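(* Let $n\ge2$, let $k$ be an integer with $1\le k\le \frac n2$, and set $s=\frac{k}{k+1}$, $\beta=\frac nk-2$, and $f_\beta(x)=-(1+|x|^2)^{-\beta/2}$, $x\in\mathbb{R}^n$. Then $$(-\Delta)^s\big[-(-\Delta)^s f_\beta\big]^k\ge 0\quad\text{in }\mathbb{R}^n$$ (in the sense of distributions).
   Context: For $s\in(0,1)$ and locally integrable $u$ with $\int_{\mathbb{R}^n}\frac{|u(x)|}{(1+|x|^2)^{(n+2s)/2}}dx<\infty$, $(-\Delta)^s u(x)=c_{s,n}\int_{\mathbb{R}^n}\frac{u(x)-u(y)}{|x-y|^{n+2s}}dy$ with a normalization constant $c_{s,n}>0$, understood in the distributional sense $\langle(-\Delta)^s u,h\rangle=\int u\,(-\Delta)^s h\,dx$, $h\in C_0^\infty(\mathbb{R}^n)$. *)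

theory Defs
  imports "HOL-Analysis.Analysis"
begin

text \<open>Smooth (C-infinity) real functions on R^n: all iterated partial derivatives
  exist everywhere (a family closed under taking partial derivatives, all of whose
  members are differentiable everywhere).\<close>
definition smooth_fun :: "(real^'n \<Rightarrow> real) \<Rightarrow> bool" where
  "smooth_fun h \<longleftrightarrow> (\<exists>S. h \<in> S \<and>
     (\<forall>f\<in>S. (\<forall>x. f differentiable (at x)) \<and>
        (\<forall>i. (\<lambda>x. frechet_derivative f (at x) (axis i 1)) \<in> S)))"

definition test_fun :: "(real^'n \<Rightarrow> real) \<Rightarrow> bool" where
  "test_fun h \<longleftrightarrow> smooth_fun h \<and> compact (closure {x. h x \<noteq> 0})"

text \<open>Normalization constant c_{s,n} = 4^s Gamma(n/2+s) / (pi^{n/2} |Gamma(-s)|).\<close>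
definition c_sn :: "real \<Rightarrow> real \<Rightarrow> real" where
  "c_sn s n = s * 4 powr s * Gamma (n/2 + s) / (pi powr (n/2) * Gamma (1 - s))"

definition fraclap :: "real \<Rightarrow> (real^'n \<Rightarrow> real) \<Rightarrow> real^'n \<Rightarrow> real" where
  "fraclap s u x = c_sn s (real (CARD('n))) *
     Lim (at_right 0) (\<lambda>e. integral\<^sup>L lborel (\<lambda>y.
        indicator {y. e < dist x y} y * (u x - u y) / norm (x - y) powr (real (CARD('n)) + 2 * s)))"

definition fraclap_distr_nonneg :: "real \<Rightarrow> (real^'n \<Rightarrow> real) \<Rightarrow> bool" where
  "fraclap_distr_nonneg s u \<longleftrightarrow>
     u \<in> borel_measurable lborel \<and>
     integrable lborel (\<lambda>x. \<bar>u x\<bar> / (1 + (norm x)\<^sup>2) powr ((real (CARD('n)) + 2 * s)/2)) \<and>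
     (\<forall>h. test_fun h \<and> (\<forall>x. 0 \<le> h x) \<longrightarrow> 0 \<le> integral\<^sup>L lborel (\<lambda>x. u x * fraclap s h x))"

end

(*
Write N for the dimension, w = (-Delta)^s (1+|x|^2)^(-beta/2), b = beta/2 + s and q = N/2 - s; the choice
of s and beta means exactly k b = q.

Writing |y|^(-N-2s) as an integral of Gaussians exp(-(t/r)|y|^2) over r > 0, with the width tied to the
parameter t of the Gaussian exp(-t|x|^2) acted upon, shows that (-Delta)^s maps the mixture
int_0^infinity t^(p-1) phi(t) exp(-t|x|^2) dt, up to a positive constant, to
  int_0^infinity r^(-1-s) int_0^infinity t^(p+s-1) exp(-t|x|^2) (phi(t) - (1+r)^(p+s-N/2) phi(t(1+r))) dt dr.

For p = beta/2 and phi(t) = exp(-t) this exhibits w as int t^(b-1) psi(t) exp(-t|x|^2) dt, where psi >= 0 is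
decreasing as soon as b <= N/2 - 1, which holds for k >= 2. Products of such mixtures are again of this form,
with exponents adding up, so w^k = int t^(q-1) theta(t) exp(-t|x|^2) dt with theta decreasing. For p = q the
factor (1+r)^(p+s-N/2) disappears, and phi(t) - phi(t(1+r)) >= 0 for decreasing phi gives (-Delta)^s w^k >= 0.

For k = 1, psi is not decreasing. But then w is a superposition over r > 0 of U(1) - (1+r)^(-s) U(1+r), where
U(c) = int t^(q-1) exp(-ct) exp(-t|x|^2) dt, and substituting r/c for r shows that c^(-s) (-Delta)^s U(c)
decreases in c.
*)

theory Submission
  imports Defs "HOL-Probability.Distributions"
begin

section \<open>Gaussian and Gamma integrals\<close>

text \<open>The choice of width rests on the parallel sum: averaging a Gaussian of parameter
  \<open>t\<close> against one of parameter \<open>l\<close> produces the parameter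
  \<open>l t / (l + t)\<close>, and for \<open>l = t / r\<close> this is \<open>t / (1 + r)\<close>.
  The operator therefore acts on densities by dilations, and a sign comes from comparing a density
  with its dilate. The power of \<open>1 + r\<close> collects the mass of the Gaussians and the
  Jacobian of the dilation; \<open>N/2 - s\<close> is the exponent at which the two cancel. The
  function w is needed pointwise, its power only as a distribution. So the exchange of integrals is
  done once for an abstract family of second differences, which is evaluated at a point in one use
  and paired with a test function in the other. The integral over \<open>r\<close> stays outermost
  until a sign is known: near \<open>r = 0\<close> the two terms of a difference are not separately
  integrable against r^(-1-s). For k = 1 the integrand of psi is exp(-t) - (1+r)^(-s) exp(-t(1+r)).
  Its slope at t = 0 is (1+r)^(1-s) - 1 > 0, which is how monotonicity is lost.\<close>

lemma distr_lborel_reflect: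
  fixes c :: "'a::euclidean_space"
  shows "distr lborel borel (\<lambda>x. c - x) = lborel"
  by (subst (2) lborel_affine[of "-1" c]) (auto simp: density_1)

lemma nn_integral_lborel_translate:
  fixes c :: "'a::euclidean_space"
  assumes [measurable]: "f \<in> borel_measurable borel"
  shows "(\<integral>\<^sup>+x. f (c + x) \<partial>lborel) = (\<integral>\<^sup>+x. f x \<partial>lborel)"
  by (subst (2) lborel_distr_plus[of c, symmetric]) (simp add: nn_integral_distr)

lemma nn_integral_lborel_scale:
  fixes f :: "'a::euclidean_space \<Rightarrow> ennreal"
  assumes [measurable]: "f \<in> borel_measurable borel" and c: "c > 0"
  shows "(\<integral>\<^sup>+x. f (c *\<^sub>R x) \<partial>lborel) = ennreal (c powr (- real DIM('a))) * (\<integral>\<^sup>+x. f x \<partial>lborel)"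
proof -
  have "(\<integral>\<^sup>+x. f x \<partial>lborel) = ennreal (c ^ DIM('a)) * (\<integral>\<^sup>+x. f (c *\<^sub>R x) \<partial>lborel)"
    using c by (subst lborel_affine[of c 0]) (simp_all add: nn_integral_density nn_integral_distr nn_integral_cmult ennreal_power)
  moreover have "ennreal (c powr (- real DIM('a))) * ennreal (c ^ DIM('a)) = 1"
    using c by (simp add: ennreal_mult[symmetric] powr_minus powr_realpow)
  ultimately show ?thesis
    by (simp add: mult.assoc[symmetric])
qed

lemma has_bochner_integral_lborel_translate_iff:
  fixes c :: "'a::euclidean_space" and f :: "'a \<Rightarrow> real"
  shows "has_bochner_integral lborel (\<lambda>x. f (c + x)) I \<longleftrightarrow> has_bochner_integral lborel f I" (is "?L = ?R")
proof -
  have *: "has_bochner_integral lborel (\<lambda>x. g (d + x)) I" if "has_bochner_integral lborel g I" 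
    for g :: "'a \<Rightarrow> real" and d
  proof -
    have [measurable]: "g \<in> borel_measurable borel"
      using that borel_measurable_integrable[of lborel g] by (auto simp: has_bochner_integral_iff)
    show ?thesis using that by (subst (asm) lborel_distr_plus[of d, symmetric]) 
      (simp add: has_bochner_integral_iff integrable_distr_eq integral_distr)
  qed
  show ?thesis using *[of f c] *[of "\<lambda>x. f (c + x)" "-c"] by auto
qed

lemma has_bochner_integral_lborel_reflect:
  fixes c :: "'a::euclidean_space" and f :: "'a \<Rightarrow> real"
  assumes "has_bochner_integral lborel f I"
  shows "has_bochner_integral lborel (\<lambda>x. f (c - x)) I"
proof -
  have [measurable]: "f \<in> borel_measurable borel"
    using assms borel_measurable_integrable[of lborel f] by (auto simp: has_bochner_integral_iff)
  show ?thesis using assms by (subst (asm) distr_lborel_reflect[of c, symmetric]) 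
    (simp add: has_bochner_integral_iff integrable_distr_eq integral_distr)
qed

lemma nn_integral_gauss_std:
  "(\<integral>\<^sup>+y. ennreal (exp (- (norm y)\<^sup>2)) \<partial>(lborel :: 'a::euclidean_space measure)) = ennreal (pi powr (DIM('a)/2))"
proof -
  have 1: "has_bochner_integral lborel (\<lambda>x::real. exp (-x\<^sup>2)) (sqrt pi)"
    using has_bochner_integral_even_function[OF gaussian_moment_0] by simp
  have 2: "(\<integral>\<^sup>+x. ennreal (exp (-x\<^sup>2)) \<partial>(lborel::real measure)) = ennreal (sqrt pi)"
    using nn_integral_eq_integral[of "lborel::real measure" "\<lambda>x. exp (-x\<^sup>2)"] 1
    by (auto simp: has_bochner_integral_iff)
  have "(\<integral>\<^sup>+y. ennreal (exp (- (norm y)\<^sup>2)) \<partial>(lborel :: 'a measure))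
     = (\<integral>\<^sup>+y. (\<Prod>b\<in>Basis. ennreal (exp (- (y \<bullet> b)\<^sup>2))) \<partial>(lborel :: 'a measure))"
  proof (intro nn_integral_cong)
    fix y :: 'a
    have "(norm y)\<^sup>2 = (\<Sum>b\<in>Basis. (y \<bullet> b)\<^sup>2)"
      unfolding power2_norm_eq_inner by (subst euclidean_inner) (simp add: power2_eq_square)
    then have "exp (- (norm y)\<^sup>2) = (\<Prod>b\<in>Basis. exp (- (y \<bullet> b)\<^sup>2))"
      by (simp add: exp_sum[symmetric] sum_negf)
    then show "ennreal (exp (- (norm y)\<^sup>2)) = (\<Prod>b\<in>Basis. ennreal (exp (- (y \<bullet> b)\<^sup>2)))"
      by (simp add: prod_ennreal)
  qed
  also have "\<dots> = (\<Prod>b\<in>(Basis::'a set). (\<integral>\<^sup>+x. ennreal (exp (-x\<^sup>2)) \<partial>(lborel::real measure)))"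
    by (intro nn_integral_lborel_prod) auto
  also have "\<dots> = ennreal (sqrt pi ^ DIM('a))"
    by (simp add: 2 ennreal_power)
  also have "sqrt pi ^ DIM('a) = pi powr (DIM('a)/2)"
    by (simp add: powr_half_sqrt[symmetric] powr_realpow[symmetric] powr_powr)
  finally show ?thesis .
qed

lemma nn_integral_gauss:
  assumes c: "c > 0"
  shows "(\<integral>\<^sup>+y. ennreal (exp (- c * (norm (z + y))\<^sup>2)) \<partial>(lborel :: 'a::euclidean_space measure)) = ennreal ((pi / c) powr (DIM('a)/2))"
proof -
  have "(\<integral>\<^sup>+y. ennreal (exp (- c * (norm (z + y))\<^sup>2)) \<partial>(lborel :: 'a measure))
     = (\<integral>\<^sup>+y. ennreal (exp (- c * (norm y)\<^sup>2)) \<partial>(lborel :: 'a measure))"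
    by (rule nn_integral_lborel_translate) simp
  also have "\<dots> = (\<integral>\<^sup>+y. ennreal (exp (- (norm (sqrt c *\<^sub>R y))\<^sup>2)) \<partial>(lborel :: 'a measure))"
    using c by (simp add: power_mult_distrib)
  also have "\<dots> = ennreal (sqrt c powr (- real DIM('a))) * ennreal (pi powr (DIM('a)/2))"
    using c by (subst nn_integral_lborel_scale) (simp_all add: nn_integral_gauss_std)
  also have "\<dots> = ennreal ((pi / c) powr (DIM('a)/2))"
    using c by (simp add: ennreal_mult[symmetric] powr_half_sqrt[symmetric] powr_powr powr_divide powr_minus field_simps)
  finally show ?thesis .
qed

lemma has_bochner_integral_gauss:
  assumes c: "c > 0"
  shows "has_bochner_integral (lborel :: 'a::euclidean_space measure) (\<lambda>y. exp (- c * (norm (z + y))\<^sup>2)) ((pi / c) powr (DIM('a)/2))"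
  by (rule has_bochner_integral_nn_integral) (use nn_integral_gauss[OF c] in auto)

lemma has_bochner_integral_gauss0:
  assumes c: "c > 0"
  shows "has_bochner_integral (lborel :: 'a::euclidean_space measure) (\<lambda>y. exp (- c * (norm y)\<^sup>2)) ((pi / c) powr (DIM('a)/2))"
  using has_bochner_integral_gauss[OF c, of 0] by simp

text \<open>Two quadratics centred at \<open>0\<close> and \<open>- x\<close> with weights
  \<open>l\<close> and \<open>t\<close> add up to one centred at the weighted mean; the constant
  left over has the parallel sum \<open>l * t / (l + t)\<close> as its coefficient.\<close>

lemma complete_square:
  fixes x y :: "'a::real_inner"
  assumes "l > 0" "t > 0"
  shows "- l * (norm y)\<^sup>2 + - t * (norm (x + y))\<^sup>2
     = - (l * t / (l + t)) * (norm x)\<^sup>2 + - (l + t) * (norm ((t / (l + t)) *\<^sub>R x + y))\<^sup>2"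
proof -
  have *: "(norm (a *\<^sub>R x + y))\<^sup>2 = a\<^sup>2 * (norm x)\<^sup>2 + 2 * a * (x \<bullet> y) + (norm y)\<^sup>2" for a
    unfolding power2_norm_eq_inner
    by (simp add: inner_add_left inner_add_right inner_commute[of y x] power2_eq_square algebra_simps)
  define z where "z = t / (l + t)"
  have z: "(l + t) * z = t" "l * t / (l + t) = l * z" using assms by (simp_all add: z_def)
  have "(l + t) * (norm (z *\<^sub>R x + y))\<^sup>2 
    = ((l + t) * z) * z * (norm x)\<^sup>2 + 2 * ((l + t) * z) * (x \<bullet> y) + (l + t) * (norm y)\<^sup>2"
    unfolding * by (simp add: power2_eq_square algebra_simps)
  moreover have "t * z * (norm x)\<^sup>2 + l * z * (norm x)\<^sup>2 = t * (norm x)\<^sup>2"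
    using z(1) by (simp add: distrib_right[symmetric] distrib_left[symmetric] add.commute mult.commute[of z])
  ultimately show ?thesis using *[of 1] unfolding z_def[symmetric] z by (simp add: algebra_simps)
qed

lemma has_bochner_integral_gauss_conv:
  fixes x :: "'a::euclidean_space"
  assumes l: "l > 0" and t: "t > 0"
  shows "has_bochner_integral lborel (\<lambda>y. exp (- l * (norm y)\<^sup>2) * exp (- t * (norm (x + y))\<^sup>2))
     ((pi / (l + t)) powr (DIM('a)/2) * exp (- (l * t / (l + t)) * (norm x)\<^sup>2))"
proof -
  have "exp (- l * (norm y)\<^sup>2) * exp (- t * (norm (x + y))\<^sup>2) 
    = exp (- (l + t) * (norm ((t / (l + t)) *\<^sub>R x + y))\<^sup>2) * exp (- (l * t / (l + t)) * (norm x)\<^sup>2)" for y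
    unfolding exp_add[symmetric] complete_square[OF l t] by (simp add: add.commute)
  then show ?thesis
    using has_bochner_integral_mult_left[OF has_bochner_integral_gauss[of "l + t" "(t / (l + t)) *\<^sub>R x"], of "exp (- (l * t / (l + t)) * (norm x)\<^sup>2)"] l t
    by simp
qed

lemma has_bochner_integral_gauss_conv_minus:
  fixes x :: "'a::euclidean_space"
  assumes l: "l > 0" and t: "t > 0"
  shows "has_bochner_integral lborel (\<lambda>y. exp (- l * (norm y)\<^sup>2) * exp (- t * (norm (x - y))\<^sup>2))
     ((pi / (l + t)) powr (DIM('a)/2) * exp (- (l * t / (l + t)) * (norm x)\<^sup>2))"
  using has_bochner_integral_lborel_reflect[OF has_bochner_integral_gauss_conv[OF l t, of x], of 0] by simp

lemma nn_integral_powr_to_inf: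
  assumes "p > 0" "B > 0"
  shows "(\<integral>\<^sup>+r. ennreal (indicator {B<..} r * r powr (- p - 1)) \<partial>lborel) = ennreal (B powr (- p) / p)"
proof -
  have "((\<lambda>r. r powr (- p - 1)) has_integral - (B powr ((- p - 1) + 1)) / ((- p - 1) + 1)) {B..}"
    using assms by (intro has_integral_powr_to_inf) auto
  then have "((\<lambda>r. r powr (- p - 1)) has_integral B powr (- p) / p) {B..}"
    using assms by simp
  from nn_integral_has_integral_lebesgue[OF _ this]
  have "(\<integral>\<^sup>+r. ennreal (indicator {B..} r * r powr (- p - 1)) \<partial>lborel) = ennreal (B powr (- p) / p)"
    by simp
  moreover have "AE r in lborel. r \<noteq> B" by (rule AE_lborel_singleton)
  then have "(\<integral>\<^sup>+r. ennreal (indicator {B..} r * r powr (- p - 1)) \<partial>lborel)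
     = (\<integral>\<^sup>+r. ennreal (indicator {B<..} r * r powr (- p - 1)) \<partial>lborel)"
    by (intro nn_integral_cong_AE) (auto elim!: eventually_mono simp: indicator_def)
  ultimately show ?thesis by simp
qed

text \<open>Write \<open>exp (- (A / r))\<close> as the integral of \<open>exp (- u)\<close> over
  \<open>u > A / r\<close> and swap: the region becomes \<open>r > A / u\<close>, the inner integral
  is that of a pure power, and \<open>Gamma (p + 1) / p\<close> is left. This does the work of the
  substitution r -> A / r.\<close>

lemma nn_integral_inverse_gamma:
  assumes p: "p > 0" and A: "A > 0"
  shows "(\<integral>\<^sup>+r. ennreal (indicator {0<..} r * r powr (- p - 1) * exp (- (A / r))) \<partial>lborel) = ennreal (Gamma p * A powr (- p))"
proof -
  have e: "ennreal (exp (- c)) = (\<integral>\<^sup>+u. ennreal (indicator {c<..} u * exp (- u)) \<partial>lborel)" for c :: real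
  proof -
    have "((\<lambda>u. exp (- 1 * u)) has_integral exp (- 1 * c) / 1) {c..}"
      by (rule has_integral_exp_minus_to_infinity) simp
    then have "(\<integral>\<^sup>+u. ennreal (indicator {c..} u * exp (- u)) \<partial>lborel) = ennreal (exp (- c))"
      using nn_integral_has_integral_lebesgue[of "{c..}" "\<lambda>u. exp (- u)" "exp (-c)"] by simp
    moreover have "AE r in lborel. r \<noteq> c" by (rule AE_lborel_singleton)
    then have "(\<integral>\<^sup>+u. ennreal (indicator {c..} u * exp (- u)) \<partial>lborel)
       = (\<integral>\<^sup>+u. ennreal (indicator {c<..} u * exp (- u)) \<partial>lborel)"
      by (intro nn_integral_cong_AE) (auto elim!: eventually_mono simp: indicator_def)
    ultimately show ?thesis by simp
  qed
  have "(\<integral>\<^sup>+r. ennreal (indicator {0<..} r * r powr (- p - 1) * exp (- (A / r))) \<partial>lborel)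
    = (\<integral>\<^sup>+r. \<integral>\<^sup>+u. ennreal (indicator {0<..} r * r powr (- p - 1)) * ennreal (indicator {A / r<..} u * exp (- u)) \<partial>lborel \<partial>lborel)"
    by (intro nn_integral_cong) (subst nn_integral_cmult, simp, subst e[symmetric], simp add: ennreal_mult)
  also have "\<dots> = (\<integral>\<^sup>+u. \<integral>\<^sup>+r. ennreal (indicator {0<..} r * r powr (- p - 1)) * ennreal (indicator {A / r<..} u * exp (- u)) \<partial>lborel \<partial>lborel)"
    by (rule lborel_pair.Fubini') (simp add: indicator_def)
  also have "\<dots> = (\<integral>\<^sup>+u. \<integral>\<^sup>+r. ennreal (indicator {0<..} u * exp (- u)) * ennreal (indicator {A / u<..} r * r powr (- p - 1)) \<partial>lborel \<partial>lborel)"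
  proof (intro nn_integral_cong)
    fix u r :: real
    have "r > 0 \<and> A / r < u \<longleftrightarrow> u > 0 \<and> A / u < r"
    proof (cases "r > 0 \<and> u > 0")
      case True
      then show ?thesis using A by (simp add: field_simps)
    next
      case False
      moreover have "A / r > 0" if "r > 0" for r using A that by simp
      ultimately show ?thesis by (smt (verit))
    qed
    then show "ennreal (indicator {0<..} r * r powr (- p - 1)) * ennreal (indicator {A / r<..} u * exp (- u))
      = ennreal (indicator {0<..} u * exp (- u)) * ennreal (indicator {A / u<..} r * r powr (- p - 1))"
      by (auto simp: indicator_def mult.commute)
  qed
  also have "\<dots> = (\<integral>\<^sup>+u. ennreal (indicator {0<..} u * exp (- u) * ((A / u) powr (- p) / p)) \<partial>lborel)"
  proof (intro nn_integral_cong)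
    fix u :: real
    show "(\<integral>\<^sup>+r. ennreal (indicator {0<..} u * exp (- u)) * ennreal (indicator {A / u<..} r * r powr (- p - 1)) \<partial>lborel)
      = ennreal (indicator {0<..} u * exp (- u) * ((A / u) powr (- p) / p))"
    proof (cases "u > 0")
      case True
      then show ?thesis
        using nn_integral_powr_to_inf[OF p, of "A / u"] A p
        by (subst nn_integral_cmult) (simp_all add: ennreal_mult[symmetric] del: ennreal_mult)
    qed simp
  qed
  also have "\<dots> = (\<integral>\<^sup>+u. ennreal (A powr (- p) / p) * ennreal (indicator {0..} u * u powr ((p + 1) - 1) / exp u) \<partial>lborel)"
    using A p by (intro nn_integral_cong)
     (auto simp: ennreal_mult[symmetric] indicator_def powr_divide powr_minus exp_minus field_simps)
  also have "\<dots> = ennreal (A powr (- p) / p) * ennreal (Gamma (p + 1))"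
    using p by (simp add: nn_integral_cmult Gamma_conv_nn_integral_real)
  also have "\<dots> = ennreal (Gamma p * A powr (- p))"
    using p Gamma_plus1[of p] by (simp add: ennreal_mult[symmetric] Gamma_real_nonneg nonpos_Ints_def field_simps)
  finally show ?thesis .
qed

lemma nn_integral_gamma_scaled:
  assumes p: "p > 0" and A: "A > 0"
  shows "(\<integral>\<^sup>+t. ennreal (indicator {0<..} t * t powr (p - 1) * exp (- A * t)) \<partial>lborel) = ennreal (Gamma p * A powr (- p))"
proof -
  have "(\<integral>\<^sup>+t. ennreal (indicator {0..} t * t powr (p - 1) / exp t) \<partial>lborel)
     = A * (\<integral>\<^sup>+t. ennreal (indicator {0..} (A * t) * (A * t) powr (p - 1) / exp (A * t)) \<partial>lborel)"
    using nn_integral_real_affine[of "\<lambda>t. ennreal (indicator {0..} t * t powr (p - 1) / exp t)" A 0] A by simp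
  also have "\<dots> = A * (\<integral>\<^sup>+t. A powr (p - 1) * ennreal (indicator {0<..} t * t powr (p - 1) * exp (- A * t)) \<partial>lborel)"
    using A by (intro arg_cong2[where f="(*)"] refl nn_integral_cong)
      (auto simp: ennreal_mult[symmetric] indicator_def powr_mult exp_minus field_simps zero_le_mult_iff)
  also have "\<dots> = A * (A powr (p - 1) * (\<integral>\<^sup>+t. ennreal (indicator {0<..} t * t powr (p - 1) * exp (- A * t)) \<partial>lborel))"
    by (simp add: nn_integral_cmult)
  finally have "ennreal (Gamma p) = ennreal (A powr p) * (\<integral>\<^sup>+t. ennreal (indicator {0<..} t * t powr (p - 1) * exp (- A * t)) \<partial>lborel)"
    unfolding Gamma_conv_nn_integral_real[OF p, symmetric] mult.assoc[symmetric]
    using A by (simp add: ennreal_mult[symmetric] powr_diff)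
  then have "ennreal (A powr (-p)) * ennreal (Gamma p) = ennreal (A powr (-p)) * ennreal (A powr p) * (\<integral>\<^sup>+t. ennreal (indicator {0<..} t * t powr (p - 1) * exp (- A * t)) \<partial>lborel)"
    by (simp add: mult.assoc)
  then show ?thesis
    using A p by (simp add: ennreal_mult[symmetric] powr_minus Gamma_real_nonneg mult.commute)
qed

section \<open>The kernel of the fractional Laplacian as a Gaussian mixture\<close>

text \<open>This is what remains of the kernel once a Gaussian in \<open>y\<close> has been
  integrated out. The integrand is of order \<open>r powr (- s)\<close> at 0 and
  \<open>r powr (- s - 1)\<close> at infinity, so \<open>s < 1\<close> and \<open>0 < s\<close>
  settle one end each.\<close>

lemma integrable_min_powr:
  fixes s :: real
  assumes s: "0 < s" "s < 1"
  shows "integrable lborel (\<lambda>r::real. indicator {0<..} r * r powr (- s - 1) * min 1 (2 * r))"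
proof -
  have "((\<lambda>r. r powr (- s)) has_integral (1 powr (- s + 1) / (- s + 1))) {0..1}"
    using s by (intro has_integral_powr_from_0) auto
  from nn_integral_has_integral_lebesgue[OF _ this]
  have 1: "(\<integral>\<^sup>+r. ennreal (indicator {0..1} r * r powr (- s)) \<partial>lborel) < \<infinity>" by simp
  have 2: "(\<integral>\<^sup>+r. ennreal (indicator {1<..} r * r powr (- s - 1)) \<partial>lborel) < \<infinity>"
    using s by (subst nn_integral_powr_to_inf) auto
  have le: "indicator {0<..} r * r powr (- s - 1) * min 1 (2 * r)
     \<le> 2 * (indicator {0..1} r * r powr (- s)) + indicator {1<..} r * r powr (- s - 1)" for r :: real
  proof -
    have "r powr (- s - 1) * r = r powr (- s)" if "r > 0"
      using that powr_add[of r "- s - 1" 1] by simp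
    moreover have "r powr (- s - 1) * min 1 (2 * r) \<le> 2 * (r powr (- s - 1) * r)"
      by (subst mult.left_commute, intro mult_left_mono) auto
    moreover have "r powr (- s - 1) * min 1 (2 * r) \<le> r powr (- s - 1) * 1"
      by (intro mult_left_mono) auto
    ultimately show ?thesis
      by (cases "r > 0"; cases "r \<le> 1") (auto simp: indicator_def)
  qed
  have "(\<integral>\<^sup>+r. ennreal (indicator {0<..} r * r powr (- s - 1) * min 1 (2 * r)) \<partial>lborel)
     \<le> (\<integral>\<^sup>+r. 2 * ennreal (indicator {0..1} r * r powr (- s)) + ennreal (indicator {1<..} r * r powr (- s - 1)) \<partial>lborel)"
  proof (intro nn_integral_mono)
    fix r :: real
    have "ennreal (indicator {0<..} r * r powr (- s - 1) * min 1 (2 * r)) \<le> ennreal (2 * (indicator {0..1} r * r powr (- s)) + indicator {1<..} r * r powr (- s - 1))"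
      by (rule ennreal_leI) (rule le)
    also have "\<dots> = ennreal (2 * (indicator {0..1} r * r powr (- s))) + ennreal (indicator {1<..} r * r powr (- s - 1))"
      by (rule ennreal_plus) auto
    also have "ennreal (2 * (indicator {0..1} r * r powr (- s))) = 2 * ennreal (indicator {0..1} r * r powr (- s))"
      by (subst ennreal_mult) auto
    finally show "ennreal (indicator {0<..} r * r powr (- s - 1) * min 1 (2 * r)) \<le> 2 * ennreal (indicator {0..1} r * r powr (- s)) + ennreal (indicator {1<..} r * r powr (- s - 1))" .
  qed
  also have "\<dots> < \<infinity>"
    using 1 2 by (subst nn_integral_add) (auto simp: nn_integral_cmult ennreal_mult_less_top)
  finally show ?thesis
    by (intro integrableI_nonneg) (auto simp: indicator_def)
qed

text \<open>The left side does not depend on \<open>t\<close>. The parameter is kept free so that it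
  can be identified with that of the Gaussian on which the kernel acts.\<close>

lemma powr_conv_inverse_gamma:
  fixes y :: "'a::euclidean_space"
  assumes "p > 0" "y \<noteq> 0" "t > 0"
  shows "ennreal (Gamma p * norm y powr (- (2 * p)))
     = (\<integral>\<^sup>+r. ennreal (indicator {0<..} r * (t powr p * r powr (- p - 1) * exp (- (t / r) * (norm y)\<^sup>2))) \<partial>lborel)"
proof -
  have "(\<integral>\<^sup>+r. ennreal (indicator {0<..} r * (t powr p * r powr (- p - 1) * exp (- (t / r) * (norm y)\<^sup>2))) \<partial>lborel)
    = (\<integral>\<^sup>+r. ennreal (t powr p) * ennreal (indicator {0<..} r * r powr (- p - 1) * exp (- (t * (norm y)\<^sup>2 / r))) \<partial>lborel)"
    by (intro nn_integral_cong) (simp add: ennreal_mult[symmetric] mult_ac)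
  also have "\<dots> = ennreal (t powr p) * ennreal (Gamma p * (t * (norm y)\<^sup>2) powr (- p))"
    using assms by (subst nn_integral_cmult) (simp_all add: nn_integral_inverse_gamma)
  also have "\<dots> = ennreal (Gamma p * (t powr p * (t * (norm y)\<^sup>2) powr (- p)))"
    using assms by (simp add: ennreal_mult[symmetric] Gamma_real_nonneg mult_ac)
  also have "t powr p * (t * (norm y)\<^sup>2) powr (- p) = norm y powr (- (2 * p))"
    using assms by (simp add: powr_mult powr_minus powr_powr[of "norm y" 2, symmetric] powr_numeral)
  finally show ?thesis ..
qed

text \<open>The usual weight for Levy measures: it tames the kernel at 0, leaves it alone at
  infinity, and bounds all second differences below up to a constant.\<close>

definition min_sq :: "'a::euclidean_space \<Rightarrow> real" where
  "min_sq y = min 1 ((norm y)\<^sup>2)"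

lemma min_sq_nonneg [simp]: "0 \<le> min_sq y" by (simp add: min_sq_def)

lemma borel_measurable_min_sq [measurable]: "min_sq \<in> borel_measurable borel"
  unfolding min_sq_def[abs_def] by measurable

text \<open>Instead of polar coordinates: expand the kernel into Gaussians with
  \<open>t = 1\<close>, put \<open>r\<close> outside by Tonelli, and integrate each Gaussian in
  \<open>y\<close> exactly.\<close>

lemma integrable_levy_kernel:
  fixes s :: real
  assumes s: "0 < s" "s < 1"
  shows "integrable lborel (\<lambda>y::'a::euclidean_space. min_sq y * norm y powr (- (real DIM('a) + 2 * s)))"
proof -
  define p where "p = DIM('a) / 2 + s"
  have p: "p > 0" "- (real DIM('a) + 2 * s) = - (2 * p)" using s by (auto simp: p_def add_pos_pos)
  have G: "Gamma p > 0" using p by simp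
  \<comment> \<open>Half of the exponent is spent on trading \<open>min_sq y\<close> for
    \<open>min 1 (2 * r)\<close>, by \<open>z * exp (- z) <= 1\<close>; the other half keeps the
    Gaussian integrable in \<open>y\<close>.\<close>
  have bd: "min_sq y * exp (- (1 / r) * (norm y)\<^sup>2) \<le> min 1 (2 * r) * exp (- (1 / (2 * r)) * (norm y)\<^sup>2)"
    if "r > 0" for y :: 'a and r :: real
  proof -
    define z where "z = (norm y)\<^sup>2 / (2 * r)"
    have z: "z \<ge> 0" "(norm y)\<^sup>2 = 2 * r * z" using that by (simp_all add: z_def)
    have "exp (- z) * z \<le> 1" using exp_ge_add_one_self[of z] by (simp add: exp_minus divide_le_eq divide_inverse[symmetric] mult.commute[of _ z] del: exp_ge_add_one_self)
    moreover have "min 1 (2 * r * z) * exp (- z) \<le> 1 * 1" using z that by (intro mult_mono) auto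
    moreover have "min 1 (2 * r * z) * exp (- z) \<le> 2 * r * (z * exp (- z))" using z that by simp
    ultimately have "min 1 (2 * r * z) * exp (- z) \<le> min 1 (2 * r)"
      using that by (smt (verit) mult.commute mult_left_le)
    then have "min 1 (2 * r * z) * exp (- z) * exp (- z) \<le> min 1 (2 * r) * exp (- z)"
      by (intro mult_right_mono) auto
    moreover have "exp (- (1 / r) * (norm y)\<^sup>2) = exp (- z) * exp (- z)" "exp (- (1 / (2 * r)) * (norm y)\<^sup>2) = exp (- z)"
      using that unfolding z exp_add[symmetric] by simp_all
    ultimately show ?thesis unfolding min_sq_def z(2) by (simp add: mult.assoc)
  qed
  have "Gamma p * (\<integral>\<^sup>+y. ennreal (min_sq y * norm y powr (- (2 * p))) \<partial>(lborel :: 'a measure))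
     = (\<integral>\<^sup>+y. ennreal (min_sq y) * ennreal (Gamma p * norm y powr (- (2 * p))) \<partial>(lborel :: 'a measure))"
    using G by (subst nn_integral_cmult[symmetric]) (auto simp: ennreal_mult[symmetric] mult_ac intro!: nn_integral_cong)
  also have "\<dots> = (\<integral>\<^sup>+y. ennreal (min_sq y) * (\<integral>\<^sup>+r. ennreal (indicator {0<..} r * (1 powr p * r powr (- p - 1) * exp (- (1 / r) * (norm y)\<^sup>2))) \<partial>lborel) \<partial>(lborel :: 'a measure))"
  proof (intro nn_integral_cong)
    fix y :: 'a
    show "ennreal (min_sq y) * ennreal (Gamma p * norm y powr (- (2 * p)))
      = ennreal (min_sq y) * (\<integral>\<^sup>+r. ennreal (indicator {0<..} r * (1 powr p * r powr (- p - 1) * exp (- (1 / r) * (norm y)\<^sup>2))) \<partial>lborel)"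
      using powr_conv_inverse_gamma[of p y 1] p by (cases "y = 0") (auto simp: min_sq_def)
  qed
  also have "\<dots> = (\<integral>\<^sup>+y. (\<integral>\<^sup>+r. ennreal (indicator {0<..} r * r powr (- p - 1) * (min_sq y * exp (- (1 / r) * (norm y)\<^sup>2))) \<partial>lborel) \<partial>(lborel :: 'a measure))"
    by (subst nn_integral_cmult[symmetric]) (auto simp: ennreal_mult[symmetric] mult_ac intro!: nn_integral_cong)
  also have "\<dots> = (\<integral>\<^sup>+r. (\<integral>\<^sup>+y. ennreal (indicator {0<..} r * r powr (- p - 1) * (min_sq y * exp (- (1 / r) * (norm y)\<^sup>2))) \<partial>(lborel :: 'a measure)) \<partial>lborel)"
    by (rule lborel_pair.Fubini') simp
  also have "\<dots> \<le> (\<integral>\<^sup>+r. (\<integral>\<^sup>+y. ennreal (indicator {0<..} r * r powr (- p - 1) * min 1 (2 * r)) * ennreal (exp (- (1 / (2 * r)) * (norm y)\<^sup>2)) \<partial>(lborel :: 'a measure)) \<partial>lborel)"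
  proof (intro nn_integral_mono)
    fix r :: real and y :: 'a
    show "ennreal (indicator {0<..} r * r powr (- p - 1) * (min_sq y * exp (- (1 / r) * (norm y)\<^sup>2)))
       \<le> ennreal (indicator {0<..} r * r powr (- p - 1) * min 1 (2 * r)) * ennreal (exp (- (1 / (2 * r)) * (norm y)\<^sup>2))"
      using bd[of r y] by (cases "r > 0") (simp_all add: ennreal_mult'[symmetric] mult.assoc del: ennreal_mult ennreal_mult')
  qed
  also have "\<dots> = (\<integral>\<^sup>+r. ennreal ((2 * pi) powr (DIM('a)/2)) * ennreal (indicator {0<..} r * r powr (- s - 1) * min 1 (2 * r)) \<partial>lborel)"
  proof (intro nn_integral_cong)
    fix r :: real
    show "(\<integral>\<^sup>+y. ennreal (indicator {0<..} r * r powr (- p - 1) * min 1 (2 * r)) * ennreal (exp (- (1 / (2 * r)) * (norm y)\<^sup>2)) \<partial>(lborel :: 'a measure))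
      = ennreal ((2 * pi) powr (DIM('a)/2)) * ennreal (indicator {0<..} r * r powr (- s - 1) * min 1 (2 * r))"
    proof (cases "r > 0")
      case True
      have "r powr (- p - 1) * r powr (DIM('a)/2) = r powr (- s - 1)"
        by (simp add: powr_add[symmetric] p_def)
      then show ?thesis
        using True nn_integral_gauss[of "1 / (2 * r)" "0::'a"]
        by (subst nn_integral_cmult) (auto simp: ennreal_mult[symmetric] powr_mult mult_ac)
    qed simp
  qed
  also have "\<dots> < \<infinity>"
    using integrable_min_powr[OF s] by (subst nn_integral_cmult) 
      (auto simp: ennreal_mult_less_top nn_integral_eq_integral indicator_def)
  finally have "(\<integral>\<^sup>+y. ennreal (min_sq y * norm y powr (- (2 * p))) \<partial>(lborel :: 'a measure)) < \<infinity>"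
    using G by (auto simp: ennreal_mult_less_top)
  then show ?thesis unfolding p(2)
    by (intro integrableI_nonneg) auto
qed


text \<open>\<open>T (t, y)\<close> stands for the second difference in direction \<open>y\<close>
  of the Gaussian of parameter \<open>t\<close>, and \<open>\<eta> t\<close> for its value;
  hypothesis \<open>T\<close> records how they average against Gaussians. With
  \<open>l = t / r\<close> the second \<open>\<eta>\<close> is taken at \<open>t / (1 + r)\<close>,
  and a dilation of \<open>t\<close> passes the factor \<open>1 + r\<close> on to
  \<open>\<phi>\<close>. The two instances are evaluation at a point and pairing with a test
  function.\<close>

lemma levy_kernel_fubini:
  fixes T :: "real \<times> 'a::euclidean_space \<Rightarrow> real" and \<phi> \<eta> :: "real \<Rightarrow> real"
  assumes s: "0 < s"
    and T_meas: "T \<in> borel_measurable borel"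
    and \<phi>_meas [measurable]: "\<phi> \<in> borel_measurable borel"
    and \<eta>_meas [measurable]: "\<eta> \<in> borel_measurable borel"
    and T: "\<And>t l. t > 0 \<Longrightarrow> l > 0 \<Longrightarrow> has_bochner_integral lborel (\<lambda>y. exp (- l * (norm y)\<^sup>2) * T (t, y))
        (2 * (pi / l) powr (DIM('a)/2) * \<eta> t - 2 * (pi / (l + t)) powr (DIM('a)/2) * \<eta> (l * t / (l + t)))"
    and int: "integrable lborel (\<lambda>(t, y). indicator {0<..} t * t powr (q - 1) * \<phi> t * T (t, y) * norm y powr (- (real DIM('a) + 2 * s)))"
    and \<eta>: "\<And>r. r \<ge> 0 \<Longrightarrow> integrable lborel (\<lambda>t. indicator {0<..} t * t powr (q + s - 1) * \<eta> t * \<phi> (t * (1 + r)))"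
  defines "I \<equiv> \<lambda>r. \<integral>t. indicator {0<..} t * t powr (q + s - 1) * \<eta> t *
        (\<phi> t - (1 + r) powr (q + s - DIM('a)/2) * \<phi> (t * (1 + r))) \<partial>lborel"
  shows "integrable lborel (\<lambda>r. indicator {0<..} r * r powr (- s - 1) * I r)"
    and "Gamma (DIM('a)/2 + s) * (\<integral>(t, y). indicator {0<..} t * t powr (q - 1) * \<phi> t * T (t, y) * norm y powr (- (real DIM('a) + 2 * s)) \<partial>lborel)
       = 2 * pi powr (DIM('a)/2) * (\<integral>r. indicator {0<..} r * r powr (- s - 1) * I r \<partial>lborel)"
proof -
  define p where "p = DIM('a) / 2 + s"
  have p: "p > 0" "- (real DIM('a) + 2 * s) = - (2 * p)" using s by (auto simp: p_def add_pos_pos)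
  have G: "Gamma p > 0" using p by simp
  define H where "H = (\<lambda>(t, y). indicator {0<..} t * t powr (q - 1) * \<phi> t * T (t, y))"
  define K where "K = (\<lambda>t y r. indicator {0<..} r * (t powr p * r powr (- p - 1) * exp (- (t / r) * (norm (y::'a))\<^sup>2)))"
  have [measurable]: "T \<in> borel_measurable (borel \<Otimes>\<^sub>M borel)" using T_meas by (simp add: borel_prod)
  have H_meas: "H \<in> borel_measurable (borel \<Otimes>\<^sub>M borel)" unfolding H_def by measurable
  note H_meas [measurable]
  define F where "F = (\<lambda>z. H (fst z) * K (fst (fst z)) (snd (fst z)) (snd z))"
  have [measurable]: "F \<in> borel_measurable borel" 
    unfolding F_def K_def borel_prod[symmetric] by measurable
  note H_meas [measurable del]
  have [measurable]: "H \<in> borel_measurable borel" using H_meas by (simp add: borel_prod)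
  have [measurable]: "snd \<in> borel_measurable (borel :: (real \<times> 'a) measure)"
    unfolding borel_prod[symmetric] by measurable
  have K0: "K t y r \<ge> 0" for t y r by (simp add: K_def)
  have int': "integrable lborel (\<lambda>(t, y). H (t, y) * norm y powr (- (2 * p)))"
    using int unfolding H_def p(2) by (simp add: split_def)
  have K: "(\<integral>\<^sup>+r. ennreal (K t y r) \<partial>lborel) = ennreal (Gamma p * norm y powr (- (2 * p)))" if "t > 0" "y \<noteq> 0" for t y
    using powr_conv_inverse_gamma[OF p(1) that(2,1)] by (simp add: K_def)
  \<comment> \<open>At \<open>y = 0\<close> the identity \<open>K\<close> breaks down: the integral
    over \<open>r\<close> diverges, while \<open>norm 0 powr _\<close> is 0. This slice is a null
    set.\<close>
  have ae: "AE z in (lborel :: (real \<times> 'a) measure). snd z \<noteq> 0"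
    unfolding lborel_prod[symmetric]
  proof (rule lborel_pair.AE_pair_measure)
    show "{z \<in> space (lborel \<Otimes>\<^sub>M lborel). snd z \<noteq> (0::'a)} \<in> sets ((lborel :: real measure) \<Otimes>\<^sub>M lborel)"
      by measurable
  qed (auto simp: AE_lborel_singleton)
  have HK: "(\<integral>\<^sup>+r. ennreal \<bar>F (z, r)\<bar> \<partial>lborel) = ennreal (Gamma p) * ennreal \<bar>H z * norm (snd z) powr (- (2 * p))\<bar>" if "snd z \<noteq> 0" for z
  proof (cases "fst z > 0")
    case True
    have "(\<integral>\<^sup>+r. ennreal \<bar>F (z, r)\<bar> \<partial>lborel) = (\<integral>\<^sup>+r. ennreal \<bar>H z\<bar> * ennreal (K (fst z) (snd z) r) \<partial>lborel)"
      by (simp add: F_def split_def abs_mult K0 ennreal_mult)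
    also have "\<dots> = ennreal \<bar>H z\<bar> * ennreal (Gamma p * norm (snd z) powr (- (2 * p)))"
      using K[OF True that] by (subst nn_integral_cmult) (auto simp: K_def)
    finally show ?thesis using G by (simp add: ennreal_mult[symmetric] abs_mult mult_ac)
  next
    case False
    then have "H z = 0" by (simp add: H_def split_def)
    then show ?thesis by (simp add: F_def split_def)
  qed
  have F_int: "integrable lborel F"
  proof (rule integrableI_bounded)
    have "(\<integral>\<^sup>+x. ennreal (norm (F x)) \<partial>lborel) = (\<integral>\<^sup>+z. \<integral>\<^sup>+r. ennreal \<bar>F (z, r)\<bar> \<partial>lborel \<partial>lborel)"
      by (subst lborel_prod[symmetric], subst lborel.nn_integral_fst[symmetric]) (auto simp: lborel_prod)
    also have "\<dots> = (\<integral>\<^sup>+z. ennreal (Gamma p) * ennreal \<bar>H z * norm (snd z) powr (- (2 * p))\<bar> \<partial>lborel)"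
      using ae by (intro nn_integral_cong_AE) (auto elim!: eventually_mono simp: HK)
    also have "\<dots> < \<infinity>"
      using int' by (subst nn_integral_cmult) (auto simp: integrable_iff_bounded split_def ennreal_mult_less_top)
    finally show "(\<integral>\<^sup>+x. ennreal (norm (F x)) \<partial>lborel) < \<infinity>" .
  qed simp
  have F_int': "integrable (lborel \<Otimes>\<^sub>M lborel) F" using F_int by (simp add: lborel_prod)
  have 1: "(\<integral>r. F (z, r) \<partial>lborel) = Gamma p * (H z * norm (snd z) powr (- (2 * p)))" if "snd z \<noteq> 0" for z
  proof (cases "fst z > 0")
    case True
    have "(\<integral>r. K (fst z) (snd z) r \<partial>lborel) = Gamma p * norm (snd z) powr (- (2 * p))"
      using K[OF True that] G by (intro integral_eq_nn_integral[THEN trans]) (auto simp: K_def)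
    then show ?thesis by (simp add: F_def split_def)
  next
    case False
    then have "H z = 0" by (simp add: H_def split_def)
    then show ?thesis by (simp add: F_def split_def)
  qed
  have "Gamma p * (\<integral>z. H z * norm (snd z) powr (- (2 * p)) \<partial>lborel) = (\<integral>z. \<integral>r. F (z, r) \<partial>lborel \<partial>lborel)"
    unfolding integral_mult_right_zero[symmetric] 
    using ae by (intro integral_cong_AE) (auto elim!: eventually_mono simp: 1)
  also have "\<dots> = (\<integral>r. \<integral>z. F (z, r) \<partial>lborel \<partial>lborel)"
    using lborel_pair.Fubini_integral[of "\<lambda>z r. F (z, r)"] F_int' by simp
  finally have 2: "Gamma p * (\<integral>z. H z * norm (snd z) powr (- (2 * p)) \<partial>lborel) = (\<integral>r. \<integral>z. F (z, r) \<partial>lborel \<partial>lborel)" .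
  have int_r: "integrable lborel (\<lambda>r. \<integral>z. F (z, r) \<partial>lborel)"
    using lborel_pair.integrable_snd[of "\<lambda>z r. F (z, r)"] F_int' by simp
  have ae_r: "AE r in lborel. integrable lborel (\<lambda>z. F (z, r))"
    using lborel_pair.AE_integrable_snd[of "\<lambda>z r. F (z, r)"] F_int' by simp
  \<comment> \<open>Fubini provides integrable slices for almost every \<open>r\<close>, which is
    enough because the identity is integrated over \<open>r\<close> afterwards.\<close>
  have I: "(\<integral>z. F (z, r) \<partial>lborel) = 2 * pi powr (DIM('a)/2) * (indicator {0<..} r * r powr (- s - 1) * I r)"
    if "integrable lborel (\<lambda>z. F (z, r))" for r
  proof (cases "r > 0")
    case False
    then show ?thesis by (simp add: F_def K_def split_def)
  next
    case True
    let ?D = "real DIM('a) / 2"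
    \<comment> \<open>The second term before the dilation, with \<open>\<eta>\<close> still at
      \<open>t / (1 + r)\<close>. Its integrability and its integral are read off at
      \<open>(1 + r) * t\<close>, where the hypothesis on \<open>\<eta>\<close> applies.\<close>
    let ?g = "\<lambda>t. indicator {0<..} t * t powr (q + s - 1) * \<phi> t * \<eta> (t * inverse (1 + r))"
    have g: "?g ((1 + r) * t) = (1 + r) powr (q + s - 1) * (indicator {0<..} t * t powr (q + s - 1) * \<eta> t * \<phi> (t * (1 + r)))" for t
      using True by (cases "t > 0") (auto simp: powr_mult mult_ac zero_less_mult_iff)
    have g_int: "integrable lborel ?g"
      using \<eta>[of r] True lborel_integrable_real_affine_iff[of "1 + r" ?g 0] by (simp add: g)
    have "(\<integral>z. F (z, r) \<partial>lborel) = (\<integral>t. \<integral>y. F ((t, y), r) \<partial>lborel \<partial>lborel)"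
      using that by (subst lborel_prod[symmetric], subst lborel_pair.integral_fst'[symmetric]) (simp_all add: lborel_prod)
    also have "\<dots> = (\<integral>t. 2 * pi powr ?D * r powr (- s - 1) * 
        (indicator {0<..} t * t powr (q + s - 1) * \<eta> t * \<phi> t - (1 + r) powr (- ?D) * ?g t) \<partial>lborel)"
    proof (intro Bochner_Integration.integral_cong refl)
      fix t :: real
      show "(\<integral>y. F ((t, y), r) \<partial>lborel) = 2 * pi powr ?D * r powr (- s - 1) * 
        (indicator {0<..} t * t powr (q + s - 1) * \<eta> t * \<phi> t - (1 + r) powr (- ?D) * ?g t)"
      proof (cases "t > 0")
        case False
        then show ?thesis by (simp add: F_def H_def)
      next
        case t: True
        have "(\<integral>y. F ((t, y), r) \<partial>lborel) = (\<integral>y. t powr (q - 1) * \<phi> t * t powr p * r powr (- p - 1) * (exp (- (t / r) * (norm y)\<^sup>2) * T (t, y)) \<partial>lborel)"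
          using t True by (simp add: F_def H_def K_def mult_ac)
        also have "\<dots> = t powr (q - 1) * \<phi> t * t powr p * r powr (- p - 1) * (2 * (pi / (t / r)) powr ?D * \<eta> t - 2 * (pi / (t / r + t)) powr ?D * \<eta> (t / r * t / (t / r + t)))"
          using T[of t "t / r"] t True by (simp add: has_bochner_integral_iff)
        also have "t / r * t / (t / r + t) = t * inverse (1 + r)"
        proof -
          have "t / r + t = t * (1 + r) / r" using True by (simp add: field_simps)
          then show ?thesis using t True by (simp add: inverse_eq_divide)
        qed
        also have "(pi / (t / r)) powr ?D = pi powr ?D * (r powr ?D * t powr (- ?D))"
          using t True by (simp add: powr_divide powr_mult powr_minus field_simps)
        also have "pi / (t / r + t) = pi * (r * (inverse t * inverse (1 + r)))"
        proof -
          have "t / r + t = t * (1 + r) / r" using True by (simp add: field_simps)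
          then show ?thesis using t True by (simp add: inverse_eq_divide)
        qed
        also have "(pi * (r * (inverse t * inverse (1 + r)))) powr ?D = pi powr ?D * (r powr ?D * t powr (- ?D)) * (1 + r) powr (- ?D)"
          using t True by (simp add: powr_mult powr_minus inverse_powr)
        finally have "(\<integral>y. F ((t, y), r) \<partial>lborel) = 2 * pi powr ?D * (r powr (- p - 1) * r powr ?D) * (t powr (q - 1) * t powr p * t powr (- ?D)) * 
           (\<phi> t * \<eta> t - (1 + r) powr (- ?D) * (\<phi> t * \<eta> (t * inverse (1 + r))))"
          by (simp add: algebra_simps)
        also have "r powr (- p - 1) * r powr ?D = r powr (- s - 1)"
          by (simp add: powr_add[symmetric] p_def)
        also have "t powr (q - 1) * t powr p * t powr (- ?D) = t powr (q + s - 1)"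
          by (simp add: powr_add[symmetric] p_def add_diff_eq)
        finally show ?thesis using t by (simp add: algebra_simps)
      qed
    qed
    also have "\<dots> = 2 * pi powr ?D * r powr (- s - 1) * ((\<integral>t. indicator {0<..} t * t powr (q + s - 1) * \<eta> t * \<phi> t \<partial>lborel) - (1 + r) powr (- ?D) * (\<integral>t. ?g t \<partial>lborel))"
      using \<eta>[of 0] g_int by simp
    \<comment> \<open>One factor \<open>1 + r\<close> is the Jacobian, the others come from
      \<open>t powr (q + s - 1)\<close>. Together with the Gaussian mass
      \<open>(1 + r) powr (- ?D)\<close> they form the power that appears in
      \<open>I\<close>.\<close>
    also have "(\<integral>t. ?g t \<partial>lborel) = (1 + r) powr (q + s) * (\<integral>t. indicator {0<..} t * t powr (q + s - 1) * \<eta> t * \<phi> (t * (1 + r)) \<partial>lborel)"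
    proof -
      have "(\<integral>t. ?g t \<partial>lborel) = (1 + r) * (\<integral>t. ?g ((1 + r) * t) \<partial>lborel)"
        using lborel_integral_real_affine[of "1 + r" ?g 0] True by simp
      moreover have "(1 + r) * (1 + r) powr (q + s - 1) = (1 + r) powr (q + s)"
        using True powr_add[of "1 + r" 1 "q + s - 1"] by simp
      moreover have "(\<integral>t. ?g ((1 + r) * t) \<partial>lborel)
        = (1 + r) powr (q + s - 1) * (\<integral>t. indicator {0<..} t * t powr (q + s - 1) * \<eta> t * \<phi> (t * (1 + r)) \<partial>lborel)"
        unfolding g by (rule integral_mult_right_zero)
      moreover have "a = e * f" if "a = b * c" "b * d = e" "c = d * f" for a b c d e f :: real
        using that by auto
      ultimately show ?thesis by blast
    qed
    also have "(\<integral>t. indicator {0<..} t * t powr (q + s - 1) * \<eta> t * \<phi> t \<partial>lborel) - (1 + r) powr (- ?D) * ((1 + r) powr (q + s) * (\<integral>t. indicator {0<..} t * t powr (q + s - 1) * \<eta> t * \<phi> (t * (1 + r)) \<partial>lborel)) = I r"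
    proof -
      have "I r = (\<integral>t. indicator {0<..} t * t powr (q + s - 1) * \<eta> t * \<phi> t - (1 + r) powr (q + s - ?D) * (indicator {0<..} t * t powr (q + s - 1) * \<eta> t * \<phi> (t * (1 + r))) \<partial>lborel)"
        unfolding I_def by (intro Bochner_Integration.integral_cong refl) (simp add: algebra_simps)
      moreover have "(1 + r) powr (q + s - ?D) = (1 + r) powr (- ?D) * (1 + r) powr (q + s)"
        by (simp add: powr_add[symmetric])
      ultimately show ?thesis using \<eta>[of 0] \<eta>[of r] True by simp
    qed
    finally show ?thesis using True by simp
  qed
  have ae_I: "AE r in lborel. (\<integral>z. F (z, r) \<partial>lborel) = 2 * pi powr (DIM('a)/2) * (indicator {0<..} r * r powr (- s - 1) * I r)"
    using ae_r by eventually_elim (rule I)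
  have [measurable]: "(\<lambda>r. indicator {0<..} r * r powr (- s - 1) * I r) \<in> borel_measurable borel"
    unfolding I_def by measurable
  have "integrable lborel (\<lambda>r. 2 * pi powr (DIM('a)/2) * (indicator {0<..} r * r powr (- s - 1) * I r))"
    using int_r by (subst integrable_cong_AE[OF _ _ ae_I, symmetric]) auto
  then show "integrable lborel (\<lambda>r. indicator {0<..} r * r powr (- s - 1) * I r)"
    by simp
  have "(\<integral>r. \<integral>z. F (z, r) \<partial>lborel \<partial>lborel) = (\<integral>r. 2 * pi powr (DIM('a)/2) * (indicator {0<..} r * r powr (- s - 1) * I r) \<partial>lborel)"
    using ae_I int_r by (intro integral_cong_AE) auto
  then show "Gamma (DIM('a)/2 + s) * (\<integral>(t, y). indicator {0<..} t * t powr (q - 1) * \<phi> t * T (t, y) * norm y powr (- (real DIM('a) + 2 * s)) \<partial>lborel)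
       = 2 * pi powr (DIM('a)/2) * (\<integral>r. indicator {0<..} r * r powr (- s - 1) * I r \<partial>lborel)"
    using 2 unfolding p(2) H_def by (simp add: p_def split_def)
qed

section \<open>Second differences\<close>

abbreviation sdiff :: "('a::euclidean_space \<Rightarrow> real) \<Rightarrow> 'a \<Rightarrow> 'a \<Rightarrow> real" where
  "sdiff u x y \<equiv> 2 * u x - u (x + y) - u (x - y)"

text \<open>The kernel is even, so averaging the truncated integral over \<open>y\<close> and
  \<open>- y\<close> replaces \<open>u x - u (x + y)\<close> by half the second difference. The
  \<open>min_sq\<close> bound then gives absolute convergence, and the limit in
  \<open>fraclap\<close> is a case of dominated convergence.\<close>

lemma fraclap_eq_sdiff:
  fixes u :: "real^'n \<Rightarrow> real"
  assumes s: "0 < s" "s < 1"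
    and u_meas [measurable]: "u \<in> borel_measurable borel"
    and B: "\<And>y. \<bar>u y\<bar> \<le> B"
    and M: "\<And>y. \<bar>sdiff u x y\<bar> \<le> M * min_sq y"
  shows "integrable lborel (\<lambda>y. sdiff u x y * norm y powr (- (real CARD('n) + 2 * s)))"
    and "fraclap s u x = c_sn s (real CARD('n)) / 2 * (\<integral>y. sdiff u x y * norm y powr (- (real CARD('n) + 2 * s)) \<partial>lborel)"
proof -
  define k where "k = (\<lambda>y::real^'n. norm y powr (- (real CARD('n) + 2 * s)))"
  have k0: "k y \<ge> 0" for y by (simp add: k_def)
  have [measurable]: "k \<in> borel_measurable borel" unfolding k_def by measurable
  have levy: "integrable lborel (\<lambda>y. min_sq y * k y)"
    using integrable_levy_kernel[OF s, where ?'a = "real^'n"] by (simp add: k_def)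
  have bd: "\<bar>sdiff u x y * k y\<bar> \<le> M * (min_sq y * k y)" for y
    using mult_right_mono[OF M[of y] k0[of y]] k0[of y] by (simp add: abs_mult mult.assoc)
  have Mint: "integrable lborel (\<lambda>y. M * (min_sq y * k y))" using levy by simp
  have int: "integrable lborel (\<lambda>y. sdiff u x y * k y)"
    by (rule Bochner_Integration.integrable_bound[OF Mint]) (use bd in \<open>auto intro!: AE_I2 order.trans[OF bd]\<close>)
  then show "integrable lborel (\<lambda>y. sdiff u x y * norm y powr (- (real CARD('n) + 2 * s)))"
    by (simp add: k_def)
  have trunc: "(\<integral>y. indicator {y. e < dist x y} y * (u x - u y) / norm (x - y) powr (real CARD('n) + 2 * s) \<partial>lborel)
     = 1 / 2 * (\<integral>y. indicator {y. e < norm y} y * (sdiff u x y * k y) \<partial>lborel)" if e: "e > 0" for e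
  proof -
    define f where "f = (\<lambda>y. indicator {y. e < norm y} y * ((u x - u (x + y)) * k y))"
    \<comment> \<open>Before symmetrisation there is no cancellation, only boundedness of
      \<open>u\<close>. Outside the ball of radius \<open>e\<close> the weight \<open>min_sq\<close>
      is at least \<open>min 1 (e^2)\<close>, so it still dominates, with a constant depending on
      \<open>e\<close>.\<close>
    have "\<bar>f y\<bar> \<le> 2 * B / min 1 (e\<^sup>2) * (min_sq y * k y)" for y
    proof (cases "e < norm y")
      case True
      have "\<bar>u x - u (x + y)\<bar> \<le> 2 * B" using B[of x] B[of "x + y"] by linarith
      moreover have "min 1 (e\<^sup>2) \<le> min_sq y"
        unfolding min_sq_def using True e by (intro min.mono power_mono) auto
      then have "1 \<le> min_sq y / min 1 (e\<^sup>2)"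
        using e by (subst le_divide_eq) auto
      moreover have "B \<ge> 0" using B[of x] by linarith
      ultimately have "\<bar>u x - u (x + y)\<bar> * 1 \<le> 2 * B * (min_sq y / min 1 (e\<^sup>2))"
        by (intro mult_mono) auto
      then show ?thesis using True mult_right_mono[OF _ k0[of y]] k0[of y] by (fastforce simp: f_def abs_mult mult_ac)
    next
      case False
      have "B \<ge> 0" using B[of x] by linarith
      then show ?thesis using False k0[of y] e by (simp add: f_def)
    qed
    then have fn: "norm (f y) \<le> norm (2 * B / min 1 (e\<^sup>2) * (min_sq y * k y))" for y
      by (metis abs_ge_self order.trans real_norm_def)
    have f_meas: "f \<in> borel_measurable lborel" unfolding f_def by measurable
    have "integrable lborel (\<lambda>y. 2 * B / min 1 (e\<^sup>2) * (min_sq y * k y))"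
      using levy by simp
    then have f_int: "integrable lborel f"
      by (rule Bochner_Integration.integrable_bound[OF _ f_meas AE_I2[OF fn]])
    have f_minus: "has_bochner_integral lborel (\<lambda>y. f (- y)) (\<integral>y. f y \<partial>lborel)"
      using has_bochner_integral_lborel_reflect[OF has_bochner_integral_integrable[OF f_int], of 0] by simp
    have "has_bochner_integral lborel (\<lambda>y. f (- x + y)) (\<integral>y. f y \<partial>lborel)"
      using has_bochner_integral_lborel_translate_iff[of f "- x" "\<integral>y. f y \<partial>lborel"] f_int
      by (simp add: has_bochner_integral_iff)
    moreover have "f (- x + y) = indicator {y. e < dist x y} y * (u x - u y) / norm (x - y) powr (real CARD('n) + 2 * s)" for y
      unfolding f_def k_def powr_minus_divide
      by (simp add: dist_norm norm_minus_commute[of x y] indicator_def)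
    ultimately have "(\<integral>y. indicator {y. e < dist x y} y * (u x - u y) / norm (x - y) powr (real CARD('n) + 2 * s) \<partial>lborel)
      = (\<integral>y. f y \<partial>lborel)"
      by (simp add: has_bochner_integral_iff)
    also have "\<dots> = 1 / 2 * (\<integral>y. f y + f (- y) \<partial>lborel)"
      using f_minus f_int by (simp add: has_bochner_integral_iff)
    also have "(\<lambda>y. f y + f (- y)) = (\<lambda>y. indicator {y. e < norm y} y * (sdiff u x y * k y))"
      by (auto simp: f_def k_def indicator_def algebra_simps fun_eq_iff)
    finally show ?thesis .
  qed
  have lim: "((\<lambda>e. \<integral>y. indicator {y. e < norm y} y * (sdiff u x y * k y) \<partial>lborel) \<longlongrightarrow> (\<integral>y. sdiff u x y * k y \<partial>lborel)) (at_right 0)"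
  proof (rule tendsto_at_right_sequentially[of 0 1])
    fix X :: "nat \<Rightarrow> real" assume X: "\<And>n. 0 < X n" "X \<longlonglongrightarrow> 0"
    show "(\<lambda>n. \<integral>y. indicator {y. X n < norm y} y * (sdiff u x y * k y) \<partial>lborel) \<longlonglongrightarrow> (\<integral>y. sdiff u x y * k y \<partial>lborel)"
    proof (rule integral_dominated_convergence[OF _ _ Mint])
      show "AE y in lborel. (\<lambda>n. indicator {y. X n < norm y} y * (sdiff u x y * k y)) \<longlonglongrightarrow> sdiff u x y * k y"
      proof (rule AE_I2)
        fix y :: "real^'n"
        show "(\<lambda>n. indicator {y. X n < norm y} y * (sdiff u x y * k y)) \<longlonglongrightarrow> sdiff u x y * k y"
        proof (cases "y = 0")
          case True
          then show ?thesis by simp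
        next
          case False
          then have "\<forall>\<^sub>F n in sequentially. X n < norm y"
            using order_tendstoD(2)[OF X(2), of "norm y"] by simp
          then have "\<forall>\<^sub>F n in sequentially. indicator {y. X n < norm y} y * (sdiff u x y * k y) = sdiff u x y * k y"
            by eventually_elim simp
          then show ?thesis by (rule tendsto_eventually)
        qed
      qed
      show "AE y in lborel. norm (indicator {y. X n < norm y} y * (sdiff u x y * k y)) \<le> M * (min_sq y * k y)" for n
        using bd order.trans[OF abs_ge_zero bd] by (intro AE_I2) (auto simp: indicator_def)
    qed measurable
  qed simp
  have "((\<lambda>e. \<integral>y. indicator {y. e < dist x y} y * (u x - u y) / norm (x - y) powr (real CARD('n) + 2 * s) \<partial>lborel)
     \<longlongrightarrow> 1 / 2 * (\<integral>y. sdiff u x y * k y \<partial>lborel)) (at_right 0)"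
    using tendsto_mult_left[OF lim, of "1 / 2"]
    by (rule Lim_transform_eventually) (auto simp: eventually_at_filter trunc)
  then show "fraclap s u x = c_sn s (real CARD('n)) / 2 * (\<integral>y. sdiff u x y * norm y powr (- (real CARD('n) + 2 * s)) \<partial>lborel)"
    unfolding fraclap_def k_def by (subst tendsto_Lim) auto
qed

section \<open>Second differences of Gaussians\<close>

lemma exp_minus_second_order:
  fixes a b :: real
  assumes "a \<ge> 0" "b \<ge> 0"
  shows "\<bar>exp (- b) - exp (- a) + exp (- a) * (b - a)\<bar> \<le> (b - a)\<^sup>2"
proof -
  define d where "d = b - a"
  have eq: "exp (- b) - exp (- a) + exp (- a) * (b - a) = exp (- a) * (exp (- d) - 1 + d)"
    by (simp add: d_def algebra_simps exp_add[symmetric])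
  have 0: "exp (- d) - 1 + d \<ge> 0" using exp_ge_add_one_self[of "- d"] by linarith
  have "exp (- a) * (exp (- d) - 1 + d) \<le> d\<^sup>2"
  proof (cases "d \<ge> 0")
    case True
    have "exp (- d) * (1 + d) \<le> exp (- d) * exp d" by (intro mult_left_mono) auto
    also have "\<dots> = 1" by (simp add: exp_add[symmetric])
    also have "1 \<le> (1 - d + d\<^sup>2) * (1 + d)"
    proof -
      have "(1 - d + d\<^sup>2) * (1 + d) = 1 + d ^ 3" by (simp add: algebra_simps power2_eq_square power3_eq_cube)
      then show ?thesis using True by simp
    qed
    finally have "exp (- d) \<le> 1 - d + d\<^sup>2" using True by simp
    then have "exp (- d) - 1 + d \<le> d\<^sup>2" by simp
    moreover have "exp (- a) * (exp (- d) - 1 + d) \<le> 1 * (exp (- d) - 1 + d)"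
      using 0 assms by (intro mult_right_mono) auto
    ultimately show ?thesis by (metis mult_1 order.trans)
  next
    case False
    define c where "c = - d"
    have c: "c > 0" using False by (simp add: c_def)
    \<comment> \<open>For \<open>b < a\<close> the term \<open>exp (- d)\<close> is unbounded;
      absorbing it into \<open>exp (- a)\<close> measures the remainder from \<open>b\<close>
      instead, where the prefactor is again at most 1.\<close>
    have "exp (- a) * (exp (- d) - 1 + d) = exp (- b) * (1 - (1 + c) * exp (- c))"
      by (simp add: c_def d_def algebra_simps exp_add[symmetric])
    also have "\<dots> \<le> 1 * (1 - (1 + c) * exp (- c))"
    proof (intro mult_right_mono)
      have "(1 + c) * exp (- c) \<le> exp c * exp (- c)" by (intro mult_right_mono) auto
      then show "0 \<le> 1 - (1 + c) * exp (- c)" by (simp add: exp_add[symmetric])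
    qed (use assms in auto)
    also have "\<dots> \<le> c\<^sup>2"
    proof -
      have "(1 + c) * (1 - c) \<le> (1 + c) * exp (- c)"
        using exp_ge_add_one_self[of "- c"] c by (intro mult_left_mono) auto
      then show ?thesis by (simp add: algebra_simps power2_eq_square)
    qed
    finally show ?thesis by (simp add: c_def)
  qed
  then show ?thesis using 0 unfolding eq by (simp add: abs_mult d_def)
qed

text \<open>For \<open>norm y <= 1\<close> the exponents at \<open>x + y\<close> and
  \<open>x - y\<close> differ from the one at \<open>x\<close> by \<open>t * (Y + w)\<close> and
  \<open>t * (Y - w)\<close>. The first-order terms in \<open>w\<close> cancel, and
  \<open>w^2\<close> is controlled by Cauchy-Schwarz. The quadratic growth in \<open>t\<close> is
  harmless against the factor \<open>exp (- t)\<close> of the bubble.\<close>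

lemma sdiff_gauss_bound:
  fixes x y :: "'a::euclidean_space"
  assumes t: "t \<ge> 0"
  shows "\<bar>sdiff (\<lambda>z. exp (- t * (norm z)\<^sup>2)) x y\<bar> \<le> (2 + 8 * (norm x)\<^sup>2) * (1 + t)\<^sup>2 * min_sq y"
proof -
  let ?e = "\<lambda>z::'a. exp (- t * (norm z)\<^sup>2)"
  define R where "R = 8 * (norm x)\<^sup>2" define Y where "Y = (norm y)\<^sup>2"
  have R: "R \<ge> 0" "Y \<ge> 0" by (simp_all add: R_def Y_def)
  have e: "0 \<le> ?e z" "?e z \<le> 1" for z using t by auto
  show ?thesis
  proof (cases "norm y \<le> 1")
    case False
    then have 1: "min_sq y = 1" by (simp add: min_sq_def)
    have "\<bar>sdiff ?e x y\<bar> \<le> 2" using e[of x] e[of "x + y"] e[of "x - y"] by linarith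
    also have "2 * 1 \<le> (2 + R) * (1 + t)\<^sup>2" using t R by (intro mult_mono) (auto simp: one_le_power)
    finally show ?thesis using 1 by (simp add: R_def)
  next
    case True
    then have Y1: "min_sq y = Y" "Y \<le> 1" by (auto simp: min_sq_def Y_def power_le_one)
    define a where "a = t * (norm x)\<^sup>2"
    define w where "w = 2 * (x \<bullet> y)"
    have n: "t * (norm (x + y))\<^sup>2 - a = t * (Y + w)" "t * (norm (x - y))\<^sup>2 - a = t * (Y - w)"
      unfolding a_def Y_def w_def power2_norm_eq_inner by (simp_all add: inner_add_left inner_add_right inner_diff_left inner_diff_right inner_commute[of y x] algebra_simps)
    have "\<bar>exp (- (t * (norm (x + y))\<^sup>2)) - exp (- a) + exp (- a) * (t * (Y + w))\<bar> \<le> (t * (Y + w))\<^sup>2"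
      using exp_minus_second_order[of a "t * (norm (x + y))\<^sup>2"] t unfolding n by (simp add: a_def)
    moreover have "\<bar>exp (- (t * (norm (x - y))\<^sup>2)) - exp (- a) + exp (- a) * (t * (Y - w))\<bar> \<le> (t * (Y - w))\<^sup>2"
      using exp_minus_second_order[of a "t * (norm (x - y))\<^sup>2"] t unfolding n by (simp add: a_def)
    moreover have "exp (- a) * (t * (Y + w)) + exp (- a) * (t * (Y - w)) = exp (- a) * (2 * t * Y)"
      by (simp add: algebra_simps)
    moreover have "exp (- a) * (2 * t * Y) \<le> 1 * (2 * t * Y)"
      using t R by (intro mult_right_mono) (simp_all add: a_def)
    moreover have "0 \<le> exp (- a) * (2 * t * Y)" using t R by simp
    ultimately have "\<bar>2 * exp (- a) - exp (- (t * (norm (x + y))\<^sup>2)) - exp (- (t * (norm (x - y))\<^sup>2))\<bar>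
      \<le> 2 * t * Y + ((t * (Y + w))\<^sup>2 + (t * (Y - w))\<^sup>2)"
      by linarith
    also have "(t * (Y + w))\<^sup>2 + (t * (Y - w))\<^sup>2 = t\<^sup>2 * (2 * (Y * Y) + 2 * w\<^sup>2)"
      by (simp add: power2_eq_square algebra_simps)
    also have "w\<^sup>2 \<le> 4 * ((norm x)\<^sup>2 * Y)"
      using Cauchy_Schwarz_ineq[of x y] by (simp add: w_def Y_def power_mult_distrib power2_norm_eq_inner)
    then have "t\<^sup>2 * (2 * (Y * Y) + 2 * w\<^sup>2) \<le> t\<^sup>2 * (2 * (1 * Y) + R * Y)"
    proof (intro mult_left_mono add_mono)
      show "Y * Y \<le> 1 * Y" using Y1(2) R by (intro mult_right_mono)
      show "2 * w\<^sup>2 \<le> R * Y" if "w\<^sup>2 \<le> 4 * ((norm x)\<^sup>2 * Y)" using that by (simp add: R_def mult_ac)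
    qed auto
    also have "2 * t * Y + t\<^sup>2 * (2 * (1 * Y) + R * Y) \<le> (2 + R) * (1 + t)\<^sup>2 * Y"
    proof -
      have "(2 + R) * (1 + t)\<^sup>2 * Y - (2 * t * Y + t\<^sup>2 * (2 * (1 * Y) + R * Y)) = (2 + R + 2 * t + 2 * R * t) * Y"
        by (simp add: power2_eq_square algebra_simps)
      moreover have "\<dots> \<ge> 0" using t R by simp
      ultimately show ?thesis by linarith
    qed
    finally show ?thesis using Y1 by (simp add: R_def a_def)
  qed
qed


section \<open>Second differences of test functions\<close>

lemma frechet_derivative_outside_support:
  fixes f :: "'a::real_normed_vector \<Rightarrow> real"
  assumes "closed K" "\<And>x. x \<notin> K \<Longrightarrow> f x = 0" "x \<notin> K"
  shows "frechet_derivative f (at x) v = 0"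
proof -
  have "((\<lambda>x. 0) has_derivative (\<lambda>v. 0)) (at x)" by simp
  then have "(f has_derivative (\<lambda>v. 0)) (at x)"
    by (rule has_derivative_transform_within_open[where s = "- K"]) (use assms in auto)
  then show ?thesis by (metis frechet_derivative_at)
qed

lemma continuous_compact_support_bounded:
  fixes f :: "'a::topological_space \<Rightarrow> real"
  assumes "compact K" "\<And>x. x \<notin> K \<Longrightarrow> f x = 0" "continuous_on UNIV f"
  obtains C where "C \<ge> 0" "\<And>x. \<bar>f x\<bar> \<le> C"
proof -
  have "compact (f ` K)"
    using assms by (intro compact_continuous_image) (auto intro: continuous_on_subset)
  then obtain C where C: "\<And>y. y \<in> f ` K \<Longrightarrow> \<bar>y\<bar> \<le> C"
    using compact_imp_bounded bounded_real by metis
  show ?thesis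
  proof (rule that[of "max C 0"])
    show "\<bar>f x\<bar> \<le> max C 0" for x
      using C[of "f x"] assms(2)[of x] by (cases "x \<in> K") auto
  qed simp
qed

lemma frechet_derivative_axis_sum:
  fixes f :: "real^'n \<Rightarrow> real"
  assumes "f differentiable at x"
  shows "frechet_derivative f (at x) v = (\<Sum>i\<in>UNIV. v $ i * frechet_derivative f (at x) (axis i 1))"
proof -
  interpret linear "frechet_derivative f (at x)"
    using assms by (rule linear_frechet_derivative)
  have "frechet_derivative f (at x) v = frechet_derivative f (at x) (\<Sum>i\<in>UNIV. (v $ i) *\<^sub>R axis i 1)"
    by (simp add: basis_expansion[of v, unfolded scalar_mult_eq_scaleR])
  also have "\<dots> = (\<Sum>i\<in>UNIV. v $ i * frechet_derivative f (at x) (axis i 1))"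
    by (simp add: sum scale)
  finally show ?thesis .
qed

text \<open>The second partial derivatives are continuous with compact support, so the first ones
  are Lipschitz. Hence the linearisation of \<open>h\<close> has an error of order
  \<open>(norm y)^2\<close> uniformly in \<open>x\<close>, and the linear parts at \<open>y\<close>
  and \<open>- y\<close> cancel.\<close>

lemma test_fun_sdiff_bound:
  fixes h :: "real^'n \<Rightarrow> real"
  assumes h: "test_fun h"
  obtains C R where "C \<ge> 0" "R > 0" "continuous_on UNIV h" "\<And>x. \<bar>h x\<bar> \<le> C" "\<And>x. norm x > R \<Longrightarrow> h x = 0"
    "\<And>x y. \<bar>sdiff h x y\<bar> \<le> C * (norm y)\<^sup>2"
proof -
  define K where "K = closure {x. h x \<noteq> 0}"
  have K: "compact K" "closed K" using h by (auto simp: test_fun_def K_def)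
  have hK: "h x = 0" if "x \<notin> K" for x
    using that closure_subset[of "{x. h x \<noteq> 0}"] by (auto simp: K_def)
  obtain R where R: "R > 0" "\<And>x. x \<in> K \<Longrightarrow> norm x \<le> R"
    using compact_imp_bounded[OF K(1)] unfolding bounded_pos by blast
  define d where "d = (\<lambda>(f::real^'n \<Rightarrow> real) i x. frechet_derivative f (at x) (axis i 1))"
  obtain S where S: "h \<in> S" "\<And>f x. f \<in> S \<Longrightarrow> f differentiable at x" "\<And>f i. f \<in> S \<Longrightarrow> d f i \<in> S"
    using h unfolding test_fun_def smooth_fun_def d_def by blast
  have dK: "d f i x = 0" if "\<And>x. x \<notin> K \<Longrightarrow> f x = 0" "x \<notin> K" for f i x
    unfolding d_def using K(2) that by (rule frechet_derivative_outside_support)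
  have cont: "continuous_on UNIV f" if "f \<in> S" for f
    using S(2)[OF that] by (simp add: continuous_on_eq_continuous_within differentiable_imp_continuous_within)
  have lip: "\<exists>L\<ge>0. \<forall>a b. \<bar>f a - f b\<bar> \<le> L * norm (a - b)" if f: "f \<in> S" "\<And>x. x \<notin> K \<Longrightarrow> f x = 0" for f
  proof -
    have "\<exists>C. C \<ge> 0 \<and> (\<forall>x. \<bar>d f i x\<bar> \<le> C)" for i
      by (rule continuous_compact_support_bounded[OF K(1), of "d f i"]) (use dK[OF f(2)] cont S(3) f in auto)
    then obtain C where C: "\<And>i. C i \<ge> 0" "\<And>i x. \<bar>d f i x\<bar> \<le> C i" by metis
    have "onorm (frechet_derivative f (at x)) \<le> (\<Sum>i\<in>UNIV. C i)" for x
    proof (rule onorm_bound)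
      fix v
      have "\<bar>frechet_derivative f (at x) v\<bar> \<le> (\<Sum>i\<in>UNIV. \<bar>v $ i * d f i x\<bar>)"
        unfolding frechet_derivative_axis_sum[OF S(2)[OF f(1)], of x v] d_def by (rule sum_abs)
      also have "\<dots> \<le> (\<Sum>i\<in>UNIV. norm v * C i)"
        unfolding abs_mult using C component_le_norm_cart[of v] by (intro sum_mono mult_mono) auto
      finally show "norm (frechet_derivative f (at x) v) \<le> (\<Sum>i\<in>UNIV. C i) * norm v"
        by (simp add: sum_distrib_left[symmetric] sum_distrib_right[symmetric] mult.commute)
    qed (use C in \<open>auto intro: sum_nonneg\<close>)
    then have "norm (f a - f b) \<le> (\<Sum>i\<in>UNIV. C i) * norm (a - b)" for a b
      by (intro differentiable_bound[where S=UNIV and f' = "\<lambda>x. frechet_derivative f (at x)"])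
        (use S(2)[OF f(1)] in \<open>auto simp: frechet_derivative_works[symmetric]\<close>)
    then show ?thesis using C by (intro exI[of _ "\<Sum>i\<in>UNIV. C i"]) (auto intro: sum_nonneg)
  qed
  have "\<exists>L. L \<ge> 0 \<and> (\<forall>a b. \<bar>d h i a - d h i b\<bar> \<le> L * norm (a - b))" for i
  proof -
    have "d h i x = 0" if "x \<notin> K" for x using that by (intro dK hK)
    then show ?thesis using lip[OF S(3)[OF S(1), of i]] by blast
  qed
  then obtain L where L: "\<And>i. L i \<ge> 0" "\<And>i a b. \<bar>d h i a - d h i b\<bar> \<le> L i * norm (a - b)" by metis
  define L' where "L' = (\<Sum>i\<in>UNIV. L i)"
  have L': "L' \<ge> 0" using L by (auto simp: L'_def intro: sum_nonneg)
  have lin: "\<bar>h (x + y) - h x - frechet_derivative h (at x) y\<bar> \<le> L' * (norm y)\<^sup>2" for x y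
  proof -
    have "norm (h (x + y) - h x - frechet_derivative h (at x) ((x + y) - x)) \<le> norm ((x + y) - x) * (L' * norm y)"
    proof (rule differentiable_bound_linearization[where S = "cball x (norm y)" and f' = "\<lambda>x. frechet_derivative h (at x)"])
      fix t :: real assume "t \<in> {0..1}"
      then have "\<bar>t\<bar> * norm y \<le> 1 * norm y" by (intro mult_right_mono) auto
      then show "x + t *\<^sub>R (x + y - x) \<in> cball x (norm y)" by (simp add: dist_norm)
    next
      fix z assume "z \<in> cball x (norm y)"
      then have z: "norm (z - x) \<le> norm y" by (simp add: dist_norm norm_minus_commute)
      show "onorm (frechet_derivative h (at z) - frechet_derivative h (at x)) \<le> L' * norm y"
      proof (rule onorm_bound)
        fix v
        have "(frechet_derivative h (at z) - frechet_derivative h (at x)) v = (\<Sum>i\<in>UNIV. v $ i * (d h i z - d h i x))"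
          using frechet_derivative_axis_sum[OF S(2)[OF S(1)], of _ v] by (simp add: d_def sum_subtractf algebra_simps)
        then have "norm ((frechet_derivative h (at z) - frechet_derivative h (at x)) v) \<le> (\<Sum>i\<in>UNIV. \<bar>v $ i * (d h i z - d h i x)\<bar>)"
          by (simp add: sum_abs)
        also have "\<dots> \<le> (\<Sum>i\<in>UNIV. norm v * (L i * norm y))"
          unfolding abs_mult
        proof (intro sum_mono mult_mono)
          fix i
          have "\<bar>d h i z - d h i x\<bar> \<le> L i * norm (z - x)" by (rule L)
          also have "\<dots> \<le> L i * norm y" using z L by (intro mult_left_mono) auto
          finally show "\<bar>d h i z - d h i x\<bar> \<le> L i * norm y" .
        qed (use component_le_norm_cart[of v] in auto)
        finally show "norm ((frechet_derivative h (at z) - frechet_derivative h (at x)) v) \<le> L' * norm y * norm v"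
          by (simp add: L'_def sum_distrib_left[symmetric] sum_distrib_right[symmetric] mult_ac)
      qed (use L' in auto)
    qed (use S(2)[OF S(1)] in \<open>auto simp: frechet_derivative_works[symmetric] intro: has_derivative_at_withinI\<close>)
    then show ?thesis by (simp add: power2_eq_square mult_ac)
  qed
  have sd: "\<bar>sdiff h x y\<bar> \<le> 2 * L' * (norm y)\<^sup>2" for x y
  proof -
    interpret linear "frechet_derivative h (at x)"
      using S(2)[OF S(1)] by (rule linear_frechet_derivative)
    show ?thesis using lin[of x y] lin[of x "- y"] by (simp add: neg abs_le_iff)
  qed
  obtain C where C: "C \<ge> 0" "\<And>x. \<bar>h x\<bar> \<le> C"
    using continuous_compact_support_bounded[OF K(1) hK cont[OF S(1)]] by blast
  show ?thesis
  proof (rule that[of "max C (2 * L')" R])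
    show "\<bar>sdiff h x y\<bar> \<le> max C (2 * L') * (norm y)\<^sup>2" for x y
      by (rule order.trans[OF sd]) (intro mult_right_mono, auto)
    show "h x = 0" if "R < norm x" for x using that R(2)[of x] hK[of x] by force
    show "\<bar>h x\<bar> \<le> max C (2 * L')" for x by (rule order.trans[OF C(2)]) simp
  qed (use C R cont[OF S(1)] in auto)
qed

section \<open>The fractional Laplacian of the bubble\<close>

lemma integrable_lborel_times:
  fixes f :: "'a::euclidean_space \<Rightarrow> real" and g :: "'b::euclidean_space \<Rightarrow> real"
  assumes f: "integrable lborel f" and g: "integrable lborel g"
  shows "integrable lborel (\<lambda>z. f (fst z) * g (snd z))"
    and "(\<integral>z. f (fst z) * g (snd z) \<partial>lborel) = (\<integral>x. f x \<partial>lborel) * (\<integral>y. g y \<partial>lborel)"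
proof -
  have [measurable]: "f \<in> borel_measurable borel" "g \<in> borel_measurable borel"
    using f g borel_measurable_integrable by fastforce+
  have "integrable (lborel \<Otimes>\<^sub>M lborel) (\<lambda>z. f (fst z) * g (snd z))"
  proof (rule lborel_pair.Fubini_integrable)
    show "integrable lborel (\<lambda>x. \<integral>y. norm (f (fst (x, y)) * g (snd (x, y))) \<partial>lborel)"
      using f by (simp add: abs_mult)
  qed (use g in auto)
  then show *: "integrable lborel (\<lambda>z. f (fst z) * g (snd z))" by (simp add: lborel_prod)
  then show "(\<integral>z. f (fst z) * g (snd z) \<partial>lborel) = (\<integral>x. f x \<partial>lborel) * (\<integral>y. g y \<partial>lborel)"
    by (subst lborel_prod[symmetric], subst lborel_pair.integral_fst'[symmetric]) (simp_all add: lborel_prod)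
qed

lemma has_bochner_integral_gamma:
  fixes p A :: real
  assumes p: "p > 0" and A: "A > 0"
  shows "has_bochner_integral lborel (\<lambda>t. indicator {0<..} t * t powr (p - 1) * exp (- A * t)) (Gamma p * A powr (- p))"
  using nn_integral_gamma_scaled[OF p A] p A
  by (intro has_bochner_integral_nn_integral) (auto simp: Gamma_real_nonneg)

text \<open>The factor \<open>(1 + t)^2\<close> is the growth permitted by
  \<open>sdiff_gauss_bound\<close>; expanding it gives Gamma integrals with exponents
  \<open>p\<close>, \<open>p + 1\<close> and \<open>p + 2\<close>.\<close>

lemma integrable_gamma_sq:
  fixes p :: real
  assumes p: "p > 0"
  shows "integrable lborel (\<lambda>t. indicator {0<..} t * t powr (p - 1) * exp (- t) * (1 + t)\<^sup>2)"
proof -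
  have i: "integrable lborel (\<lambda>t. indicator {0<..} t * t powr (p' - 1) * exp (- 1 * t))" if "p' > 0" for p' :: real
    using has_bochner_integral_gamma[OF that zero_less_one] by (simp add: has_bochner_integral_iff)
  have "integrable lborel (\<lambda>t. indicator {0<..} t * t powr (p - 1) * exp (- 1 * t)
     + 2 * (indicator {0<..} t * t powr ((p + 1) - 1) * exp (- 1 * t)) + indicator {0<..} t * t powr ((p + 2) - 1) * exp (- 1 * t))"
    using p by (intro Bochner_Integration.integrable_add integrable_mult_right i) auto
  also have "(\<lambda>t. indicator {0<..} t * t powr (p - 1) * exp (- 1 * t)
     + 2 * (indicator {0<..} t * t powr ((p + 1) - 1) * exp (- 1 * t)) + indicator {0<..} t * t powr ((p + 2) - 1) * exp (- 1 * t))
     = (\<lambda>t. indicator {0<..} t * t powr (p - 1) * exp (- t) * (1 + t)\<^sup>2)"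
  proof
    fix t :: real
    have "t powr ((p + 1) - 1) = t powr (p - 1) * t" "t powr ((p + 2) - 1) = t powr (p - 1) * t\<^sup>2" if "t > 0"
      using that powr_add[of t "p - 1" 1] powr_add[of t "p - 1" 2] by (simp_all add: powr_numeral add_ac)
    then show "indicator {0<..} t * t powr (p - 1) * exp (- 1 * t)
     + 2 * (indicator {0<..} t * t powr ((p + 1) - 1) * exp (- 1 * t)) + indicator {0<..} t * t powr ((p + 2) - 1) * exp (- 1 * t)
     = indicator {0<..} t * t powr (p - 1) * exp (- t) * (1 + t)\<^sup>2"
      by (cases "t > 0") (simp_all add: power2_eq_square algebra_simps)
  qed
  finally show ?thesis .
qed

text \<open>The averaging hypothesis of \<open>levy_kernel_fubini\<close> in the case of evaluation
  at \<open>x\<close>. By reflection the two shifted Gaussians contribute equally, whence the second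
  factor 2.\<close>

lemma has_bochner_integral_gauss_sdiff:
  fixes x :: "'a::euclidean_space"
  assumes t: "t > 0" and l: "l > 0"
  shows "has_bochner_integral lborel (\<lambda>y. exp (- l * (norm y)\<^sup>2) * sdiff (\<lambda>z. exp (- t * (norm z)\<^sup>2)) x y)
    (2 * (pi / l) powr (DIM('a)/2) * exp (- t * (norm x)\<^sup>2) - 2 * (pi / (l + t)) powr (DIM('a)/2) * exp (- (l * t / (l + t)) * (norm x)\<^sup>2))"
proof -
  have "has_bochner_integral lborel (\<lambda>y. 2 * (exp (- l * (norm y)\<^sup>2) * exp (- t * (norm x)\<^sup>2)) 
      - exp (- l * (norm y)\<^sup>2) * exp (- t * (norm (x + y))\<^sup>2) - exp (- l * (norm y)\<^sup>2) * exp (- t * (norm (x - y))\<^sup>2))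
    (2 * ((pi / l) powr (DIM('a)/2) * exp (- t * (norm x)\<^sup>2)) - (pi / (l + t)) powr (DIM('a)/2) * exp (- (l * t / (l + t)) * (norm x)\<^sup>2)
       - (pi / (l + t)) powr (DIM('a)/2) * exp (- (l * t / (l + t)) * (norm x)\<^sup>2))"
    by (intro has_bochner_integral_diff has_bochner_integral_mult_right has_bochner_integral_mult_left
       has_bochner_integral_gauss_conv[OF l t] has_bochner_integral_gauss_conv_minus[OF l t] has_bochner_integral_gauss0[OF l])
  then show ?thesis
    by (rule has_bochner_integral_cong[THEN iffD1, rotated -1]) (auto simp: algebra_simps)
qed

text \<open>With the exponent halved, \<open>\<gamma> > 0\<close> is also the exponent of the
  mixture: the bubble is the superposition of Gaussians with density
  \<open>t powr (\<gamma> - 1) * exp (- t) / Gamma \<gamma>\<close>.\<close>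

definition bubble :: "real \<Rightarrow> 'a::euclidean_space \<Rightarrow> real" where
  "bubble \<gamma> y = (1 + (norm y)\<^sup>2) powr (- \<gamma>)"

lemma borel_measurable_bubble [measurable]: "bubble \<gamma> \<in> borel_measurable borel"
  unfolding bubble_def[abs_def] by measurable

lemma has_bochner_integral_bubble:
  fixes z :: "'a::euclidean_space"
  assumes "\<gamma> > 0"
  shows "has_bochner_integral lborel (\<lambda>t. indicator {0<..} t * t powr (\<gamma> - 1) * exp (- t) * exp (- t * (norm z)\<^sup>2)) (Gamma \<gamma> * bubble \<gamma> z)"
proof -
  have "exp (- (1 + (norm z)\<^sup>2) * t) = exp (- t) * exp (- t * (norm z)\<^sup>2)" for t
    by (simp add: exp_add[symmetric] algebra_simps)
  then show ?thesis
    using has_bochner_integral_gamma[OF assms, of "1 + (norm z)\<^sup>2"] 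
    by (simp add: bubble_def add_pos_nonneg mult.assoc)
qed

text \<open>The pointwise instance of \<open>levy_kernel_fubini\<close>, with
  \<open>q = \<gamma>\<close> and \<open>\<phi> t = exp (- t)\<close>;
  \<open>(\<gamma> + s) - N/2\<close> is the exponent of \<open>1 + r\<close> that it
  produces.\<close>

lemma fraclap_bubble:
  fixes x :: "real^'n"
  assumes s: "0 < s" "s < 1" and \<gamma>: "\<gamma> > 0"
  defines "W \<equiv> \<lambda>r. \<integral>t. indicator {0<..} t * t powr (\<gamma> + s - 1) * exp (- t * (norm x)\<^sup>2)
      * (exp (- t) - (1 + r) powr (\<gamma> + s - CARD('n) / 2) * exp (- (t * (1 + r)))) \<partial>lborel"
  shows "integrable lborel (\<lambda>r. indicator {0<..} r * r powr (- s - 1) * W r)"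
    and "fraclap s (\<lambda>y. - bubble \<gamma> y) x = - (c_sn s (real CARD('n)) * pi powr (CARD('n) / 2) / (Gamma (CARD('n) / 2 + s) * Gamma \<gamma>)
       * (\<integral>r. indicator {0<..} r * r powr (- s - 1) * W r \<partial>lborel))"
proof -
  define k where "k = (\<lambda>y::real^'n. norm y powr (- (real CARD('n) + 2 * s)))"
  have k0: "k y \<ge> 0" for y by (simp add: k_def)
  have [measurable]: "k \<in> borel_measurable borel" unfolding k_def by measurable
  have levy: "integrable lborel (\<lambda>y. min_sq y * k y)"
    using integrable_levy_kernel[OF s, where ?'a = "real^'n"] by (simp add: k_def)
  define T where "T = (\<lambda>z. sdiff (\<lambda>y. exp (- fst z * (norm y)\<^sup>2)) x (snd z))"
  have [measurable]: "T \<in> borel_measurable borel"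
    unfolding T_def borel_prod[symmetric] by measurable
  define \<phi> where "\<phi> = (\<lambda>t::real. exp (- t))"
  define \<eta> where "\<eta> = (\<lambda>t. exp (- t * (norm x)\<^sup>2))"
  have [measurable]: "\<phi> \<in> borel_measurable borel" "\<eta> \<in> borel_measurable borel"
    unfolding \<phi>_def \<eta>_def by measurable
  define M where "M = 2 + 8 * (norm x)\<^sup>2"
  define J where "J = (\<lambda>t. indicator {0<..} t * t powr (\<gamma> - 1) * \<phi> t)"
  have [measurable]: "J \<in> borel_measurable borel" unfolding J_def by measurable
  have J0: "J t \<ge> 0" for t by (simp add: J_def \<phi>_def)
  have Jsq: "integrable lborel (\<lambda>t. J t * (1 + t)\<^sup>2)"
    using integrable_gamma_sq[OF \<gamma>] by (simp add: J_def \<phi>_def)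
  have bd: "\<bar>J t * T (t, y)\<bar> \<le> M * (J t * (1 + t)\<^sup>2) * min_sq y" for t y
  proof (cases "t > 0")
    case True
    have "\<bar>T (t, y)\<bar> \<le> M * (1 + t)\<^sup>2 * min_sq y"
      using sdiff_gauss_bound[of t x y] True by (simp add: T_def M_def)
    from mult_left_mono[OF this J0[of t]] show ?thesis
      using J0[of t] by (simp add: abs_mult mult_ac)
  qed (simp add: J_def)
  have int: "integrable lborel (\<lambda>z. J (fst z) * T z * k (snd z))"
  proof (rule Bochner_Integration.integrable_bound)
    show "integrable lborel (\<lambda>z. M * (J (fst z) * (1 + fst z)\<^sup>2) * (min_sq (snd z) * k (snd z)))"
      by (rule integrable_lborel_times[of "\<lambda>t. M * (J t * (1 + t)\<^sup>2)" "\<lambda>y. min_sq y * k y"]) (use Jsq levy in auto)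
    show "(\<lambda>z. J (fst z) * T z * k (snd z)) \<in> borel_measurable lborel"
    proof -
      have [measurable]: "T \<in> borel_measurable (borel \<Otimes>\<^sub>M borel)" by (simp add: borel_prod)
      have "(\<lambda>z. J (fst z) * T z * k (snd z)) \<in> borel_measurable (borel \<Otimes>\<^sub>M borel)" by measurable
      then show ?thesis by (simp add: borel_prod)
    qed
    show "AE z in lborel. norm (J (fst z) * T z * k (snd z)) \<le> norm (M * (J (fst z) * (1 + fst z)\<^sup>2) * (min_sq (snd z) * k (snd z)))"
    proof (rule AE_I2)
      fix z :: "real \<times> (real^'n)"
      have "norm (J (fst z) * T z * k (snd z)) = \<bar>J (fst z) * T z\<bar> * k (snd z)" using k0 by (simp add: abs_mult)
      also have "\<dots> \<le> M * (J (fst z) * (1 + fst z)\<^sup>2) * min_sq (snd z) * k (snd z)"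
        using mult_right_mono[OF bd[of "fst z" "snd z"] k0[of "snd z"]] by simp
      also have "\<dots> \<le> norm (M * (J (fst z) * (1 + fst z)\<^sup>2) * (min_sq (snd z) * k (snd z)))"
        by (simp add: mult.assoc)
      finally show "norm (J (fst z) * T z * k (snd z)) \<le> norm (M * (J (fst z) * (1 + fst z)\<^sup>2) * (min_sq (snd z) * k (snd z)))" .
    qed
  qed
  have Tint: "has_bochner_integral lborel (\<lambda>y. exp (- l * (norm y)\<^sup>2) * T (t, y))
        (2 * (pi / l) powr (DIM(real^'n)/2) * \<eta> t - 2 * (pi / (l + t)) powr (DIM(real^'n)/2) * \<eta> (l * t / (l + t)))"
    if "t > 0" "l > 0" for t l
    using has_bochner_integral_gauss_sdiff[OF that, of x] unfolding T_def \<eta>_def by simp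
  have \<eta>int: "integrable lborel (\<lambda>t. indicator {0<..} t * t powr (\<gamma> + s - 1) * \<eta> t * \<phi> (t * (1 + r)))" if "r \<ge> 0" for r
  proof -
    have "\<eta> t * \<phi> (t * (1 + r)) = exp (- ((norm x)\<^sup>2 + 1 + r) * t)" for t
      by (simp add: \<eta>_def \<phi>_def exp_add[symmetric] algebra_simps)
    then show ?thesis
      using has_bochner_integral_gamma[of "\<gamma> + s" "(norm x)\<^sup>2 + 1 + r"] that \<gamma> s 
      by (simp add: has_bochner_integral_iff add_pos_nonneg add_nonneg_pos mult.assoc)
  qed
  have WI: "W r = (\<integral>t. indicator {0<..} t * t powr (\<gamma> + s - 1) * \<eta> t *
        (\<phi> t - (1 + r) powr (\<gamma> + s - DIM(real^'n)/2) * \<phi> (t * (1 + r))) \<partial>lborel)" for r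
    by (simp add: W_def \<eta>_def \<phi>_def)
  have int2: "integrable lborel (\<lambda>(t, y). indicator {0<..} t * t powr (\<gamma> - 1) * \<phi> t * T (t, y) * norm y powr (- (real DIM(real^'n) + 2 * s)))"
    using int by (simp add: J_def k_def split_def)
  note core = levy_kernel_fubini[where T = T and \<phi> = \<phi> and \<eta> = \<eta> and q = \<gamma>, OF s(1) _ _ _ Tint int2 \<eta>int, folded WI]
  show "integrable lborel (\<lambda>r. indicator {0<..} r * r powr (- s - 1) * W r)"
    by (rule core(1)) auto
  have eq1: "Gamma (CARD('n)/2 + s) * (\<integral>z. J (fst z) * T z * k (snd z) \<partial>lborel)
       = 2 * pi powr (CARD('n)/2) * (\<integral>r. indicator {0<..} r * r powr (- s - 1) * W r \<partial>lborel)"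
    using core(2) by (simp add: J_def k_def split_def)
  \<comment> \<open>Integrating over \<open>t\<close> before \<open>y\<close> turns the Gaussian
    second differences back into those of the bubble, which connects the double integral with
    \<open>fraclap\<close>.\<close>
  have Tt: "has_bochner_integral lborel (\<lambda>t. J t * T (t, y)) (Gamma \<gamma> * sdiff (bubble \<gamma>) x y)" for y
  proof -
    have "has_bochner_integral lborel (\<lambda>t. 2 * (J t * exp (- t * (norm x)\<^sup>2)) - J t * exp (- t * (norm (x + y))\<^sup>2) - J t * exp (- t * (norm (x - y))\<^sup>2))
       (2 * (Gamma \<gamma> * bubble \<gamma> x) - Gamma \<gamma> * bubble \<gamma> (x + y) - Gamma \<gamma> * bubble \<gamma> (x - y))"
      unfolding J_def \<phi>_def
      by (intro has_bochner_integral_diff has_bochner_integral_mult_right has_bochner_integral_bubble \<gamma>)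
    then show ?thesis
      by (rule has_bochner_integral_cong[THEN iffD1, rotated -1]) (auto simp: T_def algebra_simps)
  qed
  have "(\<integral>z. J (fst z) * T z * k (snd z) \<partial>lborel) = (\<integral>y. \<integral>t. J t * T (t, y) * k y \<partial>lborel \<partial>lborel)"
    using lborel_pair.integral_snd[of "\<lambda>t y. J t * T (t, y) * k y"] int by (simp add: lborel_prod split_def)
  also have "\<dots> = Gamma \<gamma> * (\<integral>y. sdiff (bubble \<gamma>) x y * k y \<partial>lborel)"
  proof -
    have "(\<integral>t. J t * T (t, y) * k y \<partial>lborel) = Gamma \<gamma> * (sdiff (bubble \<gamma>) x y * k y)" for y
      using Tt[of y] by (subst integral_mult_left_zero) (simp add: has_bochner_integral_iff)
    then show ?thesis by (simp del: integral_mult_left_zero)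
  qed
  finally have eq2: "(\<integral>z. J (fst z) * T z * k (snd z) \<partial>lborel) = Gamma \<gamma> * (\<integral>y. sdiff (bubble \<gamma>) x y * k y \<partial>lborel)" .
  \<comment> \<open>The bubble inherits its \<open>min_sq\<close> bound from the Gaussians by
    averaging over \<open>t\<close>.\<close>
  have sb: "\<bar>sdiff (\<lambda>y. - bubble \<gamma> y) x y\<bar> \<le> M * (\<integral>t. J t * (1 + t)\<^sup>2 \<partial>lborel) / Gamma \<gamma> * min_sq y" for y
  proof -
    have "\<bar>Gamma \<gamma> * sdiff (bubble \<gamma>) x y\<bar> = norm (\<integral>t. J t * T (t, y) \<partial>lborel)"
      using Tt by (simp add: has_bochner_integral_iff)
    also have "\<dots> \<le> (\<integral>t. M * (J t * (1 + t)\<^sup>2) * min_sq y \<partial>lborel)"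
    proof -
      have "(\<integral>t. \<bar>J t * T (t, y)\<bar> \<partial>lborel) \<le> (\<integral>t. M * (J t * (1 + t)\<^sup>2) * min_sq y \<partial>lborel)"
        using bd Jsq Tt[of y] by (intro integral_mono) (auto simp: has_bochner_integral_iff)
      then show ?thesis
        using integral_norm_bound[of lborel "\<lambda>t. J t * T (t, y)"] unfolding real_norm_def by linarith
    qed
    also have "\<dots> = M * (\<integral>t. J t * (1 + t)\<^sup>2 \<partial>lborel) * min_sq y" using Jsq by simp
    finally have "Gamma \<gamma> * \<bar>sdiff (bubble \<gamma>) x y\<bar> \<le> M * (\<integral>t. J t * (1 + t)\<^sup>2 \<partial>lborel) * min_sq y"
      using \<gamma> by (simp add: abs_mult)
    then have "\<bar>sdiff (bubble \<gamma>) x y\<bar> \<le> M * (\<integral>t. J t * (1 + t)\<^sup>2 \<partial>lborel) / Gamma \<gamma> * min_sq y"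
      using \<gamma> by (simp add: field_simps)
    then show ?thesis by (simp add: abs_le_iff)
  qed
  have "\<bar>- bubble \<gamma> y\<bar> \<le> 1" for y :: "real^'n"
    using \<gamma> powr_mono2'[of "- \<gamma>" 1 "1 + (norm y)\<^sup>2"] by (simp add: bubble_def)
  then have "fraclap s (\<lambda>y. - bubble \<gamma> y) x = c_sn s (real CARD('n)) / 2 * (\<integral>y. sdiff (\<lambda>y. - bubble \<gamma> y) x y * k y \<partial>lborel)"
    unfolding k_def by (intro fraclap_eq_sdiff(2)[OF s _ _ sb]) auto
  also have "(\<lambda>y. sdiff (\<lambda>y. - bubble \<gamma> y) x y * k y) = (\<lambda>y. - (sdiff (bubble \<gamma>) x y * k y))"
    by (simp add: algebra_simps fun_eq_iff)
  finally have "fraclap s (\<lambda>y. - bubble \<gamma> y) x = c_sn s (real CARD('n)) / 2 * (\<integral>y. - (sdiff (bubble \<gamma>) x y * k y) \<partial>lborel)"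
    .
  also have "\<dots> = - (c_sn s (real CARD('n)) / 2 * (\<integral>y. sdiff (bubble \<gamma>) x y * k y \<partial>lborel))"
    by (simp only: integral_minus mult_minus_right)
  also have "(\<integral>y. sdiff (bubble \<gamma>) x y * k y \<partial>lborel) = 2 * pi powr (CARD('n)/2) / (Gamma (CARD('n)/2 + s) * Gamma \<gamma>) * (\<integral>r. indicator {0<..} r * r powr (- s - 1) * W r \<partial>lborel)"
  proof -
    have "Gamma (CARD('n)/2 + s) > 0" "Gamma \<gamma> > 0" using s \<gamma> by (auto intro!: Gamma_real_pos add_nonneg_pos)
    then show ?thesis using eq1 unfolding eq2 by (simp add: field_simps)
  qed
  finally show "fraclap s (\<lambda>y. - bubble \<gamma> y) x = - (c_sn s (real CARD('n)) * pi powr (CARD('n) / 2) / (Gamma (CARD('n) / 2 + s) * Gamma \<gamma>)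
       * (\<integral>r. indicator {0<..} r * r powr (- s - 1) * W r \<partial>lborel))"
    by simp
qed

section \<open>Products of Laplace transforms of decreasing densities\<close>

text \<open>The power of \<open>t\<close> is kept apart from the density, so that monotonicity is
  asked of \<open>\<phi>\<close> alone and the exponents add up under products. Values in
  \<open>ennreal\<close> allow products to be formed before any convergence is known.\<close>

definition laplace :: "real \<Rightarrow> (real \<Rightarrow> ennreal) \<Rightarrow> real \<Rightarrow> ennreal" where
  "laplace q \<phi> \<rho> = (\<integral>\<^sup>+t. ennreal (indicator {0<..} t * t powr (q - 1) * exp (- t * \<rho>)) * \<phi> t \<partial>lborel)"

definition decr_density :: "(real \<Rightarrow> ennreal) \<Rightarrow> bool" where
  "decr_density \<phi> \<longleftrightarrow> \<phi> \<in> borel_measurable borel \<and> (\<forall>t t'. 0 < t \<and> t \<le> t' \<longrightarrow> \<phi> t' \<le> \<phi> t)"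

text \<open>The product is the transform of a convolution. Substituting
  \<open>t = \<tau> * \<sigma>\<close> pulls out \<open>\<tau> powr (p + q - 1)\<close> and leaves a
  Beta-type average of \<open>\<phi> (\<tau> * \<sigma>) * \<psi> (\<tau> * (1 - \<sigma>))\<close>
  over \<open>0 < \<sigma> < 1\<close>. Both arguments grow with \<open>\<tau>\<close>, so the
  average decreases.\<close>

lemma laplace_mult:
  assumes \<phi>: "decr_density \<phi>" and \<psi>: "decr_density \<psi>"
  obtains \<theta> where "decr_density \<theta>" "\<And>\<rho>. laplace p \<phi> \<rho> * laplace q \<psi> \<rho> = laplace (p + q) \<theta> \<rho>"
proof -
  have [measurable]: "\<phi> \<in> borel_measurable borel" "\<psi> \<in> borel_measurable borel"
    using \<phi> \<psi> by (auto simp: decr_density_def)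
  define \<theta> where "\<theta> = (\<lambda>\<tau>. \<integral>\<^sup>+\<sigma>. ennreal (indicator {0<..<1} \<sigma> * \<sigma> powr (p - 1) * (1 - \<sigma>) powr (q - 1)) * (\<phi> (\<tau> * \<sigma>) * \<psi> (\<tau> * (1 - \<sigma>))) \<partial>lborel)"
  have [measurable]: "\<theta> \<in> borel_measurable borel"
    unfolding \<theta>_def by measurable
  have "\<theta> t' \<le> \<theta> t" if "0 < t" "t \<le> t'" for t t'
    unfolding \<theta>_def
  proof (rule nn_integral_mono)
    fix \<sigma> :: real
    show "ennreal (indicator {0<..<1} \<sigma> * \<sigma> powr (p - 1) * (1 - \<sigma>) powr (q - 1)) * (\<phi> (t' * \<sigma>) * \<psi> (t' * (1 - \<sigma>)))
      \<le> ennreal (indicator {0<..<1} \<sigma> * \<sigma> powr (p - 1) * (1 - \<sigma>) powr (q - 1)) * (\<phi> (t * \<sigma>) * \<psi> (t * (1 - \<sigma>)))"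
    proof (cases "\<sigma> \<in> {0<..<1}")
      case True
      then have "\<phi> (t' * \<sigma>) \<le> \<phi> (t * \<sigma>)" "\<psi> (t' * (1 - \<sigma>)) \<le> \<psi> (t * (1 - \<sigma>))"
        using \<phi> \<psi> that by (auto simp: decr_density_def)
      then show ?thesis by (intro mult_left_mono mult_mono) auto
    qed simp
  qed
  then have "decr_density \<theta>" by (auto simp: decr_density_def)
  moreover have "laplace p \<phi> \<rho> * laplace q \<psi> \<rho> = laplace (p + q) \<theta> \<rho>" for \<rho>
  proof -
    define A where "A = (\<lambda>t. ennreal (indicator {0<..} t * t powr (p - 1) * exp (- t * \<rho>)) * \<phi> t)"
    define B where "B = (\<lambda>t. ennreal (indicator {0<..} t * t powr (q - 1) * exp (- t * \<rho>)) * \<psi> t)"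
    have [measurable]: "A \<in> borel_measurable borel" "B \<in> borel_measurable borel"
      unfolding A_def B_def by measurable
    have "laplace p \<phi> \<rho> * laplace q \<psi> \<rho> = (\<integral>\<^sup>+t. A t * (\<integral>\<^sup>+v. B v \<partial>lborel) \<partial>lborel)"
      unfolding laplace_def A_def[symmetric] B_def[symmetric] by (simp add: nn_integral_multc)
    also have "\<dots> = (\<integral>\<^sup>+t. \<integral>\<^sup>+\<tau>. A t * B (\<tau> - t) \<partial>lborel \<partial>lborel)"
    proof (intro nn_integral_cong)
      fix t :: real
      have "(\<integral>\<^sup>+\<tau>. B (\<tau> - t) \<partial>lborel) = (\<integral>\<^sup>+v. B v \<partial>lborel)"
        using nn_integral_lborel_translate[of B "- t"] by simp
      then show "A t * (\<integral>\<^sup>+v. B v \<partial>lborel) = (\<integral>\<^sup>+\<tau>. A t * B (\<tau> - t) \<partial>lborel)"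
        by (simp add: nn_integral_cmult)
    qed
    also have "\<dots> = (\<integral>\<^sup>+\<tau>. \<integral>\<^sup>+t. A t * B (\<tau> - t) \<partial>lborel \<partial>lborel)"
      by (rule lborel_pair.Fubini') simp
    also have "\<dots> = (\<integral>\<^sup>+\<tau>. ennreal (indicator {0<..} \<tau> * \<tau> powr (p + q - 1) * exp (- \<tau> * \<rho>)) * \<theta> \<tau> \<partial>lborel)"
    proof (intro nn_integral_cong)
      fix \<tau> :: real
      show "(\<integral>\<^sup>+t. A t * B (\<tau> - t) \<partial>lborel) = ennreal (indicator {0<..} \<tau> * \<tau> powr (p + q - 1) * exp (- \<tau> * \<rho>)) * \<theta> \<tau>"
      proof (cases "\<tau> > 0")
        case False
        then have z: "A t * B (\<tau> - t) = 0" for t by (cases "t > 0") (auto simp: A_def B_def)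
        show ?thesis using False unfolding z by simp
      next
        case True
        have "(\<integral>\<^sup>+t. A t * B (\<tau> - t) \<partial>lborel) = \<tau> * (\<integral>\<^sup>+\<sigma>. A (\<tau> * \<sigma>) * B (\<tau> - \<tau> * \<sigma>) \<partial>lborel)"
          using nn_integral_real_affine[of "\<lambda>t. A t * B (\<tau> - t)" \<tau> 0] True by simp
        also have "\<dots> = \<tau> * (\<integral>\<^sup>+\<sigma>. ennreal (\<tau> powr (p + q - 2) * exp (- \<tau> * \<rho>)) * (ennreal (indicator {0<..<1} \<sigma> * \<sigma> powr (p - 1) * (1 - \<sigma>) powr (q - 1)) * (\<phi> (\<tau> * \<sigma>) * \<psi> (\<tau> * (1 - \<sigma>)))) \<partial>lborel)"
        proof (rule arg_cong[where f = "(*) (ennreal \<tau>)"], rule nn_integral_cong)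
          fix \<sigma> :: real
          show "A (\<tau> * \<sigma>) * B (\<tau> - \<tau> * \<sigma>) = ennreal (\<tau> powr (p + q - 2) * exp (- \<tau> * \<rho>)) * (ennreal (indicator {0<..<1} \<sigma> * \<sigma> powr (p - 1) * (1 - \<sigma>) powr (q - 1)) * (\<phi> (\<tau> * \<sigma>) * \<psi> (\<tau> * (1 - \<sigma>))))"
          proof (cases "\<sigma> \<in> {0<..<1}")
            case True
            have d: "\<tau> - \<tau> * \<sigma> = \<tau> * (1 - \<sigma>)" by (simp add: algebra_simps)
            have "(\<tau> * \<sigma>) powr (p - 1) * exp (- (\<tau> * \<sigma>) * \<rho>) * ((\<tau> * (1 - \<sigma>)) powr (q - 1) * exp (- (\<tau> * (1 - \<sigma>)) * \<rho>))
              = (\<tau> powr (p - 1) * \<tau> powr (q - 1)) * (exp (- (\<tau> * \<sigma>) * \<rho>) * exp (- (\<tau> * (1 - \<sigma>)) * \<rho>)) * (\<sigma> powr (p - 1) * (1 - \<sigma>) powr (q - 1))"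
              using True \<open>\<tau> > 0\<close> by (simp add: powr_mult)
            also have "\<tau> powr (p - 1) * \<tau> powr (q - 1) = \<tau> powr (p + q - 2)"
              by (simp add: powr_add[symmetric])
            also have "exp (- (\<tau> * \<sigma>) * \<rho>) * exp (- (\<tau> * (1 - \<sigma>)) * \<rho>) = exp (- \<tau> * \<rho>)"
              by (simp add: exp_add[symmetric] algebra_simps)
            finally have "ennreal ((\<tau> * \<sigma>) powr (p - 1) * exp (- (\<tau> * \<sigma>) * \<rho>)) * ennreal ((\<tau> * (1 - \<sigma>)) powr (q - 1) * exp (- (\<tau> * (1 - \<sigma>)) * \<rho>))
              = ennreal (\<tau> powr (p + q - 2) * exp (- \<tau> * \<rho>)) * ennreal (\<sigma> powr (p - 1) * (1 - \<sigma>) powr (q - 1))"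
              by (simp add: ennreal_mult[symmetric] del: ennreal_mult)
            then show ?thesis
              unfolding A_def B_def d using True \<open>\<tau> > 0\<close>
              by (simp add: mult.assoc mult.left_commute[of "\<phi> _"] del: ennreal_mult ennreal_mult'')
                (simp add: mult.assoc[symmetric] del: ennreal_mult ennreal_mult'')
          next
            case False
            then have "\<tau> * \<sigma> \<le> 0 \<or> \<tau> - \<tau> * \<sigma> \<le> 0" using True
              by (auto simp: mult_le_0_iff)
            then have "A (\<tau> * \<sigma>) * B (\<tau> - \<tau> * \<sigma>) = 0" by (auto simp: A_def B_def)
            then show ?thesis using False by simp
          qed
        qed
        also have "\<dots> = ennreal \<tau> * (ennreal (\<tau> powr (p + q - 2) * exp (- \<tau> * \<rho>)) * \<theta> \<tau>)"
          unfolding \<theta>_def by (subst nn_integral_cmult) auto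
        also have "\<dots> = ennreal (\<tau> * (\<tau> powr (p + q - 2) * exp (- \<tau> * \<rho>))) * \<theta> \<tau>"
          using True by (subst ennreal_mult) (simp_all add: mult.assoc)
        also have "\<tau> * (\<tau> powr (p + q - 2) * exp (- \<tau> * \<rho>)) = \<tau> powr (p + q - 1) * exp (- \<tau> * \<rho>)"
          using True powr_add[of \<tau> 1 "p + q - 2"] by simp
        finally show ?thesis using True by simp
      qed
    qed
    finally show ?thesis unfolding laplace_def .
  qed
  ultimately show ?thesis by (rule that)
qed

text \<open>The induction starts at 1, because the empty product 1 is the transform of a point mass
  at 0, which has no density.\<close>

lemma laplace_power:
  assumes \<phi>: "decr_density \<phi>" and k: "1 \<le> k"
  obtains \<theta> where "decr_density \<theta>" "\<And>\<rho>. laplace b \<phi> \<rho> ^ k = laplace (real k * b) \<theta> \<rho>"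
proof -
  have "\<exists>\<theta>. decr_density \<theta> \<and> (\<forall>\<rho>. laplace b \<phi> \<rho> ^ k = laplace (real k * b) \<theta> \<rho>)"
    using k
  proof (induction k rule: dec_induct)
    case base
    show ?case using \<phi> by auto
  next
    case (step m)
    then obtain \<theta> where \<theta>: "decr_density \<theta>" "\<And>\<rho>. laplace b \<phi> \<rho> ^ m = laplace (real m * b) \<theta> \<rho>" by auto
    obtain \<theta>' where "decr_density \<theta>'" "\<And>\<rho>. laplace b \<phi> \<rho> * laplace (real m * b) \<theta> \<rho> = laplace (b + real m * b) \<theta>' \<rho>"
      using laplace_mult[OF \<phi> \<theta>(1)] by blast
    then show ?case using \<theta>(2) by (intro exI[of _ \<theta>']) (simp add: algebra_simps)
  qed
  then show ?thesis using that by blast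
qed

section \<open>The density of the fractional Laplacian of the bubble\<close>

lemma psi_nonneg:
  fixes e r t :: real
  assumes "e \<le> 0" "r \<ge> 0" "t \<ge> 0"
  shows "0 \<le> exp (- t) - (1 + r) powr e * exp (- (t * (1 + r)))"
proof -
  have "(1 + r) powr e * exp (- (t * (1 + r))) \<le> 1 * exp (- t)"
  proof (rule mult_mono)
    show "(1 + r) powr e \<le> 1" using assms powr_mono2'[of e 1 "1 + r"] by simp
  qed (use assms in \<open>auto simp: algebra_simps\<close>)
  then show ?thesis by simp
qed

text \<open>Differentiation in \<open>t\<close> brings down a factor \<open>1 + r\<close> in the
  second term, so the comparison now needs \<open>(1 + r) powr (e + 1) <= 1\<close>. This is the
  origin of the bound \<open>N/2 - 1\<close> on \<open>\<gamma> + s\<close>.\<close>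

lemma psi_antimono:
  fixes e r t t' :: real
  assumes e: "e \<le> - 1" and r: "r \<ge> 0" and t: "0 \<le> t" "t \<le> t'"
  shows "exp (- t') - (1 + r) powr e * exp (- (t' * (1 + r))) \<le> exp (- t) - (1 + r) powr e * exp (- (t * (1 + r)))"
proof (rule DERIV_nonpos_imp_nonincreasing[OF t(2)])
  fix x assume x: "t \<le> x" "x \<le> t'"
  have "(1 + r) powr (e + 1) * exp (- (x * (1 + r))) \<le> 1 * exp (- x)"
  proof (rule mult_mono)
    show "(1 + r) powr (e + 1) \<le> 1" using e r powr_mono2'[of "e + 1" 1 "1 + r"] by simp
  qed (use x t r in \<open>auto simp: algebra_simps\<close>)
  then have "- exp (- x) + (1 + r) powr e * (exp (- (x * (1 + r))) * (1 + r)) \<le> 0"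
    using r by (simp add: powr_add mult_ac)
  moreover have "((\<lambda>t. exp (- t) - (1 + r) powr e * exp (- (t * (1 + r)))) has_real_derivative
     - exp (- x) + (1 + r) powr e * (exp (- (x * (1 + r))) * (1 + r))) (at x)"
    by (auto intro!: derivative_eq_intros simp: algebra_simps)
  ultimately show "\<exists>y. ((\<lambda>t. exp (- t) - (1 + r) powr e * exp (- (t * (1 + r)))) has_real_derivative y) (at x) \<and> y \<le> 0"
    by blast
qed

text \<open>For each \<open>r\<close> the density in \<open>t\<close> is nonnegative and decreasing.
  Nonnegativity lets Tonelli move \<open>t\<close> outside, and integrating over \<open>r\<close>
  with the weight \<open>r powr (- s - 1)\<close> preserves both properties.\<close>

lemma fraclap_bubble_laplace:
  fixes s \<gamma> :: real
  assumes s: "0 < s" "s < 1" and \<gamma>: "\<gamma> > 0" and e: "\<gamma> + s \<le> real CARD('n) / 2 - 1"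
  obtains \<phi> where "decr_density \<phi>" "\<And>x::real^'n. 0 \<le> - fraclap s (\<lambda>y. - bubble \<gamma> y) x"
    "\<And>x::real^'n. ennreal (- fraclap s (\<lambda>y. - bubble \<gamma> y) x) = laplace (\<gamma> + s) \<phi> ((norm x)\<^sup>2)"
proof -
  define C where "C = c_sn s (real CARD('n)) * pi powr (CARD('n) / 2) / (Gamma (CARD('n) / 2 + s) * Gamma \<gamma>)"
  have C: "C > 0"
    unfolding C_def c_sn_def using s \<gamma> by (intro divide_pos_pos mult_pos_pos Gamma_real_pos) (auto simp: add_nonneg_pos)
  define \<psi> where "\<psi> = (\<lambda>r t. exp (- t) - (1 + r) powr (\<gamma> + s - CARD('n) / 2) * exp (- (t * (1 + r))))"
  define W where "W = (\<lambda>(x::real^'n) r. \<integral>t. indicator {0<..} t * t powr (\<gamma> + s - 1) * exp (- t * (norm x)\<^sup>2) * \<psi> r t \<partial>lborel)"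
  have \<psi>0: "\<psi> r t \<ge> 0" if "r > 0" "t > 0" for r t
    unfolding \<psi>_def using e that by (intro psi_nonneg) auto
  define \<phi> where "\<phi> = (\<lambda>t. ennreal C * (\<integral>\<^sup>+r. ennreal (indicator {0<..} r * r powr (- s - 1) * \<psi> r t) \<partial>lborel))"
  have [measurable]: "\<phi> \<in> borel_measurable borel" unfolding \<phi>_def \<psi>_def by measurable
  have "\<phi> t' \<le> \<phi> t" if "0 < t" "t \<le> t'" for t t'
    unfolding \<phi>_def
  proof (rule mult_left_mono, rule nn_integral_mono, rule ennreal_leI)
    fix r :: real
    show "indicator {0<..} r * r powr (- s - 1) * \<psi> r t' \<le> indicator {0<..} r * r powr (- s - 1) * \<psi> r t"
      unfolding \<psi>_def using that e by (cases "r > 0") (auto intro!: mult_left_mono psi_antimono)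
  qed auto
  then have dens: "decr_density \<phi>" by (auto simp: decr_density_def)
  have W0: "W x r \<ge> 0" if "r > 0" for x r
    unfolding W_def
  proof (rule integral_nonneg_AE, rule AE_I2)
    fix t :: real
    show "0 \<le> indicator {0<..} t * t powr (\<gamma> + s - 1) * exp (- t * (norm x)\<^sup>2) * \<psi> r t"
      using \<psi>0[OF that, of t] by (cases "t > 0") auto
  qed
  have w: "- fraclap s (\<lambda>y. - bubble \<gamma> y) x = C * (\<integral>r. indicator {0<..} r * r powr (- s - 1) * W x r \<partial>lborel)"
    and w_int: "integrable lborel (\<lambda>r. indicator {0<..} r * r powr (- s - 1) * W x r)" for x :: "real^'n"
    using fraclap_bubble[OF s \<gamma>, of x] by (simp_all add: C_def W_def \<psi>_def)
  have W0': "0 \<le> indicator {0<..} r * r powr (- s - 1) * W x r" for x r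
    using W0[of r x] by (cases "r > 0") auto
  have nonneg: "0 \<le> - fraclap s (\<lambda>y. - bubble \<gamma> y) x" for x :: "real^'n"
    unfolding w using C W0' by (intro mult_nonneg_nonneg integral_nonneg_AE) auto
  have lap: "ennreal (- fraclap s (\<lambda>y. - bubble \<gamma> y) x) = laplace (\<gamma> + s) \<phi> ((norm x)\<^sup>2)" for x :: "real^'n"
  proof -
    let ?\<rho> = "(norm x)\<^sup>2"
    have Wnn: "ennreal (W x r) = (\<integral>\<^sup>+t. ennreal (indicator {0<..} t * t powr (\<gamma> + s - 1) * exp (- t * ?\<rho>) * \<psi> r t) \<partial>lborel)" if "r > 0" for r
      unfolding W_def
    proof (rule nn_integral_eq_integral[symmetric])
      have 1: "integrable lborel (\<lambda>t. indicator {0<..} t * t powr (\<gamma> + s - 1) * exp (- A * t))" if "A > 0" for A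
        using has_bochner_integral_gamma[of "\<gamma> + s" A] that s \<gamma> by (simp add: has_bochner_integral_iff)
      have "integrable lborel (\<lambda>t. indicator {0<..} t * t powr (\<gamma> + s - 1) * exp (- (?\<rho> + 1) * t)
         - (1 + r) powr (\<gamma> + s - CARD('n) / 2) * (indicator {0<..} t * t powr (\<gamma> + s - 1) * exp (- (?\<rho> + 1 + r) * t)))"
        using that by (intro Bochner_Integration.integrable_diff integrable_mult_right 1) (auto simp: add_nonneg_pos)
      also have "(\<lambda>t. indicator {0<..} t * t powr (\<gamma> + s - 1) * exp (- (?\<rho> + 1) * t)
         - (1 + r) powr (\<gamma> + s - CARD('n) / 2) * (indicator {0<..} t * t powr (\<gamma> + s - 1) * exp (- (?\<rho> + 1 + r) * t)))
         = (\<lambda>t. indicator {0<..} t * t powr (\<gamma> + s - 1) * exp (- t * ?\<rho>) * \<psi> r t)"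
      proof
        fix t :: real
        have "exp (- (?\<rho> + 1) * t) = exp (- t * ?\<rho>) * exp (- t)" "exp (- (?\<rho> + 1 + r) * t) = exp (- t * ?\<rho>) * exp (- (t * (1 + r)))"
          by (simp_all add: exp_add[symmetric] algebra_simps)
        then show "indicator {0<..} t * t powr (\<gamma> + s - 1) * exp (- (?\<rho> + 1) * t)
         - (1 + r) powr (\<gamma> + s - CARD('n) / 2) * (indicator {0<..} t * t powr (\<gamma> + s - 1) * exp (- (?\<rho> + 1 + r) * t))
         = indicator {0<..} t * t powr (\<gamma> + s - 1) * exp (- t * ?\<rho>) * \<psi> r t"
          by (simp add: \<psi>_def algebra_simps)
      qed
      finally show "integrable lborel (\<lambda>t. indicator {0<..} t * t powr (\<gamma> + s - 1) * exp (- t * ?\<rho>) * \<psi> r t)" .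
      show "AE t in lborel. 0 \<le> indicator {0<..} t * t powr (\<gamma> + s - 1) * exp (- t * ?\<rho>) * \<psi> r t"
      proof (rule AE_I2)
        show "0 \<le> indicator {0<..} t * t powr (\<gamma> + s - 1) * exp (- t * ?\<rho>) * \<psi> r t" for t
          using \<psi>0[OF that, of t] by (cases "t > 0") auto
      qed
    qed
    have \<psi>m [measurable (raw)]: "(\<lambda>z. \<psi> (f z) (g z)) \<in> borel_measurable M" if [measurable]: "f \<in> borel_measurable M" "g \<in> borel_measurable M" for f g M
      unfolding \<psi>_def by measurable
    have "ennreal (- fraclap s (\<lambda>y. - bubble \<gamma> y) x) = ennreal C * (\<integral>\<^sup>+r. ennreal (indicator {0<..} r * r powr (- s - 1) * W x r) \<partial>lborel)"
      unfolding w using C W0' w_int[of x] by (subst nn_integral_eq_integral) (auto simp: ennreal_mult' integral_nonneg_AE)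
    also have "(\<integral>\<^sup>+r. ennreal (indicator {0<..} r * r powr (- s - 1) * W x r) \<partial>lborel)
      = (\<integral>\<^sup>+r. \<integral>\<^sup>+t. ennreal (indicator {0<..} t * t powr (\<gamma> + s - 1) * exp (- t * ?\<rho>)) * ennreal (indicator {0<..} r * r powr (- s - 1) * \<psi> r t) \<partial>lborel \<partial>lborel)"
    proof (intro nn_integral_cong)
      fix r :: real
      show "ennreal (indicator {0<..} r * r powr (- s - 1) * W x r) = (\<integral>\<^sup>+t. ennreal (indicator {0<..} t * t powr (\<gamma> + s - 1) * exp (- t * ?\<rho>)) * ennreal (indicator {0<..} r * r powr (- s - 1) * \<psi> r t) \<partial>lborel)"
      proof (cases "r > 0")
        case True
        have "ennreal (indicator {0<..} r * r powr (- s - 1) * W x r) = ennreal (r powr (- s - 1)) * ennreal (W x r)"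
          using True W0[OF True] by (simp add: ennreal_mult)
        also have "\<dots> = (\<integral>\<^sup>+t. ennreal (r powr (- s - 1)) * ennreal (indicator {0<..} t * t powr (\<gamma> + s - 1) * exp (- t * ?\<rho>) * \<psi> r t) \<partial>lborel)"
          unfolding Wnn[OF True] by (rule nn_integral_cmult[symmetric]) measurable
        also have "\<dots> = (\<integral>\<^sup>+t. ennreal (indicator {0<..} t * t powr (\<gamma> + s - 1) * exp (- t * ?\<rho>)) * ennreal (indicator {0<..} r * r powr (- s - 1) * \<psi> r t) \<partial>lborel)"
        proof (intro nn_integral_cong)
          fix t :: real
          show "ennreal (r powr (- s - 1)) * ennreal (indicator {0<..} t * t powr (\<gamma> + s - 1) * exp (- t * ?\<rho>) * \<psi> r t)
             = ennreal (indicator {0<..} t * t powr (\<gamma> + s - 1) * exp (- t * ?\<rho>)) * ennreal (indicator {0<..} r * r powr (- s - 1) * \<psi> r t)"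
            using True \<psi>0[OF True, of t] by (cases "t > 0") (simp_all add: ennreal_mult[symmetric] mult_ac del: ennreal_mult ennreal_mult'')
        qed
        finally show ?thesis .
      qed simp
    qed
    also have "\<dots> = (\<integral>\<^sup>+t. \<integral>\<^sup>+r. ennreal (indicator {0<..} t * t powr (\<gamma> + s - 1) * exp (- t * ?\<rho>)) * ennreal (indicator {0<..} r * r powr (- s - 1) * \<psi> r t) \<partial>lborel \<partial>lborel)"
      by (rule lborel_pair.Fubini') measurable
    also have "\<dots> = (\<integral>\<^sup>+t. ennreal (indicator {0<..} t * t powr (\<gamma> + s - 1) * exp (- t * ?\<rho>)) * (\<integral>\<^sup>+r. ennreal (indicator {0<..} r * r powr (- s - 1) * \<psi> r t) \<partial>lborel) \<partial>lborel)"
      by (intro nn_integral_cong nn_integral_cmult) measurable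
    also have "ennreal C * \<dots> = laplace (\<gamma> + s) \<phi> ?\<rho>"
      unfolding laplace_def \<phi>_def
      by (subst nn_integral_cmult[symmetric], measurable) (intro nn_integral_cong mult.left_commute)
    finally show ?thesis .
  qed
  show ?thesis using dens nonneg lap by (rule that)
qed

section \<open>Pairing with test functions\<close>

lemma test_fun_integrable:
  fixes h :: "real^'n \<Rightarrow> real"
  assumes h: "test_fun h"
  shows "h \<in> borel_measurable borel" and "integrable lborel h"
proof -
  obtain C R where C: "C \<ge> 0" and R: "R > 0" and cont: "continuous_on UNIV h"
    and hC: "\<And>x. \<bar>h x\<bar> \<le> C" and hR: "\<And>x. norm x > R \<Longrightarrow> h x = 0"
    and hS: "\<And>x y. \<bar>sdiff h x y\<bar> \<le> C * (norm y)\<^sup>2"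
    using test_fun_sdiff_bound[OF h] by blast
  show meas: "h \<in> borel_measurable borel" using cont by (rule borel_measurable_continuous_onI)
  have "integrable lborel (\<lambda>x. C * indicator (cball (0::real^'n) R) x)"
    by (intro integrable_mult_right integrable_real_indicator) (auto intro: emeasure_bounded_finite[OF bounded_cball, unfolded infinity_ennreal_def])
  then show "integrable lborel h"
  proof (rule Bochner_Integration.integrable_bound)
    show "AE x in lborel. norm (h x) \<le> norm (C * indicator (cball (0::real^'n) R) x :: real)"
      using hC hR C by (intro AE_I2) (force simp: indicator_def)
  qed (use meas in simp)
qed

text \<open>The L1 bound in \<open>x\<close> is what Fubini in \<open>x\<close> and \<open>y\<close>
  consumes. For \<open>norm y <= 1\<close> the second difference is supported in the ball of radius
  \<open>R + 1\<close>, where the quadratic bound applies; for larger \<open>y\<close> the ball and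
  its two translates are counted separately.\<close>

lemma test_fun_sdiff_L1:
  fixes h :: "real^'n \<Rightarrow> real"
  assumes h: "test_fun h"
  obtains M where "M \<ge> 0" "\<And>y. integrable lborel (\<lambda>x. sdiff h x y)"
    "\<And>y. (\<integral>x. \<bar>sdiff h x y\<bar> \<partial>lborel) \<le> M * min_sq y" "\<And>x y. \<bar>sdiff h x y\<bar> \<le> M * min_sq y"
proof -
  obtain C R where C: "C \<ge> 0" and R: "R > 0" and "continuous_on UNIV h"
    and hC: "\<And>x. \<bar>h x\<bar> \<le> C" and hR: "\<And>x. norm x > R \<Longrightarrow> h x = 0"
    and hS: "\<And>x y. \<bar>sdiff h x y\<bar> \<le> C * (norm y)\<^sup>2"
    using test_fun_sdiff_bound[OF h] by blast
  have [measurable]: "h \<in> borel_measurable borel" by (rule test_fun_integrable(1)[OF h])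
  have h_int: "integrable lborel h" by (rule test_fun_integrable(2)[OF h])
  define \<kappa> where "\<kappa> = (indicator (cball (0::real^'n) (R + 1)) :: _ \<Rightarrow> real)"
  define V where "V = measure lborel (cball (0::real^'n) (R + 1))"
  have \<kappa>: "has_bochner_integral lborel \<kappa> V"
    unfolding \<kappa>_def V_def by (rule has_bochner_integral_real_indicator) (auto intro: emeasure_bounded_finite[OF bounded_cball, unfolded infinity_ennreal_def])
  have \<kappa>t: "has_bochner_integral lborel (\<lambda>x. \<kappa> (x + y)) V" for y
    using \<kappa> has_bochner_integral_lborel_translate_iff[of \<kappa> y V] by (simp add: add.commute)
  have dom: "has_bochner_integral lborel (\<lambda>x. C * min_sq y * (2 * \<kappa> x + \<kappa> (x + y) + \<kappa> (x + - y))) (C * min_sq y * (2 * V + V + V))" for y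
    by (intro has_bochner_integral_mult_right has_bochner_integral_add \<kappa> \<kappa>t)
  have \<kappa>0: "\<kappa> x \<ge> 0" for x by (simp add: \<kappa>_def)
  have \<kappa>1: "norm x \<le> R + 1 \<Longrightarrow> \<kappa> x = 1" for x by (simp add: \<kappa>_def)
  have h\<kappa>: "\<bar>h x\<bar> \<le> C * \<kappa> x" for x
    using hC[of x] hR[of x] C \<kappa>0[of x] \<kappa>1[of x] by (cases "norm x \<le> R") auto
  have bd: "\<bar>sdiff h x y\<bar> \<le> C * min_sq y * (2 * \<kappa> x + \<kappa> (x + y) + \<kappa> (x + - y))" for x y
  proof (cases "norm y \<le> 1")
    case False
    then have "min_sq y = 1" by (simp add: min_sq_def)
    then show ?thesis using h\<kappa>[of x] h\<kappa>[of "x + y"] h\<kappa>[of "x + - y"] by (simp add: algebra_simps)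
  next
    case True
    then have m: "min_sq y = (norm y)\<^sup>2" by (simp add: min_sq_def power_le_one)
    show ?thesis
    proof (cases "norm x \<le> R + 1")
      case True
      have "C * (norm y)\<^sup>2 * 1 \<le> C * (norm y)\<^sup>2 * (2 * \<kappa> x + \<kappa> (x + y) + \<kappa> (x + - y))"
        using C \<kappa>0[of "x + y"] \<kappa>0[of "x + - y"] \<kappa>1[OF True] by (intro mult_left_mono) auto
      then show ?thesis using hS[of x y] m by simp
    next
      case False
      have "norm x \<le> norm (x + y) + norm y" "norm x \<le> norm (x - y) + norm y"
        using norm_triangle_ineq4[of "x + y" y] norm_triangle_ineq[of "x - y" y] by simp_all
      then have "h x = 0" "h (x + y) = 0" "h (x - y) = 0" using False \<open>norm y \<le> 1\<close> by (auto intro!: hR)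
      then show ?thesis using C \<kappa>0 by (simp add: add_nonneg_nonneg)
    qed
  qed
  have si: "integrable lborel (\<lambda>x. sdiff h x y)" for y
  proof (rule Bochner_Integration.integrable_bound)
    show "integrable lborel (\<lambda>x. C * min_sq y * (2 * \<kappa> x + \<kappa> (x + y) + \<kappa> (x + - y)))"
      using dom[of y] by (simp add: has_bochner_integral_iff)
    show "AE x in lborel. norm (sdiff h x y) \<le> norm (C * min_sq y * (2 * \<kappa> x + \<kappa> (x + y) + \<kappa> (x + - y)))"
      using bd[of _ y] by (intro AE_I2) (metis abs_ge_self order.trans real_norm_def)
  qed simp
  have L1: "(\<integral>x. \<bar>sdiff h x y\<bar> \<partial>lborel) \<le> C * min_sq y * (2 * V + V + V)" for y
  proof -
    have "(\<integral>x. \<bar>sdiff h x y\<bar> \<partial>lborel) \<le> (\<integral>x. C * min_sq y * (2 * \<kappa> x + \<kappa> (x + y) + \<kappa> (x + - y)) \<partial>lborel)"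
      using si[of y] dom[of y] bd[of _ y] by (intro integral_mono) (auto simp: has_bochner_integral_iff)
    then show ?thesis unfolding has_bochner_integral_integral_eq[OF dom[of y]] .
  qed
  have Linf: "\<bar>sdiff h x y\<bar> \<le> 4 * C * min_sq y" for x y
  proof -
    have "2 * \<kappa> x + \<kappa> (x + y) + \<kappa> (x + - y) \<le> 4" by (simp add: \<kappa>_def indicator_def)
    then have "C * min_sq y * (2 * \<kappa> x + \<kappa> (x + y) + \<kappa> (x + - y)) \<le> C * min_sq y * 4"
      using C by (intro mult_left_mono) auto
    then show ?thesis using bd[of x y] by simp
  qed
  have V: "V \<ge> 0" by (simp add: V_def)
  show ?thesis
  proof (rule that[of "max (4 * C * V) (4 * C)"])
    show "(\<integral>x. \<bar>sdiff h x y\<bar> \<partial>lborel) \<le> max (4 * C * V) (4 * C) * min_sq y" for y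
    proof -
      have "4 * C * V * min_sq y \<le> max (4 * C * V) (4 * C) * min_sq y" by (intro mult_right_mono) auto
      then show ?thesis using L1[of y] by (simp add: mult_ac)
    qed
    show "\<bar>sdiff h x y\<bar> \<le> max (4 * C * V) (4 * C) * min_sq y" for x y
      by (rule order.trans[OF Linf]) (intro mult_right_mono, auto)
  qed (use C V si in auto)
qed

text \<open>Integrability over the whole space follows by integrating in \<open>x\<close> first,
  with the L1 bound on second differences. It makes the pairing with any bounded measurable function
  meaningful.\<close>

lemma test_fun_fraclap:
  fixes h :: "real^'n \<Rightarrow> real"
  assumes h: "test_fun h" and s: "0 < s" "s < 1"
  shows "fraclap s h x = c_sn s (real CARD('n)) / 2 * (\<integral>y. sdiff h x y * norm y powr (- (real CARD('n) + 2 * s)) \<partial>lborel)"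
    and "integrable lborel (\<lambda>y. sdiff h x y * norm y powr (- (real CARD('n) + 2 * s)))"
    and "integrable lborel (fraclap s h)"
proof -
  obtain M where M: "M \<ge> 0" "\<And>y. integrable lborel (\<lambda>x. sdiff h x y)"
    "\<And>y. (\<integral>x. \<bar>sdiff h x y\<bar> \<partial>lborel) \<le> M * min_sq y" "\<And>x y. \<bar>sdiff h x y\<bar> \<le> M * min_sq y"
    using test_fun_sdiff_L1[OF h] by blast
  obtain C R where C: "C \<ge> 0" "R > 0" "continuous_on UNIV h" "\<And>x. \<bar>h x\<bar> \<le> C" "\<And>x. norm x > R \<Longrightarrow> h x = 0"
    "\<And>x y. \<bar>sdiff h x y\<bar> \<le> C * (norm y)\<^sup>2" using test_fun_sdiff_bound[OF h] by blast
  have [measurable]: "h \<in> borel_measurable borel" by (rule test_fun_integrable(1)[OF h])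
  note fl = fraclap_eq_sdiff[OF s _ C(4) M(4)]
  show eq: "fraclap s h x = c_sn s (real CARD('n)) / 2 * (\<integral>y. sdiff h x y * norm y powr (- (real CARD('n) + 2 * s)) \<partial>lborel)" for x
    by (rule fl(2)) simp
  show "integrable lborel (\<lambda>y. sdiff h x y * norm y powr (- (real CARD('n) + 2 * s)))"
    by (rule fl(1)) simp
  define k where "k = (\<lambda>y::real^'n. norm y powr (- (real CARD('n) + 2 * s)))"
  have k0: "k y \<ge> 0" for y by (simp add: k_def)
  have [measurable]: "k \<in> borel_measurable borel" unfolding k_def by measurable
  have levy: "integrable lborel (\<lambda>y. min_sq y * k y)"
    using integrable_levy_kernel[OF s, where ?'a = "real^'n"] by (simp add: k_def)
  have "integrable (lborel \<Otimes>\<^sub>M lborel) (\<lambda>z. sdiff h (snd z) (fst z) * k (fst z))"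
  proof (rule lborel_pair.Fubini_integrable)
    have "integrable lborel (\<lambda>y. M * (min_sq y * k y))" using levy by simp
    then show "integrable lborel (\<lambda>y. \<integral>x. norm (sdiff h (snd (y, x)) (fst (y, x)) * k (fst (y, x))) \<partial>lborel)"
    proof (rule Bochner_Integration.integrable_bound)
      show "AE y in lborel. norm (\<integral>x. norm (sdiff h (snd (y, x)) (fst (y, x)) * k (fst (y, x))) \<partial>lborel) \<le> norm (M * (min_sq y * k y))"
      proof (rule AE_I2)
        fix y :: "real^'n"
        have "(\<integral>x. norm (sdiff h (snd (y, x)) (fst (y, x)) * k (fst (y, x))) \<partial>lborel) = (\<integral>x. \<bar>sdiff h x y\<bar> \<partial>lborel) * k y"
          using k0[of y] by (simp add: abs_mult)
        also have "\<dots> \<le> M * min_sq y * k y" using M(3)[of y] k0[of y] by (rule mult_right_mono)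
        finally show "norm (\<integral>x. norm (sdiff h (snd (y, x)) (fst (y, x)) * k (fst (y, x))) \<partial>lborel) \<le> norm (M * (min_sq y * k y))"
          using M(1) k0[of y] by (simp add: mult.assoc)
      qed
    qed measurable
  qed (use M(2) in auto)
  then have "integrable lborel (\<lambda>x. \<integral>y. sdiff h x y * k y \<partial>lborel)"
    using lborel_pair.integrable_snd[of "\<lambda>y x. sdiff h x y * k y"] by (simp add: split_def)
  then show "integrable lborel (fraclap s h)"
    unfolding eq[abs_def] k_def by (rule integrable_mult_right)
qed

text \<open>The weak instance of \<open>levy_kernel_fubini\<close>: \<open>T (t, y)\<close> is
  \<open>h\<close> integrated against the second difference of the Gaussian. The exponent
  \<open>N/2 - s\<close> turns the power of \<open>1 + r\<close> into 1. Since the operator falls on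
  \<open>h\<close>, the mixture itself is never differentiated; finite mass of its weighted density
  suffices.\<close>

lemma fraclap_pairing_gauss_mixture:
  fixes h :: "real^'n \<Rightarrow> real" and \<phi> :: "real \<Rightarrow> real"
  assumes h: "test_fun h" and s: "0 < s" "s < 1" and q: "0 < real CARD('n) / 2 - s"
    and \<phi>_meas [measurable]: "\<phi> \<in> borel_measurable borel"
    and \<phi>: "integrable lborel (\<lambda>t. indicator {0<..} t * t powr (real CARD('n) / 2 - s - 1) * \<phi> t)"
  defines "\<eta> \<equiv> \<lambda>t. \<integral>x. h x * exp (- t * (norm x)\<^sup>2) \<partial>lborel"
  defines "I \<equiv> \<lambda>r. \<integral>t. indicator {0<..} t * t powr (real CARD('n) / 2 - 1) * \<eta> t * (\<phi> t - \<phi> (t * (1 + r))) \<partial>lborel"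
  shows "\<And>r. r \<ge> 0 \<Longrightarrow> integrable lborel (\<lambda>t. indicator {0<..} t * t powr (real CARD('n) / 2 - 1) * \<eta> t * \<phi> (t * (1 + r)))"
    and "integrable lborel (\<lambda>r. indicator {0<..} r * r powr (- s - 1) * I r)"
    and "(\<integral>x. (\<integral>t. indicator {0<..} t * t powr (real CARD('n) / 2 - s - 1) * \<phi> t * exp (- t * (norm x)\<^sup>2) \<partial>lborel) * fraclap s h x \<partial>lborel)
      = c_sn s (real CARD('n)) * pi powr (real CARD('n) / 2) / Gamma (real CARD('n) / 2 + s) * (\<integral>r. indicator {0<..} r * r powr (- s - 1) * I r \<partial>lborel)"
proof -
  let ?N = "real CARD('n) / 2"
  define q where "q = ?N - s"
  have q0: "q > 0" "q + s = ?N" using q by (simp_all add: q_def)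
  define k where "k = (\<lambda>y::real^'n. norm y powr (- (real CARD('n) + 2 * s)))"
  have k0: "k y \<ge> 0" for y by (simp add: k_def)
  have [measurable]: "k \<in> borel_measurable borel" unfolding k_def by measurable
  have levy: "integrable lborel (\<lambda>y. min_sq y * k y)"
    using integrable_levy_kernel[OF s, where ?'a = "real^'n"] by (simp add: k_def)
  define J where "J = (\<lambda>t. indicator {0<..} t * t powr (q - 1) * \<phi> t)"
  have [measurable]: "J \<in> borel_measurable borel" unfolding J_def by measurable
  have J: "integrable lborel J" using \<phi> by (simp add: J_def[abs_def] q_def)
  define g where "g = (\<lambda>t (x::real^'n). exp (- t * (norm x)\<^sup>2))"
  have g_meas [measurable (raw)]: "(\<lambda>z. g (a z) (b z)) \<in> borel_measurable M"
    if [measurable]: "a \<in> borel_measurable M" "b \<in> borel_measurable M" for a b M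
    unfolding g_def by measurable
  have g01: "0 \<le> g t x" "t \<ge> 0 \<Longrightarrow> g t x \<le> 1" for t x by (simp_all add: g_def)
  obtain M where M: "M \<ge> 0" "\<And>y. integrable lborel (\<lambda>x. sdiff h x y)"
    "\<And>y. (\<integral>x. \<bar>sdiff h x y\<bar> \<partial>lborel) \<le> M * min_sq y" "\<And>x y. \<bar>sdiff h x y\<bar> \<le> M * min_sq y"
    using test_fun_sdiff_L1[OF h] by blast
  obtain C R where C: "C \<ge> 0" "R > 0" "continuous_on UNIV h" "\<And>x. \<bar>h x\<bar> \<le> C" "\<And>x. norm x > R \<Longrightarrow> h x = 0"
    "\<And>x y. \<bar>sdiff h x y\<bar> \<le> C * (norm y)\<^sup>2" using test_fun_sdiff_bound[OF h] by blast
  have [measurable]: "h \<in> borel_measurable borel" by (rule test_fun_integrable(1)[OF h])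
  have h_int: "integrable lborel h" by (rule test_fun_integrable(2)[OF h])
  have [measurable]: "\<eta> \<in> borel_measurable borel" unfolding \<eta>_def by measurable
  have hv: "integrable lborel (\<lambda>x. h x * v x)" if "v \<in> borel_measurable borel" "\<And>x. \<bar>v x\<bar> \<le> B" for v :: "real^'n \<Rightarrow> real" and B
  proof (rule Bochner_Integration.integrable_bound)
    show "integrable lborel (\<lambda>x. B * h x)" using h_int by simp
    show "AE x in lborel. norm (h x * v x) \<le> norm (B * h x)"
    proof (rule AE_I2)
      show "norm (h x * v x) \<le> norm (B * h x)" for x
        using mult_right_mono[OF that(2)[of x], of "\<bar>h x\<bar>"] that(2)[of x] by (simp add: abs_mult mult.commute)
    qed
  qed (use that(1) in measurable)
  define T where "T = (\<lambda>z. \<integral>x. h x * sdiff (g (fst z)) x (snd z) \<partial>lborel)"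
  have T_meas': "T \<in> borel_measurable (borel \<Otimes>\<^sub>M borel)" unfolding T_def by measurable
  then have T_meas: "T \<in> borel_measurable borel" by (simp add: borel_prod)
  \<comment> \<open>Translation invariance moves the second difference from \<open>h\<close> to the
    Gaussian, a discrete form of self-adjointness.\<close>
  have T_eq: "(\<integral>x. g t x * sdiff h x y \<partial>lborel) = T (t, y)" if t: "t \<ge> 0" for t y
  proof -
    have gb: "\<bar>g t (x + y)\<bar> \<le> 1" for x y using g01[of t "x + y"] t by simp
    have hg: "integrable lborel (\<lambda>x. h x * g t (x + z))" for z by (rule hv[of _ 1]) (use gb in auto)
    have tr: "has_bochner_integral lborel (\<lambda>x. g t x * h (x + z)) (\<integral>x. h x * g t (x + - z) \<partial>lborel)" for z
      using has_bochner_integral_lborel_translate_iff[of "\<lambda>x. h x * g t (x + - z)" z] has_bochner_integral_integrable[OF hg[of "- z"]]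
      by (simp add: add.commute mult.commute)
    have "has_bochner_integral lborel (\<lambda>x. 2 * (g t x * h (x + 0)) - g t x * h (x + y) - g t x * h (x + - y))
      (2 * (\<integral>x. h x * g t (x + - 0) \<partial>lborel) - (\<integral>x. h x * g t (x + - y) \<partial>lborel) - (\<integral>x. h x * g t (x + - (- y)) \<partial>lborel))"
      by (intro has_bochner_integral_diff has_bochner_integral_mult_right tr)
    then have "(\<integral>x. g t x * sdiff h x y \<partial>lborel) = 2 * (\<integral>x. h x * g t x \<partial>lborel) - (\<integral>x. h x * g t (x - y) \<partial>lborel) - (\<integral>x. h x * g t (x + y) \<partial>lborel)"
      by (simp add: has_bochner_integral_iff algebra_simps)
    also have "\<dots> = (\<integral>x. 2 * (h x * g t (x + 0)) - h x * g t (x + y) - h x * g t (x + - y) \<partial>lborel)"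
      using hg[of 0] hg[of y] hg[of "- y"] by simp
    also have "\<dots> = T (t, y)" by (simp add: T_def algebra_simps)
    finally show ?thesis .
  qed
  \<comment> \<open>The second difference is left on \<open>h\<close>, where its L1 bound is uniform
    in \<open>t\<close>. The bound for Gaussians grows like \<open>(1 + t)^2\<close>, which
    \<open>J\<close> is not assumed to absorb.\<close>
  define Q where "Q = (\<lambda>w. J (fst (fst w)) * (g (fst (fst w)) (snd w) * sdiff h (snd w) (snd (fst w))) * k (snd (fst w)))"
  have Q_meas: "Q \<in> borel_measurable ((borel \<Otimes>\<^sub>M borel) \<Otimes>\<^sub>M borel)" unfolding Q_def by measurable
  then have Q_meas' [measurable]: "Q \<in> borel_measurable borel" by (simp add: borel_prod)
  have Qbd: "\<bar>Q (z, x)\<bar> \<le> \<bar>J (fst z)\<bar> * k (snd z) * \<bar>sdiff h x (snd z)\<bar>" for z x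
  proof (cases "fst z > 0")
    case True
    have "\<bar>g (fst z) x * sdiff h x (snd z)\<bar> \<le> 1 * \<bar>sdiff h x (snd z)\<bar>"
      unfolding abs_mult using g01[of "fst z" x] True by (intro mult_right_mono) auto
    then have "\<bar>J (fst z)\<bar> * k (snd z) * \<bar>g (fst z) x * sdiff h x (snd z)\<bar> \<le> \<bar>J (fst z)\<bar> * k (snd z) * \<bar>sdiff h x (snd z)\<bar>"
      using k0 by (intro mult_left_mono) auto
    then show ?thesis using k0[of "snd z"] by (simp add: Q_def abs_mult mult_ac)
  qed (simp add: Q_def J_def)
  have Qx: "integrable lborel (\<lambda>x. Q (z, x))" for z
  proof (rule Bochner_Integration.integrable_bound)
    show "integrable lborel (\<lambda>x. \<bar>J (fst z)\<bar> * k (snd z) * \<bar>sdiff h x (snd z)\<bar>)"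
      using M(2) by simp
    show "AE x in lborel. norm (Q (z, x)) \<le> norm (\<bar>J (fst z)\<bar> * k (snd z) * \<bar>sdiff h x (snd z)\<bar>)"
      using Qbd k0 by (simp add: abs_mult)
  qed measurable
  have Q_int: "integrable (lborel \<Otimes>\<^sub>M lborel) Q"
  proof (rule lborel_pair.Fubini_integrable)
    have "integrable lborel (\<lambda>z. \<bar>J (fst z)\<bar> * (M * (min_sq (snd z) * k (snd z))))"
      by (rule integrable_lborel_times[of "\<lambda>t. \<bar>J t\<bar>" "\<lambda>y. M * (min_sq y * k y)"]) (use J levy in auto)
    then show "integrable lborel (\<lambda>z. \<integral>x. norm (Q (z, x)) \<partial>lborel)"
    proof (rule Bochner_Integration.integrable_bound)
      show "AE z in lborel. norm (\<integral>x. norm (Q (z, x)) \<partial>lborel) \<le> norm (\<bar>J (fst z)\<bar> * (M * (min_sq (snd z) * k (snd z))))"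
      proof (rule AE_I2)
        fix z :: "real \<times> (real^'n)"
        have "(\<integral>x. norm (Q (z, x)) \<partial>lborel) \<le> (\<integral>x. \<bar>J (fst z)\<bar> * k (snd z) * \<bar>sdiff h x (snd z)\<bar> \<partial>lborel)"
          using Qbd Qx M(2) by (intro integral_mono) auto
        also have "\<dots> = \<bar>J (fst z)\<bar> * k (snd z) * (\<integral>x. \<bar>sdiff h x (snd z)\<bar> \<partial>lborel)" by simp
        also have "\<dots> \<le> \<bar>J (fst z)\<bar> * k (snd z) * (M * min_sq (snd z))"
          using M(3) k0 by (intro mult_left_mono) auto
        finally show "norm (\<integral>x. norm (Q (z, x)) \<partial>lborel) \<le> norm (\<bar>J (fst z)\<bar> * (M * (min_sq (snd z) * k (snd z))))"
          using M(1) k0[of "snd z"] by (simp add: mult_ac abs_mult)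
      qed
    qed measurable
  qed (use Qx Q_meas' in \<open>auto simp: lborel_prod\<close>)
  have Qz: "(\<integral>x. Q (z, x) \<partial>lborel) = J (fst z) * T z * k (snd z)" for z
  proof (cases "fst z > 0")
    case True
    have "(\<integral>x. Q (z, x) \<partial>lborel) = J (fst z) * (\<integral>x. g (fst z) x * sdiff h x (snd z) \<partial>lborel) * k (snd z)"
      by (simp add: Q_def)
    then show ?thesis using T_eq[of "fst z" "snd z"] True by simp
  qed (simp add: Q_def J_def)
  have JTk: "integrable lborel (\<lambda>z. J (fst z) * T z * k (snd z))"
    using lborel_pair.integrable_fst'[OF Q_int] by (simp add: Qz)
  have lhs: "(\<integral>x. (\<integral>t. J t * g t x \<partial>lborel) * (\<integral>y. sdiff h x y * k y \<partial>lborel) \<partial>lborel) = (\<integral>z. J (fst z) * T z * k (snd z) \<partial>lborel)"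
  proof -
    have "(\<integral>z. Q (z, x) \<partial>lborel) = (\<integral>t. J t * g t x \<partial>lborel) * (\<integral>y. sdiff h x y * k y \<partial>lborel)" for x
    proof -
      have "integrable lborel (\<lambda>t. J t * g t x)"
      proof (rule Bochner_Integration.integrable_bound[OF J])
        show "AE t in lborel. norm (J t * g t x) \<le> norm (J t)"
        proof (rule AE_I2)
          show "norm (J t * g t x) \<le> norm (J t)" for t
            using g01[of t x] by (cases "t > 0") (auto simp: abs_mult J_def intro: mult_left_le)
        qed
      qed measurable
      moreover have "integrable lborel (\<lambda>y. sdiff h x y * k y)"
        using test_fun_fraclap(2)[OF h s, of x] by (simp add: k_def)
      ultimately have "(\<integral>z. (J (fst z) * g (fst z) x) * (sdiff h x (snd z) * k (snd z)) \<partial>lborel) = (\<integral>t. J t * g t x \<partial>lborel) * (\<integral>y. sdiff h x y * k y \<partial>lborel)"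
        by (rule integrable_lborel_times(2))
      then show ?thesis by (simp add: Q_def mult_ac)
    qed
    then show ?thesis
      using lborel_pair.Fubini_integral[of "\<lambda>z x. Q (z, x)"] Q_int by (simp add: Qz)
  qed
  have Tint: "has_bochner_integral lborel (\<lambda>y. exp (- l * (norm y)\<^sup>2) * T (t, y))
        (2 * (pi / l) powr (DIM(real^'n)/2) * \<eta> t - 2 * (pi / (l + t)) powr (DIM(real^'n)/2) * \<eta> (l * t / (l + t)))"
    if t: "t > 0" and l: "l > 0" for t l
  proof -
    define P where "P = (\<lambda>w. exp (- l * (norm (fst w))\<^sup>2) * (h (snd w) * sdiff (g t) (snd w) (fst w)))"
    have P_meas: "P \<in> borel_measurable (borel \<Otimes>\<^sub>M borel)" unfolding P_def by measurable
    have P_int: "integrable lborel P"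
    proof (rule Bochner_Integration.integrable_bound)
      have "integrable lborel (\<lambda>y::real^'n. exp (- l * (norm y)\<^sup>2))"
        using has_bochner_integral_gauss0[OF l, where ?'a = "real^'n"] by (simp add: has_bochner_integral_iff)
      then show "integrable lborel (\<lambda>w::(real^'n) \<times> (real^'n). exp (- l * (norm (fst w))\<^sup>2) * (4 * h (snd w)))"
        by (rule integrable_lborel_times) (use h_int in simp)
      show "AE w in lborel. norm (P w) \<le> norm (exp (- l * (norm (fst w))\<^sup>2) * (4 * h (snd w)))"
      proof (rule AE_I2)
        fix w :: "(real^'n) \<times> (real^'n)"
        have "\<bar>sdiff (g t) (snd w) (fst w)\<bar> \<le> 4"
          using g01[of t "snd w"] g01[of t "snd w + fst w"] g01[of t "snd w - fst w"] t by simp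
        then have "\<bar>h (snd w)\<bar> * \<bar>sdiff (g t) (snd w) (fst w)\<bar> \<le> \<bar>h (snd w)\<bar> * 4" by (intro mult_left_mono) auto
        then show "norm (P w) \<le> norm (exp (- l * (norm (fst w))\<^sup>2) * (4 * h (snd w)))"
          by (simp add: P_def abs_mult mult.commute)
      qed
    qed (use P_meas in \<open>simp add: borel_prod\<close>)
    have P_int': "integrable (lborel \<Otimes>\<^sub>M lborel) P" using P_int by (simp add: lborel_prod)
    have fst: "(\<integral>x. P (y, x) \<partial>lborel) = exp (- l * (norm y)\<^sup>2) * T (t, y)" for y
      by (simp add: P_def T_def)
    have "(\<integral>y. exp (- l * (norm y)\<^sup>2) * T (t, y) \<partial>lborel) = (\<integral>x. \<integral>y. P (y, x) \<partial>lborel \<partial>lborel)"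
      using lborel_pair.Fubini_integral[of "\<lambda>y x. P (y, x)"] P_int' by (simp add: fst)
    also have "\<dots> = (\<integral>x. 2 * (pi / l) powr ?N * (h x * g t x) - 2 * (pi / (l + t)) powr ?N * (h x * g (l * t / (l + t)) x) \<partial>lborel)"
    proof (intro Bochner_Integration.integral_cong refl)
      fix x :: "real^'n"
      have "(\<integral>y. exp (- l * (norm y)\<^sup>2) * sdiff (g t) x y \<partial>lborel) = 2 * (pi / l) powr ?N * g t x - 2 * (pi / (l + t)) powr ?N * g (l * t / (l + t)) x"
        using has_bochner_integral_gauss_sdiff[OF t l, of x] by (simp add: g_def has_bochner_integral_iff)
      then have "h x * (\<integral>y. exp (- l * (norm y)\<^sup>2) * sdiff (g t) x y \<partial>lborel) = h x * (2 * (pi / l) powr ?N * g t x - 2 * (pi / (l + t)) powr ?N * g (l * t / (l + t)) x)"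
        by simp
      also have "h x * (\<integral>y. exp (- l * (norm y)\<^sup>2) * sdiff (g t) x y \<partial>lborel) = (\<integral>y. P (y, x) \<partial>lborel)"
        by (simp add: P_def mult.left_commute)
      finally show "(\<integral>y. P (y, x) \<partial>lborel) = 2 * (pi / l) powr ?N * (h x * g t x) - 2 * (pi / (l + t)) powr ?N * (h x * g (l * t / (l + t)) x)"
        by (simp add: algebra_simps)
    qed
    also have "\<dots> = 2 * (pi / l) powr ?N * \<eta> t - 2 * (pi / (l + t)) powr ?N * \<eta> (l * t / (l + t))"
    proof -
      have i: "integrable lborel (\<lambda>x. h x * g t' x)" if "t' \<ge> 0" for t'
        by (rule hv[of _ 1]) (use g01 that in auto)
      have "\<eta> t' = (\<integral>x. h x * g t' x \<partial>lborel)" for t' by (simp add: \<eta>_def g_def)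
      then show ?thesis using i[of t] i[of "l * t / (l + t)"] t l by simp
    qed
    finally show ?thesis
      using lborel_pair.integrable_fst'[OF P_int'] by (simp add: fst has_bochner_integral_iff)
  qed
  have \<eta>1: "\<bar>\<eta> t\<bar> \<le> (\<integral>x. \<bar>h x\<bar> \<partial>lborel)" if "t > 0" for t
  proof -
    have "\<bar>\<eta> t\<bar> \<le> (\<integral>x. \<bar>h x * g t x\<bar> \<partial>lborel)"
      unfolding \<eta>_def g_def by (rule integral_abs_bound)
    also have "\<dots> \<le> (\<integral>x. \<bar>h x\<bar> \<partial>lborel)"
    proof (rule integral_mono)
      show "integrable lborel (\<lambda>x. \<bar>h x * g t x\<bar>)"
        by (rule integrable_abs, rule hv[of _ 1]) (use g01 that in auto)
      show "\<bar>h x * g t x\<bar> \<le> \<bar>h x\<bar>" for x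
        using g01[of t x] that by (auto simp: abs_mult intro: mult_left_le)
    qed (use h_int in simp)
    finally show ?thesis .
  qed
  have \<eta>2: "\<bar>\<eta> t\<bar> \<le> C * (pi / t) powr ?N" if "t > 0" for t
  proof -
    have g: "has_bochner_integral lborel (g t) ((pi / t) powr ?N)"
      using has_bochner_integral_gauss0[OF that, where ?'a = "real^'n"] by (simp add: g_def[abs_def])
    have "\<bar>\<eta> t\<bar> \<le> (\<integral>x. \<bar>h x * g t x\<bar> \<partial>lborel)"
      unfolding \<eta>_def g_def by (rule integral_abs_bound)
    also have "\<dots> \<le> (\<integral>x. C * g t x \<partial>lborel)"
    proof (rule integral_mono)
      show "integrable lborel (\<lambda>x. \<bar>h x * g t x\<bar>)"
        by (rule integrable_abs, rule hv[of _ 1]) (use g01 that in auto)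
      show "\<bar>h x * g t x\<bar> \<le> C * g t x" for x
        using g01(1)[of t x] C(4)[of x] by (auto simp: abs_mult intro: mult_right_mono)
    qed (use g in \<open>simp add: has_bochner_integral_iff\<close>)
    also have "\<dots> = C * (pi / t) powr ?N" using g by (simp add: has_bochner_integral_iff)
    finally show ?thesis .
  qed
  \<comment> \<open>The L1 norm of \<open>h\<close> bounds \<open>\<eta>\<close> for small
    \<open>t\<close>, and the supremum of \<open>h\<close> gives decay like
    \<open>t powr (- N/2)\<close> for large \<open>t\<close>. Together they bound
    \<open>t powr s * \<eta> t\<close>, and \<open>t powr s\<close> is the gap between the weight
    \<open>N/2 - 1\<close> wanted below and the weight \<open>q - 1\<close> of
    \<open>J\<close>.\<close>
  define H where "H = max (\<integral>x. \<bar>h x\<bar> \<partial>lborel) (C * pi powr ?N)"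
  have \<eta>H: "t powr s * \<bar>\<eta> t\<bar> \<le> H" if t: "t > 0" for t
  proof (cases "t \<le> 1")
    case True
    have "t powr s * \<bar>\<eta> t\<bar> \<le> 1 * \<bar>\<eta> t\<bar>"
      using t True s by (intro mult_right_mono) (auto intro: powr_le1)
    then show ?thesis using \<eta>1[OF t] by (simp add: H_def)
  next
    case False
    have "t powr s * \<bar>\<eta> t\<bar> \<le> t powr ?N * \<bar>\<eta> t\<bar>"
      using False q by (intro mult_right_mono powr_mono) auto
    also have "\<dots> \<le> t powr ?N * (C * (pi / t) powr ?N)" using \<eta>2[OF t] by (intro mult_left_mono) auto
    also have "\<dots> = C * pi powr ?N" using t by (simp add: powr_divide)
    finally show ?thesis by (simp add: H_def)
  qed
  show \<eta>int: "integrable lborel (\<lambda>t. indicator {0<..} t * t powr (?N - 1) * \<eta> t * \<phi> (t * (1 + r)))" if r: "r \<ge> 0" for r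
  proof (rule Bochner_Integration.integrable_bound)
    have "integrable lborel (\<lambda>t. J (0 + (1 + r) * t))"
      using J r by (intro lborel_integrable_real_affine) auto
    then show "integrable lborel (\<lambda>t. H * (1 + r) powr (1 - q) * J ((1 + r) * t))" by simp
    show "AE t in lborel. norm (indicator {0<..} t * t powr (?N - 1) * \<eta> t * \<phi> (t * (1 + r))) \<le> norm (H * (1 + r) powr (1 - q) * J ((1 + r) * t))"
    proof (rule AE_I2)
      fix t :: real
      show "norm (indicator {0<..} t * t powr (?N - 1) * \<eta> t * \<phi> (t * (1 + r))) \<le> norm (H * (1 + r) powr (1 - q) * J ((1 + r) * t))"
      proof (cases "t > 0")
        case True
        have "t powr (?N - 1) = t powr (q - 1) * t powr s" unfolding q0(2)[symmetric] powr_add[symmetric] by (simp add: algebra_simps)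
        then have "norm (indicator {0<..} t * t powr (?N - 1) * \<eta> t * \<phi> (t * (1 + r))) = t powr (q - 1) * \<bar>\<phi> (t * (1 + r))\<bar> * (t powr s * \<bar>\<eta> t\<bar>)"
          using True by (simp add: abs_mult mult_ac)
        also have "\<dots> \<le> t powr (q - 1) * \<bar>\<phi> (t * (1 + r))\<bar> * H"
          using \<eta>H[OF True] by (intro mult_left_mono) auto
        also have "\<dots> \<le> t powr (q - 1) * \<bar>\<phi> (t * (1 + r))\<bar> * \<bar>H\<bar>"
          by (intro mult_left_mono) auto
        also have "t powr (q - 1) = (1 + r) powr (1 - q) * ((1 + r) * t) powr (q - 1)"
          using True r by (simp add: powr_mult mult.assoc[symmetric] powr_add[symmetric])
        finally show ?thesis using True r by (simp add: J_def abs_mult mult_ac zero_less_mult_iff)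
      qed simp
    qed
  qed measurable
  have \<eta>int': "integrable lborel (\<lambda>t. indicator {0<..} t * t powr (q + s - 1) * \<eta> t * \<phi> (t * (1 + r)))" if "r \<ge> 0" for r
    using \<eta>int[OF that] by (simp add: q_def)
  \<comment> \<open>The exponent \<open>q + s - N/2\<close> is 0, and \<open>(1 + r) powr 0\<close>
    is 1 except at \<open>r = -1\<close>, where \<open>0 powr 0 = 0\<close>. For
    \<open>r <= 0\<close> the indicator restores the identity.\<close>
  have II: "I r = (\<integral>t. indicator {0<..} t * t powr (q + s - 1) * \<eta> t * (\<phi> t - (1 + r) powr (q + s - DIM(real^'n)/2) * \<phi> (t * (1 + r))) \<partial>lborel)"
    if "r > 0" for r
    using that by (simp add: I_def q_def)
  have II': "indicator {0<..} r * r powr (- s - 1) * I r = indicator {0<..} r * r powr (- s - 1) * (\<integral>t. indicator {0<..} t * t powr (q + s - 1) * \<eta> t * (\<phi> t - (1 + r) powr (q + s - DIM(real^'n)/2) * \<phi> (t * (1 + r))) \<partial>lborel)" for r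
    using II[of r] by (cases "r > 0") auto
  have int2: "integrable lborel (\<lambda>(t, y). indicator {0<..} t * t powr (q - 1) * \<phi> t * T (t, y) * norm y powr (- (real DIM(real^'n) + 2 * s)))"
    using JTk by (simp add: J_def k_def split_def)
  note core = levy_kernel_fubini[where T = T and \<phi> = \<phi> and \<eta> = \<eta> and q = q, OF s(1) T_meas \<phi>_meas _ Tint int2 \<eta>int', folded II']
  show "integrable lborel (\<lambda>r. indicator {0<..} r * r powr (- s - 1) * I r)"
    by (rule core(1)) auto
  have eq1: "Gamma (?N + s) * (\<integral>z. J (fst z) * T z * k (snd z) \<partial>lborel)
       = 2 * pi powr ?N * (\<integral>r. indicator {0<..} r * r powr (- s - 1) * I r \<partial>lborel)"
    using core(2) by (simp add: J_def k_def split_def)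
  have "(\<integral>x. (\<integral>t. indicator {0<..} t * t powr (?N - s - 1) * \<phi> t * exp (- t * (norm x)\<^sup>2) \<partial>lborel) * fraclap s h x \<partial>lborel)
    = (\<integral>x. c_sn s (real CARD('n)) / 2 * ((\<integral>t. J t * g t x \<partial>lborel) * (\<integral>y. sdiff h x y * k y \<partial>lborel)) \<partial>lborel)"
    unfolding test_fun_fraclap(1)[OF h s] J_def g_def k_def q_def by (simp add: mult_ac)
  also have "\<dots> = c_sn s (real CARD('n)) / 2 * (\<integral>z. J (fst z) * T z * k (snd z) \<partial>lborel)"
    by (simp only: integral_mult_right_zero lhs)
  also have "(\<integral>z. J (fst z) * T z * k (snd z) \<partial>lborel) = 2 * pi powr ?N / Gamma (?N + s) * (\<integral>r. indicator {0<..} r * r powr (- s - 1) * I r \<partial>lborel)"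
  proof -
    have "Gamma (?N + s) > 0" using s by (auto intro!: Gamma_real_pos add_nonneg_pos)
    then show ?thesis using eq1 by (simp add: field_simps)
  qed
  finally show "(\<integral>x. (\<integral>t. indicator {0<..} t * t powr (?N - s - 1) * \<phi> t * exp (- t * (norm x)\<^sup>2) \<partial>lborel) * fraclap s h x \<partial>lborel)
      = c_sn s (real CARD('n)) * pi powr ?N / Gamma (?N + s) * (\<integral>r. indicator {0<..} r * r powr (- s - 1) * I r \<partial>lborel)"
    by simp
qed

section \<open>Nonnegativity\<close>

lemma c_sn_nonneg: "0 < s \<Longrightarrow> s < 1 \<Longrightarrow> n \<ge> 0 \<Longrightarrow> 0 \<le> c_sn s n"
  unfolding c_sn_def by (intro divide_nonneg_nonneg mult_nonneg_nonneg Gamma_real_nonneg) (auto simp: add_nonneg_pos)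

text \<open>For bounded \<open>u\<close> the weighted integrability is automatic: outside the unit
  ball the weight is at most the kernel and \<open>min_sq\<close> is 1, so
  \<open>integrable_levy_kernel\<close> applies; on the ball the weight is at most 1.\<close>

lemma fraclap_distr_nonnegI:
  fixes u :: "real^'n \<Rightarrow> real"
  assumes s: "0 < s" "s < 1" and meas [measurable]: "u \<in> borel_measurable borel" and B: "\<And>x. \<bar>u x\<bar> \<le> B"
    and nonneg: "\<And>h. test_fun h \<Longrightarrow> (\<And>x. 0 \<le> h x) \<Longrightarrow> 0 \<le> (\<integral>x. u x * fraclap s h x \<partial>lborel)"
  shows "fraclap_distr_nonneg s u"
  unfolding fraclap_distr_nonneg_def
proof (intro conjI allI impI)
  let ?p = "(real CARD('n) + 2 * s) / 2"
  have B0: "B \<ge> 0" using B[of 0] by linarith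
  define b where "b = (\<lambda>x::real^'n. B * (indicator (cball 0 1) x + min_sq x * norm x powr (- (real DIM(real^'n) + 2 * s))))"
  have "integrable lborel (\<lambda>x::real^'n. indicator (cball 0 1) x + min_sq x * norm x powr (- (real DIM(real^'n) + 2 * s)) :: real)"
    using integrable_levy_kernel[OF s, where ?'a = "real^'n"]
    by (intro Bochner_Integration.integrable_add integrable_real_indicator)
      (auto intro: emeasure_bounded_finite[OF bounded_cball, unfolded infinity_ennreal_def])
  then have "integrable lborel b" unfolding b_def by (rule integrable_mult_right)
  then show "integrable lborel (\<lambda>x. \<bar>u x\<bar> / (1 + (norm x)\<^sup>2) powr ?p)"
  proof (rule Bochner_Integration.integrable_bound)
    show "AE x in lborel. norm (\<bar>u x\<bar> / (1 + (norm x)\<^sup>2) powr ?p) \<le> norm (b x)"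
    proof (rule AE_I2)
      fix x :: "real^'n"
      have 1: "(1 + (norm x)\<^sup>2) powr (- ?p) \<le> indicator (cball 0 1) x + min_sq x * norm x powr (- (real DIM(real^'n) + 2 * s))"
      proof (cases "norm x \<le> 1")
        case True
        have "(1 + (norm x)\<^sup>2) powr (- ?p) \<le> 1 powr (- ?p)"
          using s by (intro powr_mono2') auto
        then show ?thesis using True by (simp add: add_increasing2)
      next
        case False
        then have "1 < norm x" by simp
        then have "1 \<le> (norm x)\<^sup>2" by (simp add: one_le_power)
        then have m: "min_sq x = 1" by (simp add: min_sq_def)
        have "(1 + (norm x)\<^sup>2) powr (- ?p) \<le> ((norm x)\<^sup>2) powr (- ?p)"
          using s False by (intro powr_mono2') auto
        also have "\<dots> = norm x powr (- (real CARD('n) + 2 * s))"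
        proof -
          have "(norm x)\<^sup>2 = norm x powr 2" using \<open>1 < norm x\<close> by simp
          moreover have "2 * - (a / 2) = - a" for a :: real by simp
          ultimately show ?thesis by (simp only: powr_powr)
        qed
        finally show ?thesis using m False by simp
      qed
      have "\<bar>u x\<bar> / (1 + (norm x)\<^sup>2) powr ?p = \<bar>u x\<bar> * (1 + (norm x)\<^sup>2) powr (- ?p)"
        by (simp only: powr_minus_divide) simp
      also have "\<dots> \<le> b x"
        unfolding b_def by (intro mult_mono B 1 B0) auto
      finally show "norm (\<bar>u x\<bar> / (1 + (norm x)\<^sup>2) powr ?p) \<le> norm (b x)" by simp
    qed
  qed measurable
qed (use nonneg in auto)

section \<open>Powers k >= 2: a sign from decreasing densities\<close>

lemma laplace_antimono:
  assumes "\<rho> \<le> \<rho>'"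
  shows "laplace q \<phi> \<rho>' \<le> laplace q \<phi> \<rho>"
  unfolding laplace_def
proof (rule nn_integral_mono, rule mult_right_mono)
  fix t :: real
  show "ennreal (indicator {0<..} t * t powr (q - 1) * exp (- t * \<rho>')) \<le> ennreal (indicator {0<..} t * t powr (q - 1) * exp (- t * \<rho>))"
    using assms by (cases "t > 0") (auto intro!: ennreal_leI mult_left_mono)
qed simp

text \<open>An infinite value at \<open>t0\<close> would spread by monotonicity to all of
  \<open>(0, t0]\<close> and make the transform infinite. This permits the passage from
  \<open>ennreal\<close> to real densities.\<close>

lemma decr_density_finite:
  assumes \<phi>: "decr_density \<phi>" and fin: "laplace q \<phi> 0 < \<infinity>" and t0: "t0 > 0"
  shows "\<phi> t0 < \<infinity>"
proof (rule ccontr)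
  assume "\<not> \<phi> t0 < \<infinity>"
  then have "\<phi> t0 = \<infinity>" by (simp add: less_top[symmetric])
  moreover have "\<phi> t0 \<le> \<phi> t" if "0 < t" "t \<le> t0" for t
    using \<phi> that by (auto simp: decr_density_def)
  ultimately have top: "\<phi> t = \<infinity>" if "0 < t" "t \<le> t0" for t
    using that by (auto simp: top_unique)
  have "(\<integral>\<^sup>+t. \<infinity> * indicator {0<..t0} t \<partial>lborel) \<le> laplace q \<phi> 0"
    unfolding laplace_def
  proof (rule nn_integral_mono)
    fix t :: real
    show "\<infinity> * indicator {0<..t0} t \<le> ennreal (indicator {0<..} t * t powr (q - 1) * exp (- t * 0)) * \<phi> t"
      using top[of t] by (cases "t \<in> {0<..t0}") (auto simp: ennreal_mult_top)
  qed
  moreover have "(\<integral>\<^sup>+t. \<infinity> * indicator {0<..t0} t \<partial>(lborel :: real measure)) = \<infinity>"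
    using t0 by (subst nn_integral_cmult_indicator) (auto simp: ennreal_top_mult)
  ultimately show False using fin by (simp add: top_unique)
qed

text \<open>In the formula for the pairing every factor has a sign:
  \<open>f t - f (t * (1 + r))\<close> because the density decreases, and the Gaussian averages of
  \<open>h\<close> because \<open>h\<close> is nonnegative.\<close>

lemma laplace_pairing_nonneg:
  fixes h u :: "real^'n \<Rightarrow> real"
  assumes h: "test_fun h" "\<And>x. 0 \<le> h x" and s: "0 < s" "s < 1" and q: "0 < real CARD('n) / 2 - s"
    and \<phi>: "decr_density \<phi>" and u0: "\<And>x. 0 \<le> u x"
    and u: "\<And>x. ennreal (u x) = laplace (real CARD('n) / 2 - s) \<phi> ((norm x)\<^sup>2)"
  shows "0 \<le> (\<integral>x. u x * fraclap s h x \<partial>lborel)"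
proof -
  let ?q = "real CARD('n) / 2 - s"
  have [measurable]: "\<phi> \<in> borel_measurable borel" using \<phi> by (simp add: decr_density_def)
  define f where "f = (\<lambda>t. enn2real (\<phi> t))"
  have [measurable]: "f \<in> borel_measurable borel" unfolding f_def by measurable
  \<comment> \<open>At the origin the transform is the total mass of the weighted density, so the
    finite value \<open>u 0\<close> already yields the integrability required of
    \<open>f\<close>.\<close>
  have "laplace ?q \<phi> 0 = ennreal (u 0)" using u[of 0] by simp
  then have fin: "laplace ?q \<phi> 0 < \<infinity>" by simp
  have f: "ennreal (f t) = \<phi> t" if "t > 0" for t
    using decr_density_finite[OF \<phi> fin that] by (simp add: f_def less_top)
  have f0: "f t \<ge> 0" for t by (simp add: f_def)
  have f_mono: "f t' \<le> f t" if "0 < t" "t \<le> t'" for t t'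
    unfolding f_def using \<phi> that decr_density_finite[OF \<phi> fin that(1)]
    by (intro enn2real_mono) (auto simp: decr_density_def)
  have uf: "has_bochner_integral lborel (\<lambda>t. indicator {0<..} t * t powr (?q - 1) * f t * exp (- t * (norm x)\<^sup>2)) (u x)" for x
  proof (rule has_bochner_integral_nn_integral)
    show "(\<integral>\<^sup>+t. ennreal (indicator {0<..} t * t powr (?q - 1) * f t * exp (- t * (norm x)\<^sup>2)) \<partial>lborel) = ennreal (u x)"
      unfolding u laplace_def
    proof (rule nn_integral_cong)
      fix t :: real
      show "ennreal (indicator {0<..} t * t powr (?q - 1) * f t * exp (- t * (norm x)\<^sup>2)) = ennreal (indicator {0<..} t * t powr (?q - 1) * exp (- t * (norm x)\<^sup>2)) * \<phi> t"
        using f[of t] f0[of t] by (cases "t > 0") (auto simp: ennreal_mult[symmetric] mult_ac simp flip: f)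
    qed
  qed (use f0 u0 in auto)
  have f_int: "integrable lborel (\<lambda>t. indicator {0<..} t * t powr (?q - 1) * f t)"
    using uf[of 0] by (simp add: has_bochner_integral_iff)
  have ueq: "u x = (\<integral>t. indicator {0<..} t * t powr (?q - 1) * f t * exp (- t * (norm x)\<^sup>2) \<partial>lborel)" for x
    using has_bochner_integral_integral_eq[OF uf[of x]] by simp
  define I where "I = (\<lambda>r. \<integral>t. indicator {0<..} t * t powr (real CARD('n) / 2 - 1) * (\<integral>x. h x * exp (- t * (norm x)\<^sup>2) \<partial>lborel) * (f t - f (t * (1 + r))) \<partial>lborel)"
  have I: "I r \<ge> 0" if "r > 0" for r
    unfolding I_def
  proof (rule integral_nonneg_AE, rule AE_I2)
    fix t :: real
    show "0 \<le> indicator {0<..} t * t powr (real CARD('n) / 2 - 1) * (\<integral>x. h x * exp (- t * (norm x)\<^sup>2) \<partial>lborel) * (f t - f (t * (1 + r)))"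
    proof (cases "t > 0")
      case True
      have "f (t * (1 + r)) \<le> f t" using True that by (intro f_mono) (auto simp: algebra_simps)
      moreover have "0 \<le> (\<integral>x. h x * exp (- t * (norm x)\<^sup>2) \<partial>lborel)"
        using h(2) by (intro integral_nonneg_AE AE_I2) auto
      ultimately show ?thesis by (intro mult_nonneg_nonneg) auto
    qed simp
  qed
  have "0 \<le> (\<integral>r. indicator {0<..} r * r powr (- s - 1) * I r \<partial>lborel)"
  proof (rule integral_nonneg_AE, rule AE_I2)
    show "0 \<le> indicator {0<..} r * r powr (- s - 1) * I r" for r using I[of r] by (cases "r > 0") auto
  qed
  then have "0 \<le> c_sn s (real CARD('n)) * pi powr (real CARD('n) / 2) / Gamma (real CARD('n) / 2 + s) * (\<integral>r. indicator {0<..} r * r powr (- s - 1) * I r \<partial>lborel)"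
    using s by (intro mult_nonneg_nonneg divide_nonneg_nonneg c_sn_nonneg Gamma_real_nonneg) (auto simp: add_nonneg_pos)
  then show ?thesis
    unfolding ueq I_def by (subst fraclap_pairing_gauss_mixture(3)[OF h(1) s q _ f_int]) auto
qed

section \<open>The power k = 1: comparison by scaling\<close>

text \<open>The rescaling \<open>r \<mapsto> r / c\<close> makes the dependence on \<open>c\<close> monotone.\<close>

lemma fraclap_pairing_exp_scaled:
  fixes h :: "real^'n \<Rightarrow> real"
  assumes h: "test_fun h" "\<And>x. 0 \<le> h x" and s: "0 < s" "s < 1" and q: "0 < real CARD('n) / 2 - s" and c: "1 \<le> c"
  defines "U \<equiv> \<lambda>c (x::real^'n). \<integral>t. indicator {0<..} t * t powr (real CARD('n) / 2 - s - 1) * exp (- (t * c)) * exp (- t * (norm x)\<^sup>2) \<partial>lborel"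
  shows "c powr (- s) * (\<integral>x. U c x * fraclap s h x \<partial>lborel) \<le> (\<integral>x. U 1 x * fraclap s h x \<partial>lborel)"
proof -
  let ?N = "real CARD('n) / 2"
  define K where "K = c_sn s (real CARD('n)) * pi powr ?N / Gamma (?N + s)"
  have K: "K \<ge> 0"
    unfolding K_def using s by (intro mult_nonneg_nonneg divide_nonneg_nonneg c_sn_nonneg Gamma_real_nonneg) (auto simp: add_nonneg_pos)
  define \<eta> where "\<eta> = (\<lambda>t. \<integral>x. h x * exp (- t * (norm x)\<^sup>2) \<partial>lborel)"
  have \<eta>0: "\<eta> t \<ge> 0" for t unfolding \<eta>_def using h(2) by (intro integral_nonneg_AE) auto
  define I where "I = (\<lambda>c r. \<integral>t. indicator {0<..} t * t powr (?N - 1) * \<eta> t * (exp (- (t * c)) - exp (- (t * (1 + r) * c))) \<partial>lborel)"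
  have e_int: "integrable lborel (\<lambda>t. indicator {0<..} t * t powr (?N - s - 1) * exp (- (t * c)))" if "c > 0" for c
    using has_bochner_integral_gamma[OF q that] by (simp add: has_bochner_integral_iff mult.commute)
  have \<eta>_int: "integrable lborel (\<lambda>t. indicator {0<..} t * t powr (?N - 1) * \<eta> t * exp (- (t * (1 + r) * c)))" if "c > 0" "r \<ge> 0" for c r
    unfolding \<eta>_def by (rule fraclap_pairing_gauss_mixture(1)[OF h(1) s q _ e_int[OF that(1)] that(2)]) simp
  have I_int: "integrable lborel (\<lambda>r. indicator {0<..} r * r powr (- s - 1) * I c r)" if "c > 0" for c
    unfolding I_def \<eta>_def by (rule fraclap_pairing_gauss_mixture(2)[OF h(1) s q _ e_int[OF that]]) simp
  have U: "(\<integral>x. U c x * fraclap s h x \<partial>lborel) = K * (\<integral>r. indicator {0<..} r * r powr (- s - 1) * I c r \<partial>lborel)" if "c > 0" for c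
    unfolding I_def \<eta>_def K_def U_def by (rule fraclap_pairing_gauss_mixture(3)[OF h(1) s q _ e_int[OF that]]) simp
  define F where "F = (\<lambda>r. indicator {0<..} r * r powr (- s - 1) * I c r)"
  \<comment> \<open>Replacing \<open>r\<close> by \<open>r / c\<close>, the Jacobian and
    \<open>r powr (- s - 1)\<close> together contribute \<open>c powr s\<close>, which the factor
    \<open>c powr (- s)\<close> in the claim removes.\<close>
  have Fc: "inverse c * F (inverse c * r) = c powr s * (indicator {0<..} r * r powr (- s - 1) * I c (inverse c * r))" for r
  proof (cases "r > 0")
    case True
    have "inverse c * (inverse c) powr (- s - 1) = c powr s"
      using c powr_mult_base[of "inverse c" "- s - 1"] by (simp add: inverse_powr powr_minus)
    moreover have "F (inverse c * r) = inverse c powr (- s - 1) * (r powr (- s - 1) * I c (inverse c * r))"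
      using True c by (simp add: F_def powr_mult zero_less_mult_iff)
    ultimately show ?thesis using True by (simp add: mult.assoc[symmetric])
  next
    case False
    then have "\<not> inverse c * r > 0" using c by (simp add: zero_less_mult_iff)
    then show ?thesis using False by (simp add: F_def)
  qed
  have "integrable lborel (\<lambda>r. F (0 + inverse c * r))"
    using I_int[of c] c unfolding F_def[symmetric] by (intro lborel_integrable_real_affine) auto
  then have "integrable lborel (\<lambda>r. inverse c * F (inverse c * r))" by simp
  then have sc_int: "integrable lborel (\<lambda>r. indicator {0<..} r * r powr (- s - 1) * I c (inverse c * r))"
    unfolding Fc using c by simp
  have "(\<integral>r. F r \<partial>lborel) = inverse c * (\<integral>r. F (inverse c * r) \<partial>lborel)"
    using lborel_integral_real_affine[of "inverse c" F 0] c by simp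
  also have "\<dots> = (\<integral>r. inverse c * F (inverse c * r) \<partial>lborel)" by simp
  also have "\<dots> = c powr s * (\<integral>r. indicator {0<..} r * r powr (- s - 1) * I c (inverse c * r) \<partial>lborel)"
    unfolding Fc by (rule integral_mult_right_zero)
  finally have "c powr (- s) * (\<integral>r. F r \<partial>lborel) = (\<integral>r. indicator {0<..} r * r powr (- s - 1) * I c (inverse c * r) \<partial>lborel)"
    using c by (simp add: powr_minus)
  also have "\<dots> \<le> (\<integral>r. indicator {0<..} r * r powr (- s - 1) * I 1 r \<partial>lborel)"
  proof (rule integral_mono[OF sc_int I_int])
    fix r :: real
    have "I c (inverse c * r) \<le> I 1 r" if r: "r > 0"
      unfolding I_def
    proof (rule integral_mono)
      have "integrable lborel (\<lambda>t. indicator {0<..} t * t powr (?N - 1) * \<eta> t * exp (- (t * (1 + 0) * c')) - indicator {0<..} t * t powr (?N - 1) * \<eta> t * exp (- (t * (1 + r') * c')))" 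
        if "c' > 0" "r' \<ge> 0" for c' r'
        using that by (intro Bochner_Integration.integrable_diff \<eta>_int) auto
      then have d: "integrable lborel (\<lambda>t. indicator {0<..} t * t powr (?N - 1) * \<eta> t * (exp (- (t * c')) - exp (- (t * (1 + r') * c'))))" 
        if "c' > 0" "r' \<ge> 0" for c' r'
        using that by (simp add: right_diff_distrib)
      show "integrable lborel (\<lambda>t. indicator {0<..} t * t powr (?N - 1) * \<eta> t * (exp (- (t * c)) - exp (- (t * (1 + inverse c * r) * c))))"
        using d[of c "inverse c * r"] c r by simp
      show "integrable lborel (\<lambda>t. indicator {0<..} t * t powr (?N - 1) * \<eta> t * (exp (- (t * 1)) - exp (- (t * (1 + r) * 1))))"
        using d[of 1 r] r by simp
      fix t :: real
      show "indicator {0<..} t * t powr (?N - 1) * \<eta> t * (exp (- (t * c)) - exp (- (t * (1 + inverse c * r) * c)))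
        \<le> indicator {0<..} t * t powr (?N - 1) * \<eta> t * (exp (- (t * 1)) - exp (- (t * (1 + r) * 1)))"
      proof (cases "t > 0")
        case True
        \<comment> \<open>After the rescaling the increment \<open>t * r\<close> is free of
          \<open>c\<close>. What remains of \<open>c\<close> is the prefactor
          \<open>exp (- (t * c))\<close>, which decreases in \<open>c\<close>.\<close>
        have "t * (1 + inverse c * r) * c = t * c + t * r" using c by (simp add: algebra_simps)
        then have "exp (- (t * c)) - exp (- (t * (1 + inverse c * r) * c)) = exp (- (t * c)) * (1 - exp (- (t * r)))"
          by (simp add: exp_add[symmetric] right_diff_distrib)
        also have "\<dots> \<le> exp (- (t * 1)) * (1 - exp (- (t * r)))"
          using True r c by (intro mult_right_mono) auto
        also have "\<dots> = exp (- (t * 1)) - exp (- (t * (1 + r) * 1))"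
          by (simp add: exp_add[symmetric] algebra_simps)
        finally show ?thesis using True \<eta>0[of t] by (intro mult_left_mono) auto
      qed simp
    qed
    then show "indicator {0<..} r * r powr (- s - 1) * I c (inverse c * r) \<le> indicator {0<..} r * r powr (- s - 1) * I 1 r"
      by (cases "r > 0") (auto intro: mult_left_mono)
  qed simp
  finally have "c powr (- s) * (\<integral>r. F r \<partial>lborel) \<le> (\<integral>r. indicator {0<..} r * r powr (- s - 1) * I 1 r \<partial>lborel)" .
  from mult_left_mono[OF this K] show ?thesis
    using U[of c] U[of 1] c unfolding F_def by (simp add: mult.left_commute)
qed

text \<open>Here the exponent of \<open>1 + r\<close> is \<open>- s > - 1\<close>, out of reach of
  \<open>psi_antimono\<close>. The sign is obtained after pairing instead: Fubini moves the integral
  over \<open>x\<close> inside the one over \<open>r\<close>, and for each \<open>r\<close> the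
  scaling inequality with \<open>c = 1 + r\<close> compares \<open>U 1\<close> with
  \<open>U (1 + r)\<close>.\<close>

lemma fraclap_bubble_distr_nonneg:
  fixes s \<gamma> :: real
  assumes s: "0 < s" "s < 1" and \<gamma>: "\<gamma> > 0" and \<gamma>s: "\<gamma> + s = real CARD('n) / 2 - s"
  shows "fraclap_distr_nonneg s (\<lambda>x::real^'n. - fraclap s (\<lambda>y. - bubble \<gamma> y) x)"
proof -
  let ?q = "real CARD('n) / 2 - s"
  have q: "?q > 0" using \<gamma>s \<gamma> s by linarith
  define C where "C = c_sn s (real CARD('n)) * pi powr (CARD('n) / 2) / (Gamma (CARD('n) / 2 + s) * Gamma \<gamma>)"
  have C: "C \<ge> 0"
    unfolding C_def using s \<gamma> by (intro divide_nonneg_nonneg mult_nonneg_nonneg c_sn_nonneg Gamma_real_nonneg) (auto simp: add_nonneg_pos)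
  define G where "G = (\<lambda>c (x::real^'n) t. indicator {0<..} t * t powr (?q - 1) * exp (- (t * c)) * exp (- t * (norm x)\<^sup>2))"
  define U where "U = (\<lambda>c x. \<integral>t. G c x t \<partial>lborel)"
  define W where "W = (\<lambda>x r. U 1 x - (1 + r) powr (- s) * U (1 + r) x)"
  have G_meas [measurable (raw)]: "(\<lambda>z. G (a z) (b z) (d z)) \<in> borel_measurable M"
    if [measurable]: "a \<in> borel_measurable M" "b \<in> borel_measurable M" "d \<in> borel_measurable M" for a b d M
    unfolding G_def by measurable
  have U_meas [measurable (raw)]: "(\<lambda>z. U (a z) (b z)) \<in> borel_measurable M"
    if [measurable]: "a \<in> borel_measurable M" "b \<in> borel_measurable M" for a b M
    unfolding U_def by measurable
  have W_meas [measurable (raw)]: "(\<lambda>z. W (a z) (b z)) \<in> borel_measurable M"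
    if [measurable]: "a \<in> borel_measurable M" "b \<in> borel_measurable M" for a b M
    unfolding W_def by measurable
  have G_int: "integrable lborel (G c x)" if "c > 0" for c x
  proof -
    have "G c x = (\<lambda>t. indicator {0<..} t * t powr (?q - 1) * exp (- (c + (norm x)\<^sup>2) * t))"
      by (simp add: G_def fun_eq_iff exp_add[symmetric] algebra_simps)
    then show ?thesis
      using has_bochner_integral_gamma[OF q, of "c + (norm x)\<^sup>2"] that by (simp add: has_bochner_integral_iff add_pos_nonneg)
  qed
  have G0: "0 \<le> G c x t" for c x t by (simp add: G_def)
  have U0: "0 \<le> U c x" for c x unfolding U_def using G0 by (intro integral_nonneg_AE) auto
  have U1: "U c x \<le> U 1 0" if "c \<ge> 1" for c x
    unfolding U_def
  proof (rule integral_mono[OF G_int G_int])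
    show "G c x t \<le> G 1 0 t" for t
    proof (cases "t > 0")
      case True
      then have "exp (- (t * c)) * exp (- t * (norm x)\<^sup>2) \<le> exp (- (t * 1)) * 1"
        using that by (intro mult_mono) auto
      then show ?thesis using True by (simp add: G_def mult.assoc mult_left_mono)
    qed (simp add: G_def)
  qed (use that in auto)
  have W_eq: "W x r = (\<integral>t. indicator {0<..} t * t powr (?q - 1) * exp (- t * (norm x)\<^sup>2) * (exp (- t) - (1 + r) powr (- s) * exp (- (t * (1 + r)))) \<partial>lborel)"
    if "r > 0" for x r
  proof -
    have "W x r = (\<integral>t. G 1 x t - (1 + r) powr (- s) * G (1 + r) x t \<partial>lborel)"
      unfolding W_def U_def using G_int[of 1 x] G_int[of "1 + r" x] that by simp
    also have "\<dots> = (\<integral>t. indicator {0<..} t * t powr (?q - 1) * exp (- t * (norm x)\<^sup>2) * (exp (- t) - (1 + r) powr (- s) * exp (- (t * (1 + r)))) \<partial>lborel)"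
      by (intro Bochner_Integration.integral_cong refl) (simp add: G_def algebra_simps)
    finally show ?thesis .
  qed
  have W0: "W x r \<ge> 0" if "r > 0" for x r
    unfolding W_eq[OF that]
  proof (rule integral_nonneg_AE, rule AE_I2)
    show "0 \<le> indicator {0<..} t * t powr (?q - 1) * exp (- t * (norm x)\<^sup>2) * (exp (- t) - (1 + r) powr (- s) * exp (- (t * (1 + r))))" for t
      using psi_nonneg[of "- s" r t] that s by (cases "t > 0") auto
  qed
  \<comment> \<open>The integrand at \<open>x\<close> is the one at 0 times
    \<open>exp (- t * (norm x)^2)\<close>, and the one at 0 is nonnegative by
    \<open>psi_nonneg\<close>. So \<open>V 0\<close> dominates every \<open>V x\<close>, which gives
    Fubini a bound uniform in \<open>x\<close>.\<close>
  have W_mono: "W x r \<le> W 0 r" if r: "r > 0" for x r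
  proof -
    have i: "integrable lborel (\<lambda>t. G 1 x t - (1 + r) powr (- s) * G (1 + r) x t)" for x
      using G_int[of 1 x] G_int[of "1 + r" x] r by simp
    have W: "W x r = (\<integral>t. G 1 x t - (1 + r) powr (- s) * G (1 + r) x t \<partial>lborel)" for x
      unfolding W_def U_def using G_int[of 1 x] G_int[of "1 + r" x] r by simp
    show ?thesis
      unfolding W
    proof (rule integral_mono[OF i i])
      fix t
      show "G 1 x t - (1 + r) powr (- s) * G (1 + r) x t \<le> G 1 0 t - (1 + r) powr (- s) * G (1 + r) 0 t"
      proof (cases "t > 0")
        case True
        have e: "exp (- t * (norm x)\<^sup>2) \<le> 1" using True by simp
        have "0 \<le> G 1 0 t - (1 + r) powr (- s) * G (1 + r) 0 t"
        proof -
          have "G 1 0 t - (1 + r) powr (- s) * G (1 + r) 0 t = t powr (?q - 1) * (exp (- t) - (1 + r) powr (- s) * exp (- (t * (1 + r))))"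
            using True by (simp add: G_def algebra_simps)
          then show ?thesis using psi_nonneg[of "- s" r t] r s True by simp
        qed
        then have "(G 1 0 t - (1 + r) powr (- s) * G (1 + r) 0 t) * exp (- t * (norm x)\<^sup>2) \<le> G 1 0 t - (1 + r) powr (- s) * G (1 + r) 0 t"
          using e by (intro mult_left_le) auto
        then show ?thesis by (simp add: G_def left_diff_distrib mult.assoc)
      qed (simp add: G_def)
    qed
  qed
  define V where "V = (\<lambda>x r. indicator {0<..} r * r powr (- s - 1) * W x r)"
  have V_meas [measurable (raw)]: "(\<lambda>z. V (a z) (b z)) \<in> borel_measurable M"
    if [measurable]: "a \<in> borel_measurable M" "b \<in> borel_measurable M" for a b M
    unfolding V_def by measurable
  have V0: "0 \<le> V x r" for x r using W0[of r x] by (cases "r > 0") (auto simp: V_def)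
  have V_mono: "V x r \<le> V 0 r" for x r
    using W_mono[of r x] by (cases "r > 0") (auto simp: V_def intro: mult_left_mono)
  have ex: "\<gamma> + s - real CARD('n) / 2 = - s" using \<gamma>s by simp
  have Veq: "V x r = indicator {0<..} r * r powr (- s - 1) * (\<integral>t. indicator {0<..} t * t powr (\<gamma> + s - 1) * exp (- t * (norm x)\<^sup>2)
      * (exp (- t) - (1 + r) powr (\<gamma> + s - CARD('n) / 2) * exp (- (t * (1 + r)))) \<partial>lborel)" for x r
    unfolding ex unfolding \<gamma>s using W_eq[of r x] by (cases "r > 0") (simp_all add: V_def)
  have V_int: "integrable lborel (V x)" and w: "- fraclap s (\<lambda>y. - bubble \<gamma> y) x = C * (\<integral>r. V x r \<partial>lborel)" for x :: "real^'n"
    using fraclap_bubble[OF s \<gamma>, of x, folded Veq] by (simp_all add: C_def)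
  define B where "B = (\<integral>r. V 0 r \<partial>lborel)"
  have VB: "(\<integral>r. V x r \<partial>lborel) \<le> B" for x
    unfolding B_def by (rule integral_mono[OF V_int V_int V_mono])
  have V_pos: "0 \<le> (\<integral>r. V x r \<partial>lborel)" for x using V0 by (intro integral_nonneg_AE) auto
  show ?thesis
    unfolding w
  proof (rule fraclap_distr_nonnegI[OF s])
    show "(\<lambda>x. C * (\<integral>r. V x r \<partial>lborel)) \<in> borel_measurable borel" by measurable
    show "\<bar>C * (\<integral>r. V x r \<partial>lborel)\<bar> \<le> C * B" for x
      using C V_pos[of x] VB[of x] by (simp add: abs_mult mult_left_mono)
    fix h :: "real^'n \<Rightarrow> real" assume h: "test_fun h" "\<And>x. 0 \<le> h x"
    let ?g = "fraclap s h"
    have g: "integrable lborel ?g" by (rule test_fun_fraclap(3)[OF h(1) s])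
    have [measurable]: "?g \<in> borel_measurable borel" using borel_measurable_integrable[OF g] by simp
    have int: "integrable (lborel \<Otimes>\<^sub>M lborel) (\<lambda>(x, r). V x r * ?g x)"
    proof (rule lborel_pair.Fubini_integrable)
      show "integrable lborel (\<lambda>x. \<integral>r. norm (case (x, r) of (x, r) \<Rightarrow> V x r * ?g x) \<partial>lborel)"
      proof (rule Bochner_Integration.integrable_bound)
        show "integrable lborel (\<lambda>x. B * ?g x)" using g by simp
        show "AE x in lborel. norm (\<integral>r. norm (case (x, r) of (x, r) \<Rightarrow> V x r * ?g x) \<partial>lborel) \<le> norm (B * ?g x)"
        proof (rule AE_I2)
          fix x
          have "(\<integral>r. norm (case (x, r) of (x, r) \<Rightarrow> V x r * ?g x) \<partial>lborel) = (\<integral>r. V x r \<partial>lborel) * \<bar>?g x\<bar>"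
            using V0 by (simp add: abs_mult)
          also have "\<bar>\<dots>\<bar> \<le> \<bar>B\<bar> * \<bar>?g x\<bar>"
            unfolding abs_mult using V_pos[of x] VB[of x] by (intro mult_mono) auto
          finally show "norm (\<integral>r. norm (case (x, r) of (x, r) \<Rightarrow> V x r * ?g x) \<partial>lborel) \<le> norm (B * ?g x)"
            by (simp add: abs_mult)
        qed
      qed measurable
    qed (use V_int in auto)
    have "(\<integral>x. C * (\<integral>r. V x r \<partial>lborel) * ?g x \<partial>lborel) = C * (\<integral>x. \<integral>r. V x r * ?g x \<partial>lborel \<partial>lborel)"
      by (simp add: mult.assoc)
    also have "(\<integral>x. \<integral>r. V x r * ?g x \<partial>lborel \<partial>lborel) = (\<integral>r. \<integral>x. V x r * ?g x \<partial>lborel \<partial>lborel)"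
      using lborel_pair.Fubini_integral[OF int] by simp
    also have "0 \<le> C * \<dots>"
    proof (rule mult_nonneg_nonneg[OF C integral_nonneg_AE[OF AE_I2]])
      fix r :: real
      show "0 \<le> (\<integral>x. V x r * ?g x \<partial>lborel)"
      proof (cases "r > 0")
        case True
        have Ug: "integrable lborel (\<lambda>x. U c x * ?g x)" if "c \<ge> 1" for c
        proof (rule Bochner_Integration.integrable_bound)
          show "integrable lborel (\<lambda>x. U 1 0 * ?g x)" using g by simp
          show "AE x in lborel. norm (U c x * ?g x) \<le> norm (U 1 0 * ?g x)"
            using U0 U1[OF that] by (intro AE_I2) (simp add: abs_mult mult_right_mono)
        qed measurable
        have "(1 + r) powr (- s) * (\<integral>x. U (1 + r) x * ?g x \<partial>lborel) \<le> (\<integral>x. U 1 x * ?g x \<partial>lborel)"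
          unfolding U_def G_def using True by (intro fraclap_pairing_exp_scaled h s q) auto
        moreover have "(\<integral>x. W x r * ?g x \<partial>lborel) = (\<integral>x. U 1 x * ?g x \<partial>lborel) - (1 + r) powr (- s) * (\<integral>x. U (1 + r) x * ?g x \<partial>lborel)"
        proof -
          have "(\<integral>x. W x r * ?g x \<partial>lborel) = (\<integral>x. U 1 x * ?g x - (1 + r) powr (- s) * (U (1 + r) x * ?g x) \<partial>lborel)"
            by (intro Bochner_Integration.integral_cong refl) (simp add: W_def algebra_simps)
          then show ?thesis using Ug[of 1] Ug[of "1 + r"] True by simp
        qed
        moreover have "(\<integral>x. V x r * ?g x \<partial>lborel) = r powr (- s - 1) * (\<integral>x. W x r * ?g x \<partial>lborel)"
          using True by (simp add: V_def mult.assoc)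
        ultimately show ?thesis by simp
      qed (simp add: V_def)
    qed
    finally show "0 \<le> (\<integral>x. C * (\<integral>r. V x r \<partial>lborel) * ?g x \<partial>lborel)" .
  qed
qed

lemma fraclap_const: "fraclap s (\<lambda>y. c) x = 0"
proof -
  have "Lim (at_right (0::real)) (\<lambda>e. 0 :: real) = 0" by (intro tendsto_Lim) auto
  then show ?thesis by (simp add: fraclap_def)
qed

theorem theorem1p4:
  fixes k :: nat and s \<beta> :: real
  assumes "CARD('n) \<ge> 2"
    and "1 \<le> k" and "real k \<le> real (CARD('n)) / 2"
    and "s = real k / (real k + 1)"
    and "\<beta> = real (CARD('n)) / real k - 2"
  shows "fraclap_distr_nonneg s
           (\<lambda>x::real^'n. (- fraclap s (\<lambda>y::real^'n. - ((1 + (norm y)\<^sup>2) powr (-\<beta>/2))) x) ^ k)"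
proof -
  define \<gamma> where "\<gamma> = \<beta> / 2"
  have f: "(\<lambda>y::real^'n. - ((1 + (norm y)\<^sup>2) powr (-\<beta>/2))) = (\<lambda>y. - bubble \<gamma> y)"
    by (simp add: bubble_def \<gamma>_def)
  have s: "0 < s" "s < 1" using assms by auto
  have "2 \<le> real CARD('n) / real k" using assms(2,3) by (subst le_divide_eq) auto
  then have "\<beta> \<ge> 0" using assms(5) by simp
  have ks: "real k * (\<gamma> + s) = real CARD('n) / 2 - s"
  proof -
    have "real k * \<beta> = real CARD('n) - 2 * real k" using assms by (simp add: field_simps)
    moreover have "s * (real k + 1) = real k" using assms(4) by simp
    then have "real k * s + s = real k" by (simp add: algebra_simps)
    ultimately show ?thesis unfolding \<gamma>_def distrib_left times_divide_eq_right by linarith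
  qed
  have q: "0 < real CARD('n) / 2 - s" using assms s by linarith
  show ?thesis
  \<comment> \<open>For n = 2k the bubble is the constant 1 and has no representation as a Gamma
    mixture. Its fractional Laplacian vanishes, and so does the power, as
    \<open>k >= 1\<close>.\<close>
  proof (cases "\<beta> = 0")
    case True
    have "bubble \<gamma> y = 1" for y :: "real^'n"
      using True by (simp add: bubble_def \<gamma>_def add_nonneg_eq_0_iff)
    then show ?thesis using assms(2) unfolding f
      by (intro fraclap_distr_nonnegI[OF s, of _ 0]) (simp_all add: fraclap_const power_0_left)
  next
    case False
    then have \<gamma>: "\<gamma> > 0" using \<open>\<beta> \<ge> 0\<close> by (simp add: \<gamma>_def)
    show ?thesis
    proof (cases "k = 1")
      case True
      then show ?thesis using fraclap_bubble_distr_nonneg[OF s \<gamma>, where ?'n = 'n] ks unfolding f by simp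
    next
      case False
      then have k2: "2 \<le> real k" using assms(2) by simp
      \<comment> \<open>By \<open>ks\<close> and \<open>k >= 2\<close>, \<open>\<gamma> + s\<close>
        is at most half of \<open>N/2 - s\<close>. That this is at most \<open>N/2 - 1\<close> means
        \<open>N/2 + s >= 2\<close>, which holds since \<open>N/2 >= k >= 2\<close>.\<close>
      have e: "\<gamma> + s \<le> real CARD('n) / 2 - 1"
      proof -
        have "2 * (\<gamma> + s) \<le> real k * (\<gamma> + s)" using k2 \<gamma> s by (intro mult_right_mono) auto
        then have "\<gamma> + s \<le> (real CARD('n) / 2 - s) / 2" unfolding ks by simp
        also have "\<dots> \<le> real CARD('n) / 2 - 1" using k2 assms(3) s by simp
        finally show ?thesis .
      qed
      obtain \<phi> where \<phi>: "decr_density \<phi>" "\<And>x::real^'n. 0 \<le> - fraclap s (\<lambda>y. - bubble \<gamma> y) x"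
        "\<And>x::real^'n. ennreal (- fraclap s (\<lambda>y. - bubble \<gamma> y) x) = laplace (\<gamma> + s) \<phi> ((norm x)\<^sup>2)"
        using fraclap_bubble_laplace[OF s \<gamma> e] by blast
      obtain \<theta> where \<theta>: "decr_density \<theta>" "\<And>\<rho>. laplace (\<gamma> + s) \<phi> \<rho> ^ k = laplace (real k * (\<gamma> + s)) \<theta> \<rho>"
        using laplace_power[OF \<phi>(1) assms(2)] by blast
      define u where "u = (\<lambda>x::real^'n. (- fraclap s (\<lambda>y. - bubble \<gamma> y) x) ^ k)"
      have u0: "0 \<le> u x" for x unfolding u_def by (rule zero_le_power[OF \<phi>(2)])
      have u: "ennreal (u x) = laplace (real CARD('n) / 2 - s) \<theta> ((norm x)\<^sup>2)" for x
        using \<theta>(2)[of "(norm x)\<^sup>2"] unfolding u_def ks \<phi>(3)[symmetric] by (simp only: ennreal_power[OF \<phi>(2)])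
      have [measurable]: "\<theta> \<in> borel_measurable borel" using \<theta>(1) by (simp add: decr_density_def)
      show ?thesis
        unfolding f u_def[symmetric]
      proof (rule fraclap_distr_nonnegI[OF s])
        \<comment> \<open>\<open>fraclap\<close> is defined pointwise through a limit, so
          measurability of \<open>u\<close> is taken from its representation as a Laplace
          transform.\<close>
        have "(\<lambda>x. enn2real (laplace (real CARD('n) / 2 - s) \<theta> ((norm x)\<^sup>2))) \<in> borel_measurable (borel :: (real^'n) measure)"
          unfolding laplace_def by measurable
        also have "(\<lambda>x. enn2real (laplace (real CARD('n) / 2 - s) \<theta> ((norm x)\<^sup>2))) = u"
          using u0 by (simp add: fun_eq_iff flip: u)
        finally show "u \<in> borel_measurable borel" .
        show "\<bar>u x\<bar> \<le> u 0" for x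
        proof -
          have "ennreal (u x) \<le> ennreal (u 0)" unfolding u by (rule laplace_antimono) simp
          then show ?thesis using u0 by simp
        qed
        show "0 \<le> (\<integral>x. u x * fraclap s h x \<partial>lborel)" if "test_fun h" "\<And>x. 0 \<le> h x" for h
          by (rule laplace_pairing_nonneg[OF that s q \<theta>(1) u0 u])
      qed
    qed
  qed
qed

end
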